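(* Let $M=\mathrm{graph}_u$ be a locally Lipschitz minimal graph over $\mathbb{R}^n$ of codimension $m\ge2$ with $\sup_{\mathbb{R}^n}|\Lambda^2du|\le\Lambda$. Then there is a constant $C_{n,\Lambda}\ge1$ depending only on $n,\Lambda$ such that $M$ is contained in some affine subspace of dimension $\le C_{n,\Lambda}$, and for any ball $\mathbf{B}_r(\mathbf{x})$ in $\mathbb{R}^{n+m}$ $$\mathcal{H}^n(M\cap\mathbf{B}_r(\mathbf{x}))\le C_{n,\Lambda}\,\omega_nr^n.$$
   Context: For a locally Lipschitz map $u=(u^1,\dots,u^m):\mathbb{R}^n\to\mathbb{R}^m$, $M=\mathrm{graph}_u=\{(x,u(x)):x\in\mathbb{R}^n\}\subset\mathbb{R}^{n+m}$. $M$ is a (locally Lipschitz) minimal graph if the multiplicity-one $n$-varifold $|M|$ associated with $M$ is stationary in $\mathbb{R}^{n+m}$. At points of differentiability let $\lambda_1,\dots,\lambda_n\ge0$ be the singular values of $Du$ ($\lambda_i^2$ are the eigenvalues of the $n\times n$ matrix $(\sum_\alpha\partial_iu^\alpha\partial_ju^\alpha)$); the 2-dilation is $|\Lambda^2du|=\sup_{i\ne j}\lambda_i\lambda_j$, and the bound on it is understood almost everywhere. $\mathbf{B}_r(\mathbf{x})$ is the ball in $\mathbb{R}^{n+m}$ of radius $r$ centered at $\mathbf{x}$; $\omega_n$ is the volume of the unit ball of $\mathbb{R}^n$. *)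

theory Defs
  imports "HOL-Analysis.Analysis"
begin

section \<open>A common home for all spaces \<open>\<real>\<^sup>m\<close>\<close>

text \<open>
  The codimension \<open>m\<close> has to be quantified inside the statement (after the constant), so it cannot
  be a type. All \<open>\<real>\<^sup>m\<close> are therefore realised as the subspaces of sequences vanishing from index
  \<open>m\<close> on, inside the space of finitely supported sequences with the Euclidean inner product.
  (The library's norm on \<open>nat \<Rightarrow>\<^sub>0 real\<close> is the sum norm, so that type cannot be used.)
\<close>

typedef fin_seq = "{f :: nat \<Rightarrow> real. finite {i. f i \<noteq> 0}}"
  morphisms coord Abs_fin_seq
  by (rule exI[of _ "\<lambda>_. 0"]) simp

setup_lifting type_definition_fin_seq

lemma finite_coord_support: "finite {i. coord x i \<noteq> 0}"
  using coord[of x] by simp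

lemma fin_seq_eqI: "(\<And>i. coord x i = coord y i) \<Longrightarrow> x = y"
  by (simp add: coord_inject[symmetric] fun_eq_iff)

instantiation fin_seq :: real_vector
begin

lift_definition zero_fin_seq :: fin_seq is "\<lambda>_. 0" by simp

lift_definition plus_fin_seq :: "fin_seq \<Rightarrow> fin_seq \<Rightarrow> fin_seq" is "\<lambda>f g i. f i + g i"
  subgoal for f g by (rule finite_subset[of _ "{i. f i \<noteq> 0} \<union> {i. g i \<noteq> 0}"]) auto
  done

lift_definition minus_fin_seq :: "fin_seq \<Rightarrow> fin_seq \<Rightarrow> fin_seq" is "\<lambda>f g i. f i - g i"
  subgoal for f g by (rule finite_subset[of _ "{i. f i \<noteq> 0} \<union> {i. g i \<noteq> 0}"]) auto
  done

lift_definition uminus_fin_seq :: "fin_seq \<Rightarrow> fin_seq" is "\<lambda>f i. - f i"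
  by simp

lift_definition scaleR_fin_seq :: "real \<Rightarrow> fin_seq \<Rightarrow> fin_seq" is "\<lambda>c f i. c * f i"
  by (rule finite_subset[rotated]) auto

instance
  by (standard; transfer; simp add: algebra_simps)

end

instantiation fin_seq :: real_inner
begin

definition inner_fin_seq :: "fin_seq \<Rightarrow> fin_seq \<Rightarrow> real" where
  "inner_fin_seq x y = (\<Sum>i | coord x i \<noteq> 0. coord x i * coord y i)"

definition norm_fin_seq :: "fin_seq \<Rightarrow> real" where
  "norm_fin_seq x = sqrt (inner x x)"

definition sgn_fin_seq :: "fin_seq \<Rightarrow> fin_seq" where
  "sgn_fin_seq x = x /\<^sub>R norm x"

definition dist_fin_seq :: "fin_seq \<Rightarrow> fin_seq \<Rightarrow> real" where
  "dist_fin_seq x y = norm (x - y)"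

definition uniformity_fin_seq :: "(fin_seq \<times> fin_seq) filter" where
  "uniformity_fin_seq = (INF e\<in>{0<..}. principal {(x, y). dist x y < e})"

definition open_fin_seq :: "fin_seq set \<Rightarrow> bool" where
  "open_fin_seq U = (\<forall>x\<in>U. \<forall>\<^sub>F (x', y) in uniformity. x' = x \<longrightarrow> y \<in> U)"

lemma inner_fin_seq_superset:
  assumes "finite I" "{i. coord x i \<noteq> 0} \<subseteq> I"
  shows "inner x y = (\<Sum>i\<in>I. coord x i * coord y i)"
  unfolding inner_fin_seq_def using assms by (intro sum.mono_neutral_left) auto

instance
proof
  fix x y z :: fin_seq and r :: real
  let ?I = "{i. coord x i \<noteq> 0} \<union> {i. coord y i \<noteq> 0} \<union> {i. coord z i \<noteq> 0}"
  have I: "finite ?I" by (simp add: finite_coord_support)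
  have *: "inner a b = (\<Sum>i\<in>?I. coord a i * coord b i)" if "{i. coord a i \<noteq> 0} \<subseteq> ?I" for a b
    using inner_fin_seq_superset[OF I that] .
  have s: "{i. coord (x + y) i \<noteq> 0} \<subseteq> ?I" "{i. coord (r *\<^sub>R x) i \<noteq> 0} \<subseteq> ?I"
    by (auto simp: plus_fin_seq.rep_eq scaleR_fin_seq.rep_eq)
  show "inner x y = inner y x"
    by (subst (1 2) *) (auto simp: mult.commute)
  show "inner (x + y) z = inner x z + inner y z"
    using s by (subst (1 2 3) *) (auto simp: plus_fin_seq.rep_eq distrib_right sum.distrib)
  show "inner (scaleR r x) y = r * inner x y"
    using s by (subst (1 2) *) (auto simp: scaleR_fin_seq.rep_eq sum_distrib_left mult.assoc)
  show "0 \<le> inner x x"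
    unfolding inner_fin_seq_def by (intro sum_nonneg) auto
  show "inner x x = 0 \<longleftrightarrow> x = 0"
    unfolding inner_fin_seq_def
    by (subst sum_nonneg_eq_0_iff)
       (auto simp: finite_coord_support coord_inject[symmetric] fun_eq_iff zero_fin_seq.rep_eq)
qed (simp_all add: norm_fin_seq_def sgn_fin_seq_def dist_fin_seq_def uniformity_fin_seq_def
       open_fin_seq_def)

end

definition coord_space :: "nat \<Rightarrow> fin_seq set" where
  "coord_space m = {y. \<forall>i\<ge>m. coord y i = 0}"

lemma inner_coord_space:
  assumes "x \<in> coord_space m"
  shows "inner x y = (\<Sum>i<m. coord x i * coord y i)"
  using assms by (intro inner_fin_seq_superset) (auto simp: coord_space_def not_le[symmetric])

text \<open>\<open>\<real>\<^bsup>n+m\<^esup>\<close> as a subspace of \<open>\<real>\<^sup>n \<times> fin_seq\<close>:\<close>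

definition ambient :: "nat \<Rightarrow> ((real ^ 'n) \<times> fin_seq) set" where
  "ambient m = UNIV \<times> coord_space m"


section \<open>Hausdorff measure\<close>

text \<open>
  Normalised so that the \<open>k\<close>-dimensional measure is Lebesgue measure on \<open>\<real>\<^sup>k\<close>. The empty set gets
  weight \<open>0\<close> explicitly because \<open>0 ^ 0 = 1\<close>; boundedness is required because \<^const>\<open>diameter\<close> is
  meaningless for unbounded sets.
\<close>

definition hausdorff_weight :: "nat \<Rightarrow> 'a::metric_space set \<Rightarrow> ennreal" where
  "hausdorff_weight k S =
     (if S = {} then 0 else ennreal (unit_ball_vol (real k) * (diameter S / 2) ^ k))"

definition hausdorff_covers :: "real \<Rightarrow> 'a::metric_space set \<Rightarrow> (nat \<Rightarrow> 'a set) set" where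
  "hausdorff_covers \<delta> S = {A. S \<subseteq> (\<Union>i. A i) \<and> (\<forall>i. bounded (A i) \<and> diameter (A i) \<le> \<delta>)}"

definition hausdorff_pre :: "nat \<Rightarrow> real \<Rightarrow> 'a::metric_space set \<Rightarrow> ennreal" where
  "hausdorff_pre k \<delta> S = (INF A\<in>hausdorff_covers \<delta> S. \<Sum>i. hausdorff_weight k (A i))"

definition hausdorff_outer :: "nat \<Rightarrow> 'a::metric_space set \<Rightarrow> ennreal" where
  "hausdorff_outer k S = (SUP \<delta>\<in>{0<..}. hausdorff_pre k \<delta> S)"

definition hausdorff_measure :: "nat \<Rightarrow> 'a::metric_space measure" where
  "hausdorff_measure k = measure_of UNIV (sets borel) (hausdorff_outer k)"

lemma hausdorff_weight_empty [simp]: "hausdorff_weight k {} = 0"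
  by (simp add: hausdorff_weight_def)

lemma hausdorff_pre_le:
  "A \<in> hausdorff_covers \<delta> S \<Longrightarrow> hausdorff_pre k \<delta> S \<le> (\<Sum>i. hausdorff_weight k (A i))"
  unfolding hausdorff_pre_def by (rule INF_lower)

lemma hausdorff_pre_mono: "S \<subseteq> T \<Longrightarrow> hausdorff_pre k \<delta> S \<le> hausdorff_pre k \<delta> T"
  unfolding hausdorff_pre_def by (rule INF_superset_mono) (auto simp: hausdorff_covers_def)

lemma hausdorff_pre_antimono: "\<delta> \<le> \<epsilon> \<Longrightarrow> hausdorff_pre k \<epsilon> S \<le> hausdorff_pre k \<delta> S"
  unfolding hausdorff_pre_def
  by (rule INF_superset_mono) (auto simp: hausdorff_covers_def intro: order_trans)

lemma hausdorff_pre_empty: "0 < \<delta> \<Longrightarrow> hausdorff_pre k \<delta> {} = 0"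
  using hausdorff_pre_le[of "\<lambda>_. {}" \<delta> "{}" k] by (simp add: hausdorff_covers_def)

lemma hausdorff_pre_UN: "hausdorff_pre k \<delta> (\<Union>n. S n) \<le> (\<Sum>n. hausdorff_pre k \<delta> (S n))"
proof (rule ennreal_le_epsilon)
  fix e :: real assume e: "0 < e" and fin: "(\<Sum>n. hausdorff_pre k \<delta> (S n)) < top"
  have "\<exists>B\<in>hausdorff_covers \<delta> (S n).
      (\<Sum>i. hausdorff_weight k (B i)) \<le> hausdorff_pre k \<delta> (S n) + e * (1/2) ^ Suc n" for n
  proof -
    have "hausdorff_pre k \<delta> (S n) < hausdorff_pre k \<delta> (S n) + e * (1/2) ^ Suc n"
      using e fin by (auto simp add: less_top dest!: ennreal_suminf_lessD)
    then show ?thesis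
      unfolding hausdorff_pre_def INF_less_iff by (meson less_imp_le)
  qed
  then obtain B where B: "\<And>n. B n \<in> hausdorff_covers \<delta> (S n)"
    and Ble: "\<And>n. (\<Sum>i. hausdorff_weight k (B n i))
      \<le> hausdorff_pre k \<delta> (S n) + e * (1/2) ^ Suc n"
    by metis
  define C where "C = case_prod B o prod_decode"
  have "C \<in> hausdorff_covers \<delta> (\<Union>n. S n)"
    using B unfolding hausdorff_covers_def C_def
    by (auto simp: subset_eq split_def) (metis fst_conv snd_conv prod_encode_inverse)
  then have "hausdorff_pre k \<delta> (\<Union>n. S n) \<le> (\<Sum>i. hausdorff_weight k (C i))"
    by (rule hausdorff_pre_le)
  also have "\<dots> = (\<Sum>i. (\<lambda>p. hausdorff_weight k (case_prod B p)) (prod_decode i))"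
    by (simp add: C_def)
  also have "\<dots> = (\<Sum>n. \<Sum>i. hausdorff_weight k (B n i))"
    by (rule suminf_ennreal_2dimen) simp
  also have "\<dots> \<le> (\<Sum>n. hausdorff_pre k \<delta> (S n) + e * (1/2) ^ Suc n)"
    by (intro suminf_le allI Ble) auto
  also have "\<dots> = (\<Sum>n. hausdorff_pre k \<delta> (S n)) + (\<Sum>n. ennreal e * ennreal ((1/2) ^ Suc n))"
    using e by (subst suminf_add[symmetric])
      (auto simp del: ennreal_suminf_cmult simp add: ennreal_mult[symmetric])
  also have "\<dots> = (\<Sum>n. hausdorff_pre k \<delta> (S n)) + e"
    unfolding ennreal_suminf_cmult
    by (subst suminf_ennreal_eq[OF zero_le_power power_half_series]) auto
  finally show "hausdorff_pre k \<delta> (\<Union>n. S n) \<le> (\<Sum>n. hausdorff_pre k \<delta> (S n)) + e" .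
qed

lemma hausdorff_pre_separated:
  assumes "\<And>x y. x \<in> A \<Longrightarrow> y \<in> B \<Longrightarrow> \<delta> < dist x y"
  shows "hausdorff_pre k \<delta> A + hausdorff_pre k \<delta> B \<le> hausdorff_pre k \<delta> (A \<union> B)"
  unfolding hausdorff_pre_def[of k \<delta> "A \<union> B"]
proof (rule INF_greatest)
  fix C assume C: "C \<in> hausdorff_covers \<delta> (A \<union> B)"
  define D where "D = (\<lambda>i. if C i \<inter> A = {} then {} else C i)"
  define E where "E = (\<lambda>i. if C i \<inter> A = {} then C i else {})"
  have *: "bounded (C i)" "diameter (C i) \<le> \<delta>" for i
    using C by (auto simp: hausdorff_covers_def)
  have \<delta>: "0 \<le> \<delta>"
    using *[of 0] diameter_ge_0 order_trans by blast
  have "y \<in> \<Union> (range E)" if y: "y \<in> B" for y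
  proof -
    obtain i where i: "y \<in> C i"
      using C y by (auto simp: hausdorff_covers_def)
    have "C i \<inter> A = {}"
    proof (rule ccontr)
      assume "C i \<inter> A \<noteq> {}"
      then obtain x where x: "x \<in> C i" "x \<in> A" by auto
      have "dist x y \<le> \<delta>"
        using diameter_bounded_bound[OF *(1) x(1) i] *(2)[of i] by simp
      then show False
        using assms[OF x(2) y] by simp
    qed
    then show ?thesis
      using i by (auto simp: E_def)
  qed
  then have "E \<in> hausdorff_covers \<delta> B"
    using * \<delta> by (auto simp: hausdorff_covers_def E_def)
  moreover have "D \<in> hausdorff_covers \<delta> A"
    using C \<delta> unfolding hausdorff_covers_def D_def by (auto simp: subset_eq) blast
  ultimately have "hausdorff_pre k \<delta> A + hausdorff_pre k \<delta> B
      \<le> (\<Sum>i. hausdorff_weight k (D i)) + (\<Sum>i. hausdorff_weight k (E i))"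
    by (intro add_mono hausdorff_pre_le)
  also have "\<dots> = (\<Sum>i. hausdorff_weight k (D i) + hausdorff_weight k (E i))"
    by (rule suminf_add) auto
  also have "\<dots> = (\<Sum>i. hausdorff_weight k (C i))"
    by (intro suminf_cong) (simp add: D_def E_def)
  finally show "hausdorff_pre k \<delta> A + hausdorff_pre k \<delta> B \<le> (\<Sum>i. hausdorff_weight k (C i))" .
qed

lemma hausdorff_pre_le_outer: "0 < \<delta> \<Longrightarrow> hausdorff_pre k \<delta> S \<le> hausdorff_outer k S"
  unfolding hausdorff_outer_def by (rule SUP_upper) simp

lemma hausdorff_outer_mono: "S \<subseteq> T \<Longrightarrow> hausdorff_outer k S \<le> hausdorff_outer k T"
  unfolding hausdorff_outer_def by (intro SUP_mono) (auto intro: hausdorff_pre_mono)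

lemma hausdorff_outer_empty [simp]: "hausdorff_outer k {} = 0"
  by (simp add: hausdorff_outer_def hausdorff_pre_empty)

lemma hausdorff_outer_UN:
  "hausdorff_outer k (\<Union>n. S n) \<le> (\<Sum>n. hausdorff_outer k (S n))"
  unfolding hausdorff_outer_def[of k "\<Union>n. S n"]
proof (rule SUP_least)
  fix \<delta> :: real assume "\<delta> \<in> {0<..}"
  then have "(\<Sum>n. hausdorff_pre k \<delta> (S n)) \<le> (\<Sum>n. hausdorff_outer k (S n))"
    by (intro suminf_le hausdorff_pre_le_outer) auto
  with hausdorff_pre_UN show "hausdorff_pre k \<delta> (\<Union>n. S n) \<le> (\<Sum>n. hausdorff_outer k (S n))"
    by (rule order_trans)
qed

lemma outer_measure_space_hausdorff: "outer_measure_space (Pow UNIV) (hausdorff_outer k)"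
  by (auto simp: outer_measure_space_def positive_def increasing_def countably_subadditive_def
      hausdorff_outer_mono hausdorff_outer_UN)

lemma hausdorff_outer_Un: "hausdorff_outer k (S \<union> T) \<le> hausdorff_outer k S + hausdorff_outer k T"
proof -
  interpret sigma_algebra UNIV "Pow UNIV :: 'a set set" by (rule sigma_algebra_Pow)
  have "subadditive (Pow UNIV) (hausdorff_outer k :: 'a set \<Rightarrow> ennreal)"
    using outer_measure_space_hausdorff[of k]
    by (intro countably_subadditive_subadditive) (auto simp: outer_measure_space_def)
  then have "hausdorff_outer k (S \<union> (T - S)) \<le> hausdorff_outer k S + hausdorff_outer k (T - S)"
    by (rule subadditiveD) auto
  also have "\<dots> \<le> hausdorff_outer k S + hausdorff_outer k T"
    by (intro add_left_mono hausdorff_outer_mono) auto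
  finally show ?thesis by simp
qed

lemma hausdorff_outer_eq_seq:
  assumes "0 < d"
  shows "hausdorff_outer k S = (SUP n. hausdorff_pre k (d / real (n + 2)) S)"
proof (rule antisym)
  show "hausdorff_outer k S \<le> (SUP n. hausdorff_pre k (d / real (n + 2)) S)"
    unfolding hausdorff_outer_def
  proof (rule SUP_least)
    fix \<delta> :: real assume "\<delta> \<in> {0<..}"
    then have \<delta>: "0 < \<delta>" by simp
    obtain n :: nat where n: "d / \<delta> < real n"
      using reals_Archimedean2 by blast
    have "d \<le> \<delta> * real (n + 2)"
      using n \<delta> by (simp add: field_simps)
    then have "d / real (n + 2) \<le> \<delta>"
      by (simp add: divide_le_eq)
    then show "hausdorff_pre k \<delta> S \<le> (SUP n. hausdorff_pre k (d / real (n + 2)) S)"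
      by (intro SUP_upper2[of n] hausdorff_pre_antimono) auto
  qed
qed (use assms in \<open>intro SUP_least hausdorff_pre_le_outer, auto\<close>)

lemma hausdorff_outer_separated:
  assumes d: "0 < d" and AB: "\<And>x y. x \<in> A \<Longrightarrow> y \<in> B \<Longrightarrow> d \<le> dist x y"
  shows "hausdorff_outer k (A \<union> B) = hausdorff_outer k A + hausdorff_outer k B"
proof (rule antisym[OF hausdorff_outer_Un])
  have inc: "incseq (\<lambda>n. hausdorff_pre k (d / real (n + 2)) S)" for S :: "'a set"
    using d by (intro monoI hausdorff_pre_antimono divide_left_mono) auto
  have small: "d / real (n + 2) < d" for n
    using d by (simp add: divide_less_eq)
  have "hausdorff_outer k A + hausdorff_outer k B
      = (SUP n. hausdorff_pre k (d / real (n + 2)) A + hausdorff_pre k (d / real (n + 2)) B)"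
    unfolding hausdorff_outer_eq_seq[OF d] by (rule ennreal_SUP_add[OF inc inc, symmetric])
  also have "\<dots> \<le> (SUP n. hausdorff_pre k (d / real (n + 2)) (A \<union> B))"
    using AB small by (intro SUP_mono' hausdorff_pre_separated) (meson less_le_trans)
  also have "\<dots> = hausdorff_outer k (A \<union> B)"
    by (rule hausdorff_outer_eq_seq[OF d, symmetric])
  finally show "hausdorff_outer k A + hausdorff_outer k B \<le> hausdorff_outer k (A \<union> B)" .
qed

lemma hausdorff_outer_separated_sum:
  fixes D :: "nat \<Rightarrow> 'a::metric_space set"
  assumes "\<And>m. 0 < d m" "\<And>n m x y. n < m \<Longrightarrow> x \<in> D n \<Longrightarrow> y \<in> D m \<Longrightarrow> d n \<le> dist x y"
  shows "(\<Sum>n<N. hausdorff_outer k (D n)) = hausdorff_outer k (\<Union>n<N. D n)"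
proof (induction N)
  case (Suc N)
  show ?case
  proof (cases "N = 0")
    case False
    define e where "e = Min (d ` {..<N})"
    have "0 < e"
      unfolding e_def using False assms(1) by (subst Min_gr_iff) auto
    moreover have "e \<le> dist x y" if "x \<in> (\<Union>n<N. D n)" "y \<in> D N" for x y
    proof -
      from that(1) obtain n where n: "n < N" "x \<in> D n" by auto
      have "e \<le> d n" unfolding e_def using n by (intro Min_le) auto
      then show ?thesis using assms(2)[OF n that(2)] by simp
    qed
    ultimately have "hausdorff_outer k ((\<Union>n<N. D n) \<union> D N)
        = hausdorff_outer k (\<Union>n<N. D n) + hausdorff_outer k (D N)"
      by (rule hausdorff_outer_separated)
    then show ?thesis
      using Suc by (simp add: lessThan_Suc Un_commute)
  qed (simp add: lessThan_Suc)
qed simp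

lemma closed_in_lambda_system_hausdorff:
  fixes F :: "'a::metric_space set"
  assumes F: "closed F"
  shows "F \<in> lambda_system UNIV (Pow UNIV) (hausdorff_outer k)"
proof -
  let ?H = "hausdorff_outer k :: 'a set \<Rightarrow> ennreal"
  have "?H (A \<inter> F) + ?H (A - F) \<le> ?H A" for A
  proof (cases "F = {} \<or> ?H A = top")
    case False
    then have ne: "F \<noteq> {}" and fin: "?H A < top" by (auto simp: less_top)
    define B where "B n = {x \<in> A. 1 / real (Suc n) \<le> infdist x F}" for n
    define D where "D n = B (Suc n) - B n" for n
    define f where "f n = ?H (D n)" for n
    have far: "1 / real (Suc n) - 1 / real (Suc m) \<le> dist x y"
      if "x \<in> B n" "y \<notin> B m" "y \<in> A" for x y n m
    proof -
      have "1 / real (Suc n) \<le> infdist x F" "infdist y F < 1 / real (Suc m)"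
        using that by (auto simp: B_def)
      moreover have "infdist x F \<le> infdist y F + dist x y" by (rule infdist_triangle)
      ultimately show ?thesis by linarith
    qed
    have DA: "D n \<subseteq> A" for n by (auto simp: D_def B_def)
    have half: "(\<Sum>n<N. f (2 * n + c)) \<le> ?H A" for N c
    proof -
      define d where "d n = 1 / real (Suc (Suc (2 * n + c))) - 1 / real (Suc (Suc (Suc (2 * n + c))))"
        for n
      have "(\<Sum>n<N. ?H (D (2 * n + c))) = ?H (\<Union>n<N. D (2 * n + c))"
      proof (rule hausdorff_outer_separated_sum)
        show "0 < d n" for n
          by (simp add: d_def divide_simps)
        fix n m :: nat and x y
        assume nm: "n < m" and x: "x \<in> D (2 * n + c)" and y: "y \<in> D (2 * m + c)"
        have "1 / real (Suc (2 * m + c)) \<le> 1 / real (Suc (Suc (Suc (2 * n + c))))"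
          using nm by (intro divide_left_mono) auto
        moreover have "1 / real (Suc (Suc (2 * n + c))) - 1 / real (Suc (2 * m + c)) \<le> dist x y"
          using x y DA by (intro far) (auto simp: D_def)
        ultimately show "d n \<le> dist x y"
          by (simp add: d_def)
      qed
      also have "\<dots> \<le> ?H A"
        using DA by (intro hausdorff_outer_mono) auto
      finally show ?thesis by (simp add: f_def)
    qed
    have double: "(\<Sum>n<2 * N. f n) = (\<Sum>n<N. f (2 * n + 0)) + (\<Sum>n<N. f (2 * n + 1))" for N
      by (induction N) (simp_all add: algebra_simps)
    have "(\<Sum>n<N. f n) \<le> ?H A + ?H A" for N
    proof -
      have "(\<Sum>n<N. f n) \<le> (\<Sum>n<2 * N. f n)"
        by (intro sum_mono2) auto
      also have "\<dots> \<le> ?H A + ?H A"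
        unfolding double by (intro add_mono half)
      finally show ?thesis .
    qed
    then have "suminf f \<le> ?H A + ?H A"
      by (intro suminf_le_const) auto
    with fin have sumfin: "suminf f < top"
      by (metis ennreal_add_less_top le_less_trans)
    define g where "g n = enn2real (f n)" for n
    have "f n < top" for n
      using sumfin by (rule ennreal_suminf_lessD)
    then have fg: "f n = ennreal (g n)" for n
      by (simp add: g_def)
    have g0: "0 \<le> g n" for n by (simp add: g_def)
    have gs: "summable g"
      using sumfin g0 by (intro summable_suminf_not_top) (auto simp flip: fg simp: fun_eq_iff)
    show ?thesis
    proof (rule ennreal_le_epsilon)
      fix e :: real assume e: "0 < e"
      obtain N where N: "\<And>n. n \<ge> N \<Longrightarrow> norm (\<Sum>i. g (i + n)) < e"
        using suminf_exist_split[OF e gs] by blast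
      have tail: "(\<Sum>i. f (i + N)) \<le> ennreal e"
      proof -
        have "(\<Sum>i. f (i + N)) = ennreal (\<Sum>i. g (i + N))"
          unfolding fg using g0 gs by (intro suminf_ennreal2) (auto simp: summable_iff_shift)
        then show ?thesis using N[of N] by (auto intro: ennreal_leI)
      qed
      have cover: "A - F \<subseteq> B N \<union> (\<Union>i. D (i + N))"
      proof
        fix x assume x: "x \<in> A - F"
        then have "0 < infdist x F"
          using F ne by (auto intro: infdist_pos_not_in_closed)
        then obtain j where j: "1 / real (Suc j) < infdist x F"
          using nat_approx_posE by metis
        then have xj: "x \<in> B j" using x by (simp add: B_def)
        define l where "l = (LEAST j. x \<in> B j)"
        have l: "x \<in> B l" and min: "\<And>i. i < l \<Longrightarrow> x \<notin> B i"
          unfolding l_def using xj by (auto intro: LeastI dest: not_less_Least)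
        show "x \<in> B N \<union> (\<Union>i. D (i + N))"
        proof (cases "l \<le> N")
          case True
          have "1 / real (Suc N) \<le> 1 / real (Suc l)"
            using True by (intro divide_left_mono) auto
          with l have "x \<in> B N" by (auto simp: B_def intro: order_trans)
          then show ?thesis by simp
        next
          case False
          then obtain i where "l = Suc (i + N)"
            by (metis add.commute add_Suc_right less_imp_Suc_add not_le)
          with l min have "x \<in> D (i + N)" by (auto simp: D_def)
          then show ?thesis by blast
        qed
      qed
      have "?H (A - F) \<le> ?H (B N \<union> (\<Union>i. D (i + N)))"
        by (rule hausdorff_outer_mono[OF cover])
      also have "\<dots> \<le> ?H (B N) + ?H (\<Union>i. D (i + N))"
        by (rule hausdorff_outer_Un)
      also have "\<dots> \<le> ?H (B N) + (\<Sum>i. f (i + N))"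
        unfolding f_def by (intro add_left_mono hausdorff_outer_UN)
      also have "\<dots> \<le> ?H (B N) + ennreal e"
        by (intro add_left_mono tail)
      finally have "?H (A \<inter> F) + ?H (A - F) \<le> (?H (A \<inter> F) + ?H (B N)) + ennreal e"
        by (simp add: add_left_mono add.assoc)
      also have "?H (A \<inter> F) + ?H (B N) = ?H ((A \<inter> F) \<union> B N)"
      proof (rule hausdorff_outer_separated[symmetric])
        fix x y assume "x \<in> A \<inter> F" "y \<in> B N"
        then have "infdist y F \<le> dist y x" "1 / real (Suc N) \<le> infdist y F"
          by (auto simp: B_def intro: infdist_le)
        then show "1 / real (Suc N) \<le> dist x y" by (simp add: dist_commute)
      qed simp
      also have "\<dots> \<le> ?H A"
        by (intro hausdorff_outer_mono) (auto simp: B_def)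
      finally show "?H (A \<inter> F) + ?H (A - F) \<le> ?H A + ennreal e"
        by (simp add: add_right_mono)
    qed
  qed auto
  moreover have "?H A \<le> ?H (A \<inter> F) + ?H (A - F)" for A
    using hausdorff_outer_Un[of k "A \<inter> F" "A - F"] by (simp add: Int_Diff_Un)
  ultimately show ?thesis
    by (auto simp: lambda_system_def intro!: antisym)
       (simp_all add: Int_commute Diff_eq)
qed

text \<open>Borel sets are Caratheodory measurable, so \<^const>\<open>measure_of\<close> does not degenerate here.\<close>

lemma measure_space_hausdorff: "measure_space UNIV (sets borel) (hausdorff_outer k)"
proof -
  interpret sigma_algebra UNIV "Pow UNIV :: 'a set set" by (rule sigma_algebra_Pow)
  let ?L = "lambda_system UNIV (Pow UNIV) (hausdorff_outer k :: 'a set \<Rightarrow> ennreal)"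
  have L: "measure_space UNIV ?L (hausdorff_outer k)"
    by (rule caratheodory_lemma[OF outer_measure_space_hausdorff])
  then interpret L: sigma_algebra UNIV ?L by (simp add: measure_space_def)
  have "sigma_sets UNIV (Collect closed) \<subseteq> ?L"
    by (rule L.sigma_sets_subset) (auto intro: closed_in_lambda_system_hausdorff simp del: Pow_UNIV)
  then have "sets borel \<subseteq> ?L"
    unfolding borel_eq_closed by simp
  then show ?thesis
    using L sets.sigma_algebra_axioms[of "borel :: 'a measure"]
    by (auto simp: measure_space_def positive_def countably_additive_def subset_eq)
qed

lemma sets_hausdorff_measure [simp]: "sets (hausdorff_measure k) = sets borel"
  unfolding hausdorff_measure_def by (metis sets.sets_measure_of_eq space_borel)

lemma emeasure_hausdorff_measure:
  "A \<in> sets borel \<Longrightarrow> emeasure (hausdorff_measure k) A = hausdorff_outer k A"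
  unfolding hausdorff_measure_def using measure_space_hausdorff[of k]
  by (intro emeasure_measure_of_sigma) (auto simp: measure_space_def)

section \<open>Singular values and the 2-dilation\<close>

definition gram_matrix :: "(real ^ 'n \<Rightarrow> 'b::real_inner) \<Rightarrow> real ^ 'n ^ 'n" where
  "gram_matrix L = (\<chi> i j. L (axis i 1) \<bullet> L (axis j 1))"

text \<open>
  \<open>l\<close> lists the singular values of \<open>L\<close> with multiplicity: the \<open>(l i)\<^sup>2\<close> are the roots, with
  multiplicity, of the characteristic polynomial of the Gram matrix. The family \<open>l\<close> is unique up
  to permutation of the index set.
\<close>

definition singular_values :: "(real ^ 'n \<Rightarrow> 'b::real_inner) \<Rightarrow> ('n \<Rightarrow> real) \<Rightarrow> bool" where
  "singular_values L l \<longleftrightarrow>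
     (\<forall>i. 0 \<le> l i) \<and> (\<forall>t. det (mat t - gram_matrix L) = (\<Prod>i\<in>UNIV. t - (l i)\<^sup>2))"

text \<open>The inserted \<open>0\<close> only matters for \<open>n = 1\<close>, where there is no pair of distinct indices.\<close>

definition two_dilation :: "(real ^ 'n \<Rightarrow> 'b::real_inner) \<Rightarrow> real" where
  "two_dilation L = Sup (insert 0 {l i * l j | l i j. singular_values L l \<and> i \<noteq> j})"


section \<open>Minimal graphs\<close>

definition locally_lipschitz :: "('a::metric_space \<Rightarrow> 'b::metric_space) \<Rightarrow> bool" where
  "locally_lipschitz u \<longleftrightarrow> (\<forall>x. \<exists>e>0. \<exists>L. L-lipschitz_on (ball x e) u)"

definition graph_of :: "('a \<Rightarrow> 'b) \<Rightarrow> ('a \<times> 'b) set" where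
  "graph_of u = range (\<lambda>x. (x, u x))"

text \<open>
  The part of the graph where it has a tangent plane; by Rademacher's theorem it is all of the graph
  up to an \<open>n\<close>-dimensional Hausdorff null set.
\<close>

definition regular_graph ::
    "('a::real_normed_vector \<Rightarrow> 'b::real_normed_vector) \<Rightarrow> ('a \<times> 'b) set" where
  "regular_graph u = {(x, u x) | x. u differentiable at x}"

definition tangent_plane ::
    "('a::real_normed_vector \<Rightarrow> 'b::real_normed_vector) \<Rightarrow> 'a \<times> 'b \<Rightarrow> ('a \<times> 'b) set" where
  "tangent_plane u z = range (\<lambda>v. (v, frechet_derivative u (at (fst z)) v))"

definition orthonormal_basis :: "'e::real_inner set \<Rightarrow> 'e set \<Rightarrow> bool" where
  "orthonormal_basis B S \<longleftrightarrow>
     finite B \<and> pairwise orthogonal B \<and> (\<forall>b\<in>B. norm b = 1) \<and> span B = S"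

text \<open>
  The divergence along the subspace \<open>S\<close> of a vector field with derivative \<open>D\<close>, i.e. the trace of
  \<open>D\<close> on \<open>S\<close>. It does not depend on the chosen basis.
\<close>

definition tangential_div :: "('e::real_inner \<Rightarrow> 'e) \<Rightarrow> 'e set \<Rightarrow> real" where
  "tangential_div D S = (\<Sum>b\<in>(SOME B. orthonormal_basis B S). D b \<bullet> b)"

text \<open>
  \<open>X\<close> is a \<open>C\<^sup>1\<close> vector field with compact support on the finite-dimensional space \<open>E\<close>, with
  derivative \<open>X'\<close>.
\<close>

definition test_field ::
    "'e::real_normed_vector set \<Rightarrow> ('e \<Rightarrow> 'e) \<Rightarrow> ('e \<Rightarrow> 'e \<Rightarrow> 'e) \<Rightarrow> bool" where
  "test_field E X X' \<longleftrightarrow>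
     X ` E \<subseteq> E \<and>
     (\<forall>z\<in>E. (X has_derivative X' z) (at z within E)) \<and>
     (\<forall>v\<in>E. continuous_on E (\<lambda>z. X' z v)) \<and>
     (\<exists>K. compact K \<and> K \<subseteq> E \<and> (\<forall>z\<in>E - K. X z = 0))"

text \<open>
  The multiplicity-one \<open>k\<close>-varifold carried by \<open>M\<close> with tangent planes \<open>T\<close> is the image of the
  \<open>k\<close>-dimensional Hausdorff measure on \<open>M\<close> under \<open>z \<mapsto> (z, T z)\<close>. The integral below is its first
  variation, the integral of \<open>div\<^sub>S X (z)\<close> with respect to \<open>(z, S)\<close>.
\<close>

definition stationary_varifold ::
    "'e::real_inner set \<Rightarrow> nat \<Rightarrow> 'e set \<Rightarrow> ('e \<Rightarrow> 'e set) \<Rightarrow> bool" where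
  "stationary_varifold E k M T \<longleftrightarrow>
     (\<forall>X X'. test_field E X X' \<longrightarrow>
        (LINT z:M|hausdorff_measure k. tangential_div (X' z) (T z)) = 0)"

definition minimal_graph :: "nat \<Rightarrow> (real ^ 'n \<Rightarrow> fin_seq) \<Rightarrow> bool" where
  "minimal_graph m u \<longleftrightarrow>
     range u \<subseteq> coord_space m \<and> locally_lipschitz u \<and>
     stationary_varifold (ambient m) CARD('n) (regular_graph u) (tangent_plane u)"

end

theory Submission
  imports Defs
begin

text \<open>
  Let \<open>\<lambda>\<^sub>1 \<ge> \<dots> \<ge> \<lambda>\<^sub>n\<close> be the singular values of the derivative of \<open>u\<close>. The bound \<open>\<lambda>\<^sub>i \<lambda>\<^sub>1 \<le> \<Lambda>\<close> for \<open>i > 1\<close> leaves at most one of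
  them large. So the area element of the graph is at most a constant times \<open>1 + \<lambda>\<^sub>1\<close>, and its product with
  \<open>\<lambda>\<^sub>i / (1 + \<lambda>\<^sub>i\<^sup>2)\<close> is bounded for every \<open>i\<close>.

  Volume growth (\<open>volume_bound\<close>). Test stationarity with a vertical field \<open>\<eta>(x) \<psi>(y)\<close>, where \<open>\<psi>\<close> is a bounded gradient of a
  convex function. The derivative of \<open>\<psi>\<close> yields a positive term that dominates \<open>\<lambda>\<^sub>1\<^sup>2 / (1 + \<lambda>\<^sub>1\<^sup>2)\<close> in a ball; the
  derivative of \<open>\<eta>\<close> yields an error bounded by \<open>\<Sum> \<lambda>\<^sub>i / (1 + \<lambda>\<^sub>i\<^sup>2)\<close>, whose integral over the graph is at most a
  constant times \<open>r\<^sup>n\<close> by the first paragraph. This controls the area where \<open>\<lambda>\<^sub>1 \<ge> 1\<close>; where \<open>\<lambda>\<^sub>1 < 1\<close> the area element is bounded.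
  The estimate of the area element is \<open>area_bound\<close>, proved by an explicit covering by slabs.

  Mean value inequality (\<open>mean_value_inequality\<close>). Affine functions are harmonic on a stationary graph, so their squares are
  subharmonic, and the computation behind the monotonicity formula (\<open>stationary_weighted\<close>, \<open>energy_decay\<close>) bounds the
  square at a point by its averages over balls. The constant is independent of \<open>u\<close> because Hausdorff measure has
  upper density at least \<open>2\<^sup>-\<^sup>n\<close> almost everywhere on any set of finite measure (\<open>hausdorff_density\<close>).

  Dimension (\<open>flag_dimension_bound\<close>). By the volume bound, the square integral of a linear function over the graph in a ball of
  radius \<open>R\<close> is \<open>O(R\<^sup>n\<^sup>+\<^sup>2)\<close>. Polynomial growth forces some scale \<open>R\<close> at which \<open>k\<close> linear functions, orthonormal on the ball of
  radius \<open>2 R\<close>, still have total energy at least a constant times \<open>k\<close> on the ball of radius \<open>R\<close>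
  (\<open>slow_scale_orthonormal_family\<close>). The mean value inequality bounds the sum of their squares by a constant times \<open>R\<^sup>-\<^sup>n\<close>, whatever
  \<open>k\<close> is, and the volume bound turns this into a bound on \<open>k\<close>.

  Points without tangent plane form a null set by Rademacher's theorem, which is derived from Vitali's covering theorem
  (\<open>rademacher_real\<close>).
\<close>

section \<open>Covering arguments for Lebesgue measure\<close>

text \<open>
  Inside any open set around \<open>S\<close>, Vitali's theorem finds disjoint balls that cover almost all of \<open>S\<close>,
  and only the fraction \<open>\<theta>\<close> of each ball is needed. Hence the outer measure \<open>m\<close> of \<open>S\<close> satisfies
  \<open>m \<le> \<theta> m\<close>, and it is finite.
\<close>

lemma negligible_if_locally_thin_bounded:
  fixes S :: "'a::euclidean_space set"
  assumes \<theta>: "0 \<le> \<theta>" "\<theta> < 1" and bd: "bounded S"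
    and thin: "\<And>x d. x \<in> S \<Longrightarrow> 0 < d \<Longrightarrow> \<exists>a r U. 0 < r \<and> r < d \<and> x \<in> cball a r \<and>
      S \<inter> cball a r \<subseteq> U \<and> U \<in> sets lebesgue \<and>
      emeasure lebesgue U \<le> ennreal \<theta> * emeasure lebesgue (cball a r)"
  shows "negligible S"
proof -
  define m where "m = (INF T\<in>{T\<in>sets lebesgue. S \<subseteq> T}. emeasure lebesgue T)"
  have step: "m \<le> ennreal \<theta> * emeasure lebesgue V" if V: "open V" "S \<subseteq> V" for V
  proof -
    define K where "K = {(a, r). 0 < r \<and> cball a r \<subseteq> V \<and> (\<exists>U. S \<inter> cball a r \<subseteq> U \<and>
      U \<in> sets lebesgue \<and> emeasure lebesgue U \<le> ennreal \<theta> * emeasure lebesgue (cball a r))}"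
    have fine: "\<exists>i. i \<in> K \<and> x \<in> cball (fst i) (snd i) \<and> snd i < d" if x: "x \<in> S" and d: "0 < d" for x d
    proof -
      obtain e where e: "0 < e" "cball x e \<subseteq> V"
        using V x open_contains_cball by (metis subsetD)
      obtain a r U where *: "0 < r" "r < min d (e / 2)" "x \<in> cball a r" "S \<inter> cball a r \<subseteq> U"
        "U \<in> sets lebesgue" "emeasure lebesgue U \<le> ennreal \<theta> * emeasure lebesgue (cball a r)"
        using thin[OF x, of "min d (e / 2)"] d e by auto
      have "cball a r \<subseteq> cball x e"
      proof
        fix y assume y: "y \<in> cball a r"
        have "dist x y \<le> dist a x + dist a y" by (rule dist_triangle3)
        then show "y \<in> cball x e" using y *(2,3) by auto
      qed
      then have "(a, r) \<in> K" using * e unfolding K_def by blast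
      then show ?thesis using * by (intro exI[of _ "(a, r)"]) auto
    qed
    obtain C where C: "countable C" "C \<subseteq> K"
      "pairwise (\<lambda>i j. disjnt (cball (fst i) (snd i)) (cball (fst j) (snd j))) C"
      "negligible (S - (\<Union>i\<in>C. cball (fst i) (snd i)))"
    proof (rule Vitali_covering_theorem_cballs[of K snd S fst])
      show "\<And>i. i \<in> K \<Longrightarrow> 0 < snd i" by (auto simp: K_def)
    qed (use fine in blast)+
    have "\<forall>i\<in>C. \<exists>U. S \<inter> cball (fst i) (snd i) \<subseteq> U \<and> U \<in> sets lebesgue \<and>
        emeasure lebesgue U \<le> ennreal \<theta> * emeasure lebesgue (cball (fst i) (snd i))"
      using C(2) unfolding K_def by auto
    then obtain U where U: "\<And>i. i \<in> C \<Longrightarrow> S \<inter> cball (fst i) (snd i) \<subseteq> U i"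
      "\<And>i. i \<in> C \<Longrightarrow> U i \<in> sets lebesgue"
      "\<And>i. i \<in> C \<Longrightarrow> emeasure lebesgue (U i) \<le> ennreal \<theta> * emeasure lebesgue (cball (fst i) (snd i))"
      by metis
    let ?B = "\<lambda>i. cball (fst i) (snd i) :: 'a set"
    let ?W = "\<lambda>i. U i \<inter> ?B i"
    have dB: "disjoint_family_on ?B C"
      using C(3) by (auto simp: disjoint_family_on_def pairwise_def disjnt_def)
    then have dW: "disjoint_family_on ?W C"
      unfolding disjoint_family_on_def by blast
    have "m \<le> emeasure lebesgue ((S - (\<Union>i\<in>C. ?B i)) \<union> (\<Union>i\<in>C. ?W i))"
      unfolding m_def
    proof (intro INF_lower CollectI conjI)
      show "(S - (\<Union>i\<in>C. ?B i)) \<union> (\<Union>i\<in>C. ?W i) \<in> sets lebesgue"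
        using C(1,4) U(2) by (intro sets.Un sets.countable_UN' negligible_imp_sets) auto
      show "S \<subseteq> (S - (\<Union>i\<in>C. ?B i)) \<union> (\<Union>i\<in>C. ?W i)" using U(1) by blast
    qed
    also have "\<dots> = emeasure lebesgue (\<Union>i\<in>C. ?W i)"
      using C(1,4) U(2)
      by (subst Un_commute, intro emeasure_Un_null_set sets.countable_UN') (auto simp: negligible_iff_null_sets)
    also have "\<dots> = (\<integral>\<^sup>+i. emeasure lebesgue (?W i) \<partial>count_space C)"
      using C(1) U(2) dW by (intro emeasure_UN_countable) auto
    also have "\<dots> \<le> (\<integral>\<^sup>+i. ennreal \<theta> * emeasure lebesgue (?B i) \<partial>count_space C)"
    proof (rule nn_integral_mono)
      fix i assume "i \<in> space (count_space C)"
      then have i: "i \<in> C" by simp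
      have "emeasure lebesgue (?W i) \<le> emeasure lebesgue (U i)"
        using U(2)[OF i] by (intro emeasure_mono) auto
      then show "emeasure lebesgue (?W i) \<le> ennreal \<theta> * emeasure lebesgue (?B i)"
        using U(3)[OF i] by simp
    qed
    also have "\<dots> = ennreal \<theta> * (\<integral>\<^sup>+i. emeasure lebesgue (?B i) \<partial>count_space C)"
      by (rule nn_integral_cmult) auto
    also have "(\<integral>\<^sup>+i. emeasure lebesgue (?B i) \<partial>count_space C) = emeasure lebesgue (\<Union>i\<in>C. ?B i)"
      using C(1) dB by (intro emeasure_UN_countable[symmetric]) auto
    also have "ennreal \<theta> * \<dots> \<le> ennreal \<theta> * emeasure lebesgue V"
    proof (intro mult_left_mono emeasure_mono UN_least)
      show "?B i \<subseteq> V" if "i \<in> C" for i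
        using subsetD[OF C(2) that] by (simp add: K_def case_prod_beta)
    qed (use V in auto)
    finally show ?thesis .
  qed
  have le: "m \<le> ennreal \<theta> * emeasure lebesgue T" if T: "T \<in> sets lebesgue" "S \<subseteq> T" for T
  proof (cases "emeasure lebesgue T = top")
    case True
    show ?thesis
    proof (cases "\<theta> = 0")
      case True
      obtain V where "open V" "T \<subseteq> V" using T by blast
      then show ?thesis using step[of V] T True by auto
    next
      case False
      then show ?thesis using \<open>emeasure lebesgue T = top\<close> \<theta> by (simp add: ennreal_mult_top)
    qed
  next
    case False
    show ?thesis
    proof (rule ennreal_le_epsilon)
      fix e :: real assume e: "0 < e"
      obtain V where V: "open V" "T \<subseteq> V" "V - T \<in> lmeasurable" "emeasure lebesgue (V - T) < ennreal e"
        using sets_lebesgue_outer_open[OF T(1) e] by blast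
      have "emeasure lebesgue V \<le> emeasure lebesgue T + emeasure lebesgue (V - T)"
        using V T by (subst plus_emeasure) (auto simp: Un_absorb1)
      also have "\<dots> \<le> emeasure lebesgue T + e" using V by (intro add_left_mono) auto
      finally have "m \<le> ennreal \<theta> * (emeasure lebesgue T + e)"
        using step[OF V(1)] V(2) T(2) by (meson mult_left_mono order_trans zero_le)
      also have "\<dots> \<le> ennreal \<theta> * emeasure lebesgue T + e"
        using \<theta> e by (auto simp: distrib_left ennreal_mult[symmetric] mult_left_le_one_le intro!: add_left_mono ennreal_leI)
      finally show "m \<le> ennreal \<theta> * emeasure lebesgue T + e" .
    qed
  qed
  obtain R where R: "S \<subseteq> cball 0 R" using bd by (auto simp: bounded_iff subset_eq)
  have fin: "m < top"
  proof -
    have "m \<le> emeasure lebesgue (cball 0 R :: 'a set)" unfolding m_def using R by (intro INF_lower) auto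
    also have "\<dots> < top"
      using fmeasurableD2[OF lmeasurable_cball[of 0 R]] by (simp add: less_top)
    finally show ?thesis .
  qed
  have "m \<le> ennreal \<theta> * m"
  proof (cases "\<theta> = 0")
    case True
    have "m \<le> 0" using le[of UNIV] True by simp
    then show ?thesis by simp
  next
    case False
    have "m / ennreal \<theta> \<le> (INF T\<in>{T\<in>sets lebesgue. S \<subseteq> T}. emeasure lebesgue T)"
    proof (rule INF_greatest)
      fix T assume "T \<in> {T \<in> sets lebesgue. S \<subseteq> T}"
      then have "m \<le> ennreal \<theta> * emeasure lebesgue T" using le by auto
      then show "m / ennreal \<theta> \<le> emeasure lebesgue T"
        using False \<theta> by (simp add: divide_le_posI_ennreal)
    qed
    then have "m / ennreal \<theta> * ennreal \<theta> \<le> m * ennreal \<theta>"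
      unfolding m_def[symmetric] by (rule mult_right_mono) simp
    moreover have "m / ennreal \<theta> * ennreal \<theta> = m"
      using False \<theta> fin by (cases m) (auto simp: divide_ennreal ennreal_mult[symmetric])
    ultimately show ?thesis by (simp add: mult.commute)
  qed
  then have "m = 0"
    using \<theta> fin
    apply (cases m)
    apply (auto simp: ennreal_mult[symmetric])
    by (smt (verit) mult_right_less_imp_less mult_cancel_right1)
  then show ?thesis
    unfolding negligible_outer
  proof (intro allI impI)
    fix e :: real assume "0 < e"
    then have "(INF T\<in>{T\<in>sets lebesgue. S \<subseteq> T}. emeasure lebesgue T) < ennreal e"
      using \<open>m = 0\<close> unfolding m_def by simp
    then obtain T where T: "T \<in> sets lebesgue" "S \<subseteq> T" "emeasure lebesgue T < ennreal e"
      unfolding INF_less_iff by auto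
    then have "T \<in> lmeasurable" by (intro fmeasurableI) (auto simp: less_top intro: order.strict_trans)
    then show "\<exists>T. S \<subseteq> T \<and> T \<in> lmeasurable \<and> measure lebesgue T < e"
      using T \<open>0 < e\<close> by (intro exI[of _ T]) (auto simp: emeasure_eq_measure2 ennreal_less_iff)
  qed
qed

lemma negligible_if_locally_thin:
  fixes S :: "'a::euclidean_space set"
  assumes \<theta>: "0 \<le> \<theta>" "\<theta> < 1"
    and thin: "\<And>x d. x \<in> S \<Longrightarrow> 0 < d \<Longrightarrow> \<exists>a r U. 0 < r \<and> r < d \<and> x \<in> cball a r \<and>
      S \<inter> cball a r \<subseteq> U \<and> U \<in> sets lebesgue \<and>
      emeasure lebesgue U \<le> ennreal \<theta> * emeasure lebesgue (cball a r)"
  shows "negligible S"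
proof -
  have "negligible (S \<inter> cball 0 (real n))" for n
  proof (rule negligible_if_locally_thin_bounded[OF \<theta>])
    fix x :: 'a and d :: real assume "x \<in> S \<inter> cball 0 (real n)" "0 < d"
    then show "\<exists>a r U. 0 < r \<and> r < d \<and> x \<in> cball a r \<and> (S \<inter> cball 0 (real n)) \<inter> cball a r \<subseteq> U \<and>
        U \<in> sets lebesgue \<and> emeasure lebesgue U \<le> ennreal \<theta> * emeasure lebesgue (cball a r)"
      using thin[of x d] by blast
  qed auto
  then have "negligible (\<Union>n. S \<inter> cball 0 (real n))" by (intro negligible_countable_Union[of "range (\<lambda>n. S \<inter> cball 0 (real n))"]) auto
  moreover have "(\<Union>n. S \<inter> cball 0 (real n)) = S"
    by (auto simp: real_arch_simple)
  ultimately show ?thesis by simp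
qed

section \<open>Rademacher's theorem\<close>

text \<open>
  Disjoint intervals have disjoint images under an increasing function. So \<open>q\<close> times the total length of
  disjoint steep intervals inside \<open>{a<..<b}\<close> is at most \<open>g b - g a\<close>, and by Vitali's theorem such
  intervals cover almost all of \<open>S\<close> there.
\<close>

lemma steep_intervals_measure:
  fixes g :: "real \<Rightarrow> real"
  assumes g: "strict_mono g" and q: "0 < q" and ab: "a < b"
    and steep: "\<And>x d. x \<in> S \<Longrightarrow> 0 < d \<Longrightarrow> \<exists>c e. c < e \<and> e - c < d \<and> x \<in> {c..e} \<and> q * (e - c) \<le> g e - g c"
  obtains U where "U \<in> sets lebesgue" "S \<inter> {a<..<b} \<subseteq> U"
    "emeasure lebesgue U \<le> ennreal ((g b - g a) / q)"
proof -
  define K where "K = {(c, e). c < e \<and> a < c \<and> e < b \<and> q * (e - c) \<le> g e - g c}"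
  define z where "z = (\<lambda>i::real\<times>real. (fst i + snd i) / 2)"
  define r where "r = (\<lambda>i::real\<times>real. (snd i - fst i) / 2)"
  have cb: "cball (z i) (r i) = {fst i..snd i}" for i
    by (auto simp: cball_eq_atLeastAtMost z_def r_def field_simps)
  have "\<exists>i. i \<in> K \<and> x \<in> cball (z i) (r i) \<and> r i < d" if x: "x \<in> S \<inter> {a<..<b}" and d: "0 < d" for x d
  proof -
    obtain c e where *: "c < e" "e - c < min d (min (x - a) (b - x))" "x \<in> {c..e}" "q * (e - c) \<le> g e - g c"
      using steep[of x "min d (min (x - a) (b - x))"] x d by auto
    then have "(c, e) \<in> K" unfolding K_def by auto
    then show ?thesis unfolding cb using * by (intro exI[of _ "(c, e)"]) (auto simp: r_def)
  qed
  note fine = this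
  obtain C where C: "countable C" "C \<subseteq> K"
      "pairwise (\<lambda>i j. disjnt (cball (z i) (r i)) (cball (z j) (r j))) C"
      "negligible (S \<inter> {a<..<b} - (\<Union>i\<in>C. cball (z i) (r i)))"
  proof (rule Vitali_covering_theorem_cballs[of K r "S \<inter> {a<..<b}" z])
    show "\<And>i. i \<in> K \<Longrightarrow> 0 < r i" by (auto simp: K_def r_def)
  qed (use fine in blast)+
  define U where "U = (\<Union>i\<in>C. {fst i..snd i}) \<union> (S \<inter> {a<..<b} - (\<Union>i\<in>C. {fst i..snd i}))"
  have dis: "disjoint_family_on (\<lambda>i. {fst i..snd i}) C"
    using C(3) unfolding cb by (auto simp: disjoint_family_on_def pairwise_def disjnt_def)
  have lt: "fst i < snd i" "a < fst i" "snd i < b" "q * (snd i - fst i) \<le> g (snd i) - g (fst i)" if "i \<in> C" for i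
    using C(2) that by (auto simp: K_def)
  have disg: "disjoint_family_on (\<lambda>i. {g (fst i)..g (snd i)}) C"
    unfolding disjoint_family_on_def
  proof (intro ballI impI)
    fix i j assume ij: "i \<in> C" "j \<in> C" "i \<noteq> j"
    then have "{fst i..snd i} \<inter> {fst j..snd j} = {}" using dis by (auto simp: disjoint_family_on_def)
    then have "snd i < fst j \<or> snd j < fst i" using lt(1)[of i] lt(1)[of j] ij
      by (auto simp: disjoint_iff)
    then have "g (snd i) < g (fst j) \<or> g (snd j) < g (fst i)" using g by (auto simp: strict_mono_less)
    then show "{g (fst i)..g (snd i)} \<inter> {g (fst j)..g (snd j)} = {}" by auto
  qed
  have U1: "U \<in> sets lebesgue"
    unfolding U_def using C(1,4) unfolding cb by (intro sets.Un sets.countable_UN' negligible_imp_sets) auto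
  have "ennreal q * emeasure lebesgue U = ennreal q * emeasure lebesgue (\<Union>i\<in>C. {fst i..snd i})"
    unfolding U_def using C(1,4) unfolding cb
    by (subst emeasure_Un_null_set) (auto simp: negligible_iff_null_sets)
  also have "\<dots> = ennreal q * (\<integral>\<^sup>+i. emeasure lebesgue {fst i..snd i} \<partial>count_space C)"
    using C(1) dis by (subst emeasure_UN_countable) auto
  also have "\<dots> = (\<integral>\<^sup>+i. ennreal q * emeasure lebesgue {fst i..snd i} \<partial>count_space C)"
    by (rule nn_integral_cmult[symmetric]) auto
  also have "\<dots> \<le> (\<integral>\<^sup>+i. emeasure lebesgue {g (fst i)..g (snd i)} \<partial>count_space C)"
  proof (rule nn_integral_mono)
    fix i assume "i \<in> space (count_space C)"
    then have i: "i \<in> C" by simp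
    have "g (fst i) < g (snd i)" using lt(1)[OF i] g by (simp add: strict_mono_less)
    then show "ennreal q * emeasure lebesgue {fst i..snd i} \<le> emeasure lebesgue {g (fst i)..g (snd i)}"
      using lt[OF i] q by (auto simp: ennreal_mult[symmetric] intro!: ennreal_leI)
  qed
  also have "\<dots> = emeasure lebesgue (\<Union>i\<in>C. {g (fst i)..g (snd i)})"
    using C(1) disg by (intro emeasure_UN_countable[symmetric]) auto
  also have "\<dots> \<le> emeasure lebesgue {g a..g b}"
  proof (rule emeasure_mono)
    show "(\<Union>i\<in>C. {g (fst i)..g (snd i)}) \<subseteq> {g a..g b}"
    proof safe
      fix u v y assume i: "(u, v) \<in> C" and y: "y \<in> {g (fst (u, v))..g (snd (u, v))}"
      have "g a \<le> g u" "g v \<le> g b" using lt[OF i] g by (auto simp: strict_mono_less_eq)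
      then show "y \<in> {g a..g b}" using y by auto
    qed
  qed auto
  also have "\<dots> = ennreal (g b - g a)"
    using g ab by (simp add: strict_mono_less_eq)
  finally have "ennreal q * emeasure lebesgue U \<le> ennreal (g b - g a)" .
  then have "ennreal (1 / q) * (ennreal q * emeasure lebesgue U) \<le> ennreal (1 / q) * ennreal (g b - g a)"
    by (rule mult_left_mono) simp
  moreover have "ennreal (1 / q) * (ennreal q * emeasure lebesgue U) = emeasure lebesgue U"
    using q by (simp add: mult.assoc[symmetric] ennreal_mult[symmetric])
  moreover have "ennreal (1 / q) * ennreal (g b - g a) = ennreal ((g b - g a) / q)"
    using q g ab by (subst ennreal_mult[symmetric]) (auto simp: strict_mono_less_eq)
  ultimately have "emeasure lebesgue U \<le> ennreal ((g b - g a) / q)" by simp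
  then show ?thesis using that[OF U1] unfolding U_def by blast
qed

text \<open>
  The limit is the supremum of the numbers that are eventually below \<open>Q\<close>.
\<close>

lemma bounded_oscillation_free_converges:
  fixes Q :: "real \<Rightarrow> real"
  assumes bnd: "\<forall>\<^sub>F h in at 0. \<bar>Q h\<bar> \<le> M"
    and osc: "\<And>p q. p \<in> \<rat> \<Longrightarrow> q \<in> \<rat> \<Longrightarrow> p < q \<Longrightarrow> (\<exists>\<^sub>F h in at 0. Q h < p) \<Longrightarrow> (\<exists>\<^sub>F h in at 0. q < Q h) \<Longrightarrow> False"
  shows "\<exists>l. (Q \<longlongrightarrow> l) (at 0)"
proof -
  define A where "A = {p. \<forall>\<^sub>F h in at 0. p < Q h}"
  have ub: "p \<le> M" if "p \<in> A" for p
  proof -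
    have "\<forall>\<^sub>F h in at (0::real). p < Q h" using that unfolding A_def by simp
    with bnd have "\<forall>\<^sub>F h in at (0::real). p \<le> M" by eventually_elim linarith
    then show ?thesis by simp
  qed
  then have bdd: "bdd_above A" by (auto simp: bdd_above_def)
  have ne: "-M - 1 \<in> A" unfolding A_def using bnd by (auto elim!: eventually_mono)
  define l where "l = Sup A"
  have "(Q \<longlongrightarrow> l) (at 0)"
  proof (rule order_tendstoI)
    fix a assume "a < l"
    then obtain p where p: "p \<in> A" "a < p" unfolding l_def using less_cSup_iff[of A a] ne bdd by blast
    then show "\<forall>\<^sub>F h in at 0. a < Q h" unfolding A_def by (auto elim!: eventually_mono)
  next
    fix a assume "l < a"
    then obtain q where q: "q \<in> \<rat>" "l < q" "q < a" using Rats_dense_in_real by blast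
    then obtain p where p: "p \<in> \<rat>" "l < p" "p < q" using Rats_dense_in_real by blast
    obtain p0 where p0: "l < p0" "p0 < p" using p dense by blast
    have "p0 \<notin> A" using p0 cSup_upper[OF _ bdd] unfolding l_def by fastforce
    then have "\<exists>\<^sub>F h in at 0. Q h < p" using p0 unfolding A_def
      by (auto simp: not_eventually elim!: frequently_elim1)
    then have "\<not> (\<exists>\<^sub>F h in at 0. q < Q h)" using osc[of p q] p q by blast
    then show "\<forall>\<^sub>F h in at 0. Q h < a" using q by (auto simp: not_frequently elim!: eventually_mono)
  qed
  then show ?thesis ..
qed

lemma frequently_at_0: "(\<exists>\<^sub>F h in at (0::real). P h) \<longleftrightarrow> (\<forall>d>0. \<exists>h. h \<noteq> 0 \<and> \<bar>h\<bar> < d \<and> P h)"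
  unfolding frequently_def eventually_at by (auto simp: dist_real_def)

text \<open>
  After adding \<open>(L + 1) x\<close> all slopes are positive, and the function increases. A point of the set is the end
  of arbitrarily short intervals of slope below \<open>P = p + L + 1\<close>. All points of the set in such an interval
  are also ends of short intervals of slope above \<open>R = q + L + 1\<close>, so they fill at most the
  fraction \<open>P / R < 1\<close> of it: the set is locally thin.
\<close>

lemma oscillating_slopes_negligible:
  fixes f :: "real \<Rightarrow> real"
  assumes f: "L-lipschitz_on UNIV f" and pq: "p < q"
  shows "negligible {x. (\<exists>\<^sub>F h in at 0. (f (x + h) - f x) / h < p) \<and> (\<exists>\<^sub>F h in at 0. q < (f (x + h) - f x) / h)}"
    (is "negligible ?S")
proof (cases "- L < q \<and> - L < p")
  case False
  have "?S = {}"
  proof safe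
    fix x assume "\<exists>\<^sub>F h in at 0. (f (x + h) - f x) / h < p"
    then obtain h where h: "h \<noteq> 0" "(f (x + h) - f x) / h < p" unfolding frequently_at_0 using zero_less_one by blast
    have "\<bar>f (x + h) - f x\<bar> \<le> L * \<bar>h\<bar>" using lipschitz_onD[OF f, of "x + h" x] by (simp add: dist_real_def)
    then have "\<bar>(f (x + h) - f x) / h\<bar> \<le> L" using h(1) by (simp add: divide_le_eq abs_divide)
    then have "- L \<le> (f (x + h) - f x) / h" by linarith
    then show "x \<in> {}" using h(2) False pq by linarith
  qed
  then show ?thesis using negligible_empty by metis
next
  case True
  have L: "0 \<le> L" using f lipschitz_on_nonneg by blast
  define g where "g x = f x + (L + 1) * x" for x
  define P where "P = p + L + 1" 
  define R where "R = q + L + 1"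
  have PR: "0 < P" "P < R" "0 < R" using True pq by (auto simp: P_def R_def)
  have sg: "(g (x + h) - g x) / h = (f (x + h) - f x) / h + (L + 1)" if "h \<noteq> 0" for x h
    using that by (simp add: g_def field_simps)
  have mono: "strict_mono g"
  proof (rule strict_monoI)
    fix x y :: real assume xy: "x < y"
    have "\<bar>f y - f x\<bar> \<le> L * \<bar>y - x\<bar>" using lipschitz_onD[OF f, of y x] by (simp add: dist_real_def)
    then show "g x < g y" using xy by (auto simp: g_def algebra_simps)
  qed
  have seg: "\<exists>c e. c < e \<and> e - c = \<bar>h\<bar> \<and> x \<in> {c..e} \<and> g e - g c = ((f (x + h) - f x) / h + (L + 1)) * (e - c)"
    if "h \<noteq> 0" for x h
  proof (cases "0 < h")
    case True
    then show ?thesis unfolding sg[OF that, of x, symmetric] by (intro exI[of _ x] exI[of _ "x + h"]) auto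
  next
    case False
    then show ?thesis unfolding sg[OF that, of x, symmetric] using that
      by (intro exI[of _ "x + h"] exI[of _ "x"]) auto
  qed
  show ?thesis
  proof (rule negligible_if_locally_thin[of "P / R"])
    show "0 \<le> P / R" "P / R < 1" using PR by auto
    fix x d :: real assume x: "x \<in> ?S" and d: "0 < d"
    obtain h where h: "h \<noteq> 0" "\<bar>h\<bar> < d" "(f (x + h) - f x) / h < p"
      using x d unfolding frequently_at_0 by blast
    obtain a b where ab: "a < b" "b - a = \<bar>h\<bar>" "x \<in> {a..b}" "g b - g a = ((f (x + h) - f x) / h + (L + 1)) * (b - a)"
      using seg[OF h(1)] by blast
    have gab: "g b - g a \<le> P * (b - a)" unfolding ab(4) P_def using h(3) ab(1) by (intro mult_right_mono) auto
    have "\<exists>c e. c < e \<and> e - c < d \<and> y \<in> {c..e} \<and> R * (e - c) \<le> g e - g c" if y: "y \<in> ?S" and d: "0 < d" for y d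
    proof -
      obtain k where k: "k \<noteq> 0" "\<bar>k\<bar> < d" "q < (f (y + k) - f y) / k"
        using y d unfolding frequently_at_0 by blast
      obtain c e where ce: "c < e" "e - c = \<bar>k\<bar>" "y \<in> {c..e}" "g e - g c = ((f (y + k) - f y) / k + (L + 1)) * (e - c)"
        using seg[OF k(1)] by blast
      have "R * (e - c) \<le> g e - g c" unfolding ce(4) R_def using k(3) ce(1) by (intro mult_right_mono) auto
      then show ?thesis using ce k by (intro exI[of _ c] exI[of _ e]) auto
    qed
    from steep_intervals_measure[OF mono PR(3) ab(1) this]
    obtain U where U: "U \<in> sets lebesgue" "?S \<inter> {a<..<b} \<subseteq> U" "emeasure lebesgue U \<le> ennreal ((g b - g a) / R)"
      by blast
    let ?c = "(a + b) / 2" and ?r = "(b - a) / 2"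
    have cb: "cball ?c ?r = {a..b}" by (auto simp: cball_eq_atLeastAtMost field_simps)
    show "\<exists>a r U. 0 < r \<and> r < d \<and> x \<in> cball a r \<and> ?S \<inter> cball a r \<subseteq> U \<and> U \<in> sets lebesgue \<and>
        emeasure lebesgue U \<le> ennreal (P / R) * emeasure lebesgue (cball a r)"
    proof (intro exI conjI)
      show "0 < ?r" "?r < d" using ab h by auto
      show "x \<in> cball ?c ?r" using ab(3) unfolding cb .
      show "?S \<inter> cball ?c ?r \<subseteq> U \<union> {a, b}" using U(2) unfolding cb by auto
      have ab0: "{a, b} \<in> null_sets lebesgue" by (auto intro: null_sets_completionI)
      show "U \<union> {a, b} \<in> sets lebesgue" using U(1) ab0 by (intro sets.Un) (auto dest: null_setsD2)
      have "emeasure lebesgue (U \<union> {a, b}) = emeasure lebesgue U"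
        using U(1) by (intro emeasure_Un_null_set) (auto intro: null_sets_completionI)
      also have "\<dots> \<le> ennreal ((g b - g a) / R)" by (rule U(3))
      also have "\<dots> \<le> ennreal (P / R * (b - a))"
        using divide_right_mono[OF gab, of R] PR by (intro ennreal_leI) simp
      also have "\<dots> = ennreal (P / R) * ennreal (b - a)"
        using ab(1) PR by (intro ennreal_mult) auto
      also have "ennreal (b - a) = emeasure lebesgue (cball ?c ?r)"
        unfolding cb using ab(1) by simp
      finally show "emeasure lebesgue (U \<union> {a, b}) \<le> ennreal (P / R) * emeasure lebesgue (cball ?c ?r)" .
    qed
  qed
qed

text \<open>
  Fubini's theorem for \<open>1\<^sub>N (x + t e)\<close> on \<open>t \<in> [0,1]\<close>: integrating over \<open>x\<close> first gives the measure of \<open>N\<close> by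
  translation invariance, integrating over \<open>t\<close> first gives \<open>0\<close>.
\<close>

lemma null_if_null_on_lines:
  fixes N :: "'a::euclidean_space set" and e :: 'a
  assumes N: "N \<in> sets borel" and slice: "\<And>x. negligible {t::real. x + t *\<^sub>R e \<in> N}"
  shows "negligible N"
proof -

  let ?f = "\<lambda>z::real\<times>'a. indicator {0..1::real} (fst z) * indicator N (snd z + fst z *\<^sub>R e) :: ennreal"
  have m: "?f \<in> borel_measurable (lborel \<Otimes>\<^sub>M lborel)"
    using N by measurable
  have "(\<integral>\<^sup>+x. (\<integral>\<^sup>+t. ?f (t, x) \<partial>lborel) \<partial>lborel) = (\<integral>\<^sup>+t. (\<integral>\<^sup>+x. ?f (t, x) \<partial>lborel) \<partial>lborel)"
    by (rule lborel_pair.Fubini[OF m])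
  moreover have "(\<integral>\<^sup>+x. (\<integral>\<^sup>+t. ?f (t, x) \<partial>lborel) \<partial>lborel) = (\<integral>\<^sup>+x. 0 \<partial>(lborel::'a measure))"
  proof (rule nn_integral_cong)
    fix x :: 'a
    have sm: "{t::real. x + t *\<^sub>R e \<in> N} \<in> sets lborel"
    proof -
      have "(\<lambda>t::real. x + t *\<^sub>R e) \<in> borel_measurable borel" by measurable
      from measurable_sets[OF this N] show ?thesis by (simp add: vimage_def)
    qed
    have "(\<integral>\<^sup>+t. ?f (t, x) \<partial>lborel) \<le> (\<integral>\<^sup>+t. indicator {t::real. x + t *\<^sub>R e \<in> N} t \<partial>lborel)"
      by (intro nn_integral_mono) (auto simp: indicator_def)
    also have "\<dots> = emeasure lebesgue {t::real. x + t *\<^sub>R e \<in> N}" using sm by simp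
    also have "\<dots> = 0" using slice[of x] unfolding negligible_iff_null_sets by (rule null_setsD1)
    finally show "(\<integral>\<^sup>+t. ?f (t, x) \<partial>lborel) = 0" by simp
  qed
  moreover have "(\<integral>\<^sup>+t. (\<integral>\<^sup>+x. ?f (t, x) \<partial>lborel) \<partial>lborel) = (\<integral>\<^sup>+t. indicator {0..1::real} t * emeasure lborel N \<partial>lborel)"
  proof (rule nn_integral_cong)
    fix t :: real
    have "(\<integral>\<^sup>+x. ?f (t, x) \<partial>lborel) = indicator {0..1::real} t * (\<integral>\<^sup>+x. indicator N (x + t *\<^sub>R e) \<partial>lborel)"
      using N by (simp, subst nn_integral_cmult) auto
    also have "(\<integral>\<^sup>+x. indicator N (x + t *\<^sub>R e) \<partial>lborel) = (\<integral>\<^sup>+x. indicator N x \<partial>distr lborel borel ((+) (t *\<^sub>R e)))"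
      using N by (subst nn_integral_distr) (auto simp: add.commute)
    also have "\<dots> = emeasure lborel N" using N by (simp add: lborel_distr_plus)
    finally show "(\<integral>\<^sup>+x. ?f (t, x) \<partial>lborel) = indicator {0..1::real} t * emeasure lborel N" .
  qed
  moreover have "(\<integral>\<^sup>+t. indicator {0..1::real} t * emeasure lborel N \<partial>lborel) = emeasure lborel N"
    by (subst nn_integral_multc) auto
  ultimately have "emeasure lborel N = 0" by simp
  then show ?thesis using N by (simp add: negligible_iff_emeasure0)
qed

text \<open>
  The exceptional set is the union, over rational \<open>p < q\<close>, of the Borel sets where the difference quotient
  oscillates across \<open>[p, q]\<close>, and each of them meets every line in direction \<open>e\<close> in a null set.
\<close>

lemma directional_derivative_ae:
  fixes F :: "'a::euclidean_space \<Rightarrow> real"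
  assumes F: "L-lipschitz_on UNIV F"
  shows "negligible {x. \<not> (\<exists>l. ((\<lambda>h. (F (x + h *\<^sub>R e) - F x) / h) \<longlongrightarrow> l) (at 0))}"
proof -
  define Q where "Q x h = (F (x + h *\<^sub>R e) - F x) / h" for x and h :: real
  define N where "N p q = {x. (\<exists>\<^sub>F h in at 0. Q x h < p) \<and> (\<exists>\<^sub>F h in at 0. q < Q x h)}" for p q
  have L: "0 \<le> L" using F lipschitz_on_nonneg by blast
  have cF: "continuous_on UNIV F" using F lipschitz_on_continuous_on by blast
  have cQ: "continuous_on UNIV (\<lambda>x. Q x h)" if "h \<noteq> 0" for h
    unfolding Q_def using that by (intro continuous_intros continuous_on_compose2[OF cF]) auto
  have freq: "(\<exists>\<^sub>F h in at (0::real). P h) \<longleftrightarrow> (\<forall>k::nat. \<exists>h. h \<noteq> 0 \<and> \<bar>h\<bar> < 1 / Suc k \<and> P h)" for P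
    unfolding frequently_at_0
  proof (intro iffI allI impI)
    fix d :: real assume *: "\<forall>k::nat. \<exists>h. h \<noteq> 0 \<and> \<bar>h\<bar> < 1 / Suc k \<and> P h" and "0 < d"
    obtain k where k: "1 / real (Suc k) < d" using nat_approx_posE[OF \<open>0 < d\<close>] by blast
    from * obtain h where "h \<noteq> 0" "\<bar>h\<bar> < 1 / Suc k" "P h" by blast
    then show "\<exists>h. h \<noteq> 0 \<and> \<bar>h\<bar> < d \<and> P h" using k by (intro exI[of _ h]) auto
  qed auto
  have "N p q = (\<Inter>k::nat. (\<Union>h\<in>{h. h \<noteq> 0 \<and> \<bar>h\<bar> < 1 / Suc k}. {x. Q x h < p}))
      \<inter> (\<Inter>k::nat. (\<Union>h\<in>{h. h \<noteq> 0 \<and> \<bar>h\<bar> < 1 / Suc k}. {x. q < Q x h}))" for p q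
    unfolding N_def freq by auto
  moreover have "open (\<Union>h\<in>{h. h \<noteq> 0 \<and> \<bar>h\<bar> < 1 / Suc k}. {x. Q x h < p})"
    "open (\<Union>h\<in>{h. h \<noteq> 0 \<and> \<bar>h\<bar> < 1 / Suc k}. {x. p < Q x h})" for k :: nat and p
    using cQ by (auto intro!: open_UN open_Collect_less continuous_on_const)
  ultimately have Nb: "N p q \<in> sets borel" for p q by auto
  have "negligible (N p q)" if "p < q" for p q
  proof (rule null_if_null_on_lines[OF Nb])
    fix x
    have lip: "(L * norm e)-lipschitz_on UNIV (\<lambda>t. F (x + t *\<^sub>R e))"
    proof (rule lipschitz_onI)
      fix s t :: real
      have "dist (F (x + s *\<^sub>R e)) (F (x + t *\<^sub>R e)) \<le> L * dist (x + s *\<^sub>R e) (x + t *\<^sub>R e)"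
        by (rule lipschitz_onD[OF F]) auto
      also have "dist (x + s *\<^sub>R e) (x + t *\<^sub>R e) = norm e * dist s t"
        by (simp add: dist_norm mult.commute flip: scaleR_left_diff_distrib)
      finally show "dist (F (x + s *\<^sub>R e)) (F (x + t *\<^sub>R e)) \<le> L * norm e * dist s t" by simp
    qed (use L in auto)
    show "negligible {t. x + t *\<^sub>R e \<in> N p q}"
      using oscillating_slopes_negligible[OF lip that] unfolding N_def Q_def
      by (simp add: scaleR_left_distrib add.assoc)
  qed
  moreover have "{x. \<not> (\<exists>l. (Q x \<longlongrightarrow> l) (at 0))} \<subseteq> (\<Union>z\<in>{z\<in>\<rat>\<times>\<rat>. fst z < snd z}. N (fst z) (snd z))"
  proof
    fix x assume x: "x \<in> {x. \<not> (\<exists>l. (Q x \<longlongrightarrow> l) (at 0))}"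
    have "\<forall>\<^sub>F h in at 0. \<bar>Q x h\<bar> \<le> L * norm e"
      unfolding eventually_at
    proof (intro exI[of _ 1] conjI ballI impI)
      fix h :: real assume "h \<noteq> 0 \<and> dist h 0 < 1"
      then show "\<bar>Q x h\<bar> \<le> L * norm e"
        using lipschitz_onD[OF F, of "x + h *\<^sub>R e" x] unfolding Q_def
        by (simp add: dist_norm abs_divide divide_le_eq mult_ac)
    qed simp
    from bounded_oscillation_free_converges[OF this] x
    obtain p q where "p \<in> \<rat>" "q \<in> \<rat>" "p < q" "\<exists>\<^sub>F h in at 0. Q x h < p" "\<exists>\<^sub>F h in at 0. q < Q x h"
      by blast
    then show "x \<in> (\<Union>z\<in>{z\<in>\<rat>\<times>\<rat>. fst z < snd z}. N (fst z) (snd z))"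
      by (intro UN_I[of "(p, q)"]) (auto simp: N_def)
  qed
  moreover have "countable {z\<in>\<rat>\<times>\<rat>::(real\<times>real) set. fst z < snd z}"
    by (rule countable_subset[of _ "\<rat> \<times> \<rat>"]) (auto simp: countable_rat)
  ultimately have "negligible (\<Union>z\<in>{z\<in>\<rat>\<times>\<rat>. fst z < snd z}. N (fst z) (snd z))"
    by (intro negligible_countable_Union) auto
  then show ?thesis
    unfolding Q_def[symmetric] by (rule negligible_subset) fact
qed

text \<open>
  The set of porous points of \<open>A\<close> is locally thin: if no point of \<open>A\<close> is within \<open>\<epsilon> \<rho>\<close> of \<open>y\<close>, where
  \<open>\<rho> = dist x y\<close>, then \<open>A\<close> misses the fraction \<open>(\<epsilon>/2)\<^sup>n\<close> of the ball of radius \<open>2 \<rho>\<close> around \<open>x\<close>.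
\<close>

lemma porous_points_negligible:
  fixes A :: "'a::euclidean_space set"
  assumes \<epsilon>: "0 < \<epsilon>"
  shows "negligible {x\<in>A. \<not> (\<exists>\<delta>>0. \<forall>y. dist x y < \<delta> \<longrightarrow> (\<exists>a\<in>A. dist a y \<le> \<epsilon> * dist x y))}"
    (is "negligible ?E")
proof (cases "\<epsilon> < 1")
  case False
  have "?E = {}"
  proof safe
    fix x assume "x \<in> A" "\<not> (\<exists>\<delta>>0. \<forall>y. dist x y < \<delta> \<longrightarrow> (\<exists>a\<in>A. dist a y \<le> \<epsilon> * dist x y))"
    moreover have "dist x y \<le> \<epsilon> * dist x y" for y
      using False mult_right_mono[of 1 \<epsilon> "dist x y"] by simp
    ultimately show "x \<in> {}" using zero_less_one by blast
  qed
  then show ?thesis using negligible_empty by metis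
next
  case True
  let ?n = "DIM('a)"
  define \<theta> where "\<theta> = 1 - (\<epsilon> / 2) ^ ?n"
  have p: "0 < (\<epsilon> / 2) ^ ?n" "(\<epsilon> / 2) ^ ?n \<le> 1" using \<epsilon> True by (auto intro!: power_le_one)
  show ?thesis
  proof (rule negligible_if_locally_thin[of \<theta>])
    show "0 \<le> \<theta>" "\<theta> < 1" using p by (auto simp: \<theta>_def)
    fix x d assume x: "x \<in> ?E" and d: "(0::real) < d"
    then have "\<forall>\<delta>>0. \<exists>y. dist x y < \<delta> \<and> (\<forall>a\<in>A. \<epsilon> * dist x y < dist a y)" by (auto simp: not_le)
    from this[rule_format, OF half_gt_zero[OF d]]
    obtain y where y: "dist x y < d / 2" "\<And>a. a \<in> A \<Longrightarrow> \<epsilon> * dist x y < dist a y" by blast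
    define \<rho> where "\<rho> = dist x y"
    have \<rho>: "0 < \<rho>" using y(2)[of x] x \<epsilon> by (auto simp: \<rho>_def)
    have sub: "ball y (\<epsilon> * \<rho>) \<subseteq> cball x (2 * \<rho>)"
    proof
      fix z assume "z \<in> ball y (\<epsilon> * \<rho>)"
      moreover have "\<epsilon> * \<rho> \<le> \<rho>" using True \<rho> by simp
      moreover have "dist x z \<le> dist x y + dist y z" by (rule dist_triangle)
      ultimately show "z \<in> cball x (2 * \<rho>)" by (simp add: \<rho>_def)
    qed
    show "\<exists>a r U. 0 < r \<and> r < d \<and> x \<in> cball a r \<and> ?E \<inter> cball a r \<subseteq> U \<and> U \<in> sets lebesgue \<and>
        emeasure lebesgue U \<le> ennreal \<theta> * emeasure lebesgue (cball a r)"
    proof (intro exI conjI)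
      show "0 < 2 * \<rho>" "2 * \<rho> < d" using \<rho> y(1) by (auto simp: \<rho>_def)
      show "x \<in> cball x (2 * \<rho>)" using \<rho> by simp
      show "?E \<inter> cball x (2 * \<rho>) \<subseteq> cball x (2 * \<rho>) - ball y (\<epsilon> * \<rho>)"
        using y(2) unfolding \<rho>_def by (fastforce simp: dist_commute)
      show "cball x (2 * \<rho>) - ball y (\<epsilon> * \<rho>) \<in> sets lebesgue" by auto
      have "emeasure lebesgue (cball x (2 * \<rho>) - ball y (\<epsilon> * \<rho>)) =
          emeasure lborel (cball x (2 * \<rho>)) - emeasure lborel (ball y (\<epsilon> * \<rho>))"
        using sub \<epsilon> \<rho> by (simp, subst emeasure_Diff) (auto simp: emeasure_ball)
      also have "\<dots> = ennreal (unit_ball_vol ?n * (2 * \<rho>) ^ ?n - unit_ball_vol ?n * (\<epsilon> * \<rho>) ^ ?n)"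
        using \<epsilon> \<rho> by (simp add: emeasure_ball emeasure_cball ennreal_minus)
      also have "unit_ball_vol ?n * (2 * \<rho>) ^ ?n - unit_ball_vol ?n * (\<epsilon> * \<rho>) ^ ?n = \<theta> * (unit_ball_vol ?n * (2 * \<rho>) ^ ?n)"
        by (simp add: \<theta>_def algebra_simps power_mult_distrib power_divide)
      also have "ennreal \<dots> = ennreal \<theta> * emeasure lebesgue (cball x (2 * \<rho>))"
        using \<rho> p by (simp add: emeasure_cball ennreal_mult \<theta>_def)
      finally show "emeasure lebesgue (cball x (2 * \<rho>) - ball y (\<epsilon> * \<rho>)) \<le>
          ennreal \<theta> * emeasure lebesgue (cball x (2 * \<rho>))" by simp
    qed
  qed
qed

lemma negligible_UN_countable:
  assumes "countable I" "\<And>i. i \<in> I \<Longrightarrow> negligible (X i)"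
  shows "negligible (\<Union>i\<in>I. X i)"
  using assms by (intro negligible_countable_Union) auto

text \<open>
  The total derivative is assembled from partial derivatives. The set \<open>A j i q k\<close> collects the points at which
  the increments in direction \<open>i\<close> have slope \<open>q\<close> up to \<open>\<epsilon> j\<close> at all scales below \<open>1 / (k + 1)\<close>. There are
  countably many such sets, so almost every point is a porous point of none of them. At such a point \<open>x\<close> the
  increment from \<open>y\<close> near \<open>x\<close> can be compared, by the Lipschitz condition, with the increment from a point of the
  same set at distance \<open>o(dist x y)\<close> from \<open>y\<close>. Summing the increments along a path of coordinate segments gives
  the derivative.
\<close>

theorem rademacher_real:
  fixes F :: "'a::euclidean_space \<Rightarrow> real"
  assumes F: "L-lipschitz_on UNIV F"
  shows "negligible {x. \<not> F differentiable at x}"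
proof -
  have L: "0 \<le> L" using F lipschitz_on_nonneg by blast
  define \<epsilon> where "\<epsilon> j = 1 / real (Suc j)" for j
  define A where "A = (\<lambda>j i q k. {x. \<forall>h::real. \<bar>h\<bar> < 1 / real (Suc k) \<longrightarrow> \<bar>F (x + h *\<^sub>R i) - F x - h * q\<bar> \<le> \<epsilon> j * \<bar>h\<bar>})"
  define P where "P = (\<lambda>A e. {x\<in>A::'a set. \<not> (\<exists>\<delta>>0. \<forall>y. dist x y < \<delta> \<longrightarrow> (\<exists>a\<in>A. dist a y \<le> e * dist x y))})"
  define N1 where "N1 = (\<lambda>i. {x. \<not> (\<exists>l. ((\<lambda>h. (F (x + h *\<^sub>R i) - F x) / h) \<longlongrightarrow> l) (at 0))})"
  have \<epsilon>: "0 < \<epsilon> j" for j by (simp add: \<epsilon>_def)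
  define Bad where "Bad = (\<Union>i\<in>Basis. N1 i) \<union> (\<Union>j. \<Union>i\<in>Basis. \<Union>q\<in>\<rat>. \<Union>k. P (A j i q k) (\<epsilon> j))"
  have "negligible (P (A j i q k) (\<epsilon> j))" for j i q k
    unfolding P_def by (rule porous_points_negligible[OF \<epsilon>])
  moreover have "negligible (N1 i)" for i
    unfolding N1_def by (rule directional_derivative_ae[OF F])
  ultimately have "negligible Bad"
    unfolding Bad_def
    by (intro negligible_Un negligible_UN_countable) (simp_all add: countable_rat countable_finite)
  moreover have "{x. \<not> F differentiable at x} \<subseteq> Bad"
  proof (rule subsetI, rule ccontr)
    fix x assume x: "x \<in> {x. \<not> F differentiable at x}" and nb: "x \<notin> Bad"
    have "\<exists>l. ((\<lambda>h. (F (x + h *\<^sub>R i) - F x) / h) \<longlongrightarrow> l) (at 0)" if "i \<in> Basis" for i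
      using nb that unfolding Bad_def N1_def by blast
    then have "\<exists>D. \<forall>i\<in>Basis. ((\<lambda>h. (F (x + h *\<^sub>R i) - F x) / h) \<longlongrightarrow> D i) (at 0)"
      by (intro bchoice) blast
    then obtain D where D: "\<And>i. i \<in> Basis \<Longrightarrow> ((\<lambda>h. (F (x + h *\<^sub>R i) - F x) / h) \<longlongrightarrow> D i) (at 0)"
      by blast
    define T where "T v = (\<Sum>i\<in>Basis. (v \<bullet> i) * D i)" for v
    have "(F has_derivative T) (at x)"
      unfolding has_derivative_at_alt
    proof (intro conjI allI impI)
      show "bounded_linear T" unfolding T_def by (auto intro!: bounded_linear_intros)
      fix e :: real assume e: "0 < e"
      let ?n = "real DIM('a)"
      have n: "0 < ?n" by simp
      have cpos: "0 < e / (?n * (2 + 2 * L))" using e n L by auto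
      obtain j where j: "\<epsilon> j < e / (?n * (2 + 2 * L))"
        using nat_approx_posE[OF cpos] unfolding \<epsilon>_def by metis
      have "0 < ?n * (2 + 2 * L)" using n L by simp
      then have j': "?n * (2 + 2 * L) * \<epsilon> j \<le> e" using j by (simp add: pos_less_divide_eq mult.commute)
      have "\<exists>q \<delta>. 0 < \<delta> \<and> \<bar>q - D i\<bar> \<le> \<epsilon> j \<and> (\<forall>y. dist x y < \<delta> \<longrightarrow> (\<forall>h. \<bar>h\<bar> < \<delta> \<longrightarrow>
            \<bar>F (y + h *\<^sub>R i) - F y - h * q\<bar> \<le> \<epsilon> j * \<bar>h\<bar> + 2 * L * \<epsilon> j * dist x y))"
        if i: "i \<in> Basis" for i
      proof -
        obtain q where q: "q \<in> \<rat>" "D i < q" "q < D i + \<epsilon> j / 2"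
          using Rats_dense_in_real[of "D i" "D i + \<epsilon> j / 2"] \<epsilon>[of j] by auto
        have "\<forall>\<^sub>F h in at 0. dist ((F (x + h *\<^sub>R i) - F x) / h) (D i) < \<epsilon> j / 2"
          using tendstoD[OF D[OF i], of "\<epsilon> j / 2"] \<epsilon>[of j] by simp
        then obtain d where d: "0 < d" "\<And>h. h \<noteq> 0 \<Longrightarrow> \<bar>h\<bar> < d \<Longrightarrow> \<bar>(F (x + h *\<^sub>R i) - F x) / h - D i\<bar> < \<epsilon> j / 2"
          unfolding eventually_at by (auto simp: dist_real_def)
        obtain k where k: "1 / real (Suc k) < d" using nat_approx_posE[OF d(1)] by blast
        have "x \<in> A j i q k"
          unfolding A_def
        proof (intro CollectI allI impI)
          fix h :: real assume h: "\<bar>h\<bar> < 1 / real (Suc k)"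
          show "\<bar>F (x + h *\<^sub>R i) - F x - h * q\<bar> \<le> \<epsilon> j * \<bar>h\<bar>"
          proof (cases "h = 0")
            case False
            have "\<bar>(F (x + h *\<^sub>R i) - F x) / h - q\<bar> \<le> \<epsilon> j"
              using d(2)[OF False] h k q by linarith
            then have "\<bar>(F (x + h *\<^sub>R i) - F x) / h - q\<bar> * \<bar>h\<bar> \<le> \<epsilon> j * \<bar>h\<bar>" by (rule mult_right_mono) simp
            also have "\<bar>(F (x + h *\<^sub>R i) - F x) / h - q\<bar> * \<bar>h\<bar> = \<bar>((F (x + h *\<^sub>R i) - F x) / h - q) * h\<bar>"
              by (simp add: abs_mult)
            also have "((F (x + h *\<^sub>R i) - F x) / h - q) * h = F (x + h *\<^sub>R i) - F x - h * q"
              using False by (simp add: left_diff_distrib[of "_ / h"])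
            finally show ?thesis .
          qed simp
        qed
        moreover have "x \<notin> P (A j i q k) (\<epsilon> j)"
        proof
          assume "x \<in> P (A j i q k) (\<epsilon> j)"
          then have "x \<in> (\<Union>j. \<Union>i\<in>Basis. \<Union>q\<in>\<rat>. \<Union>k. P (A j i q k) (\<epsilon> j))"
            using i q(1) by (intro UN_I[OF UNIV_I] UN_I[OF i] UN_I[OF q(1)])
          then have "x \<in> Bad" unfolding Bad_def by (rule UnI2)
          then show False using nb by contradiction
        qed
        ultimately obtain \<delta> where \<delta>: "0 < \<delta>" "\<And>y. dist x y < \<delta> \<Longrightarrow> \<exists>a\<in>A j i q k. dist a y \<le> \<epsilon> j * dist x y"
          unfolding P_def by blast
        have "\<bar>F (y + h *\<^sub>R i) - F y - h * q\<bar> \<le> \<epsilon> j * \<bar>h\<bar> + 2 * L * \<epsilon> j * dist x y"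
          if y: "dist x y < min \<delta> (1 / real (Suc k))" and h: "\<bar>h\<bar> < min \<delta> (1 / real (Suc k))" for y h
        proof -
          obtain a where a: "a \<in> A j i q k" "dist a y \<le> \<epsilon> j * dist x y" using \<delta>(2)[of y] y by auto
          have 1: "\<bar>F (a + h *\<^sub>R i) - F a - h * q\<bar> \<le> \<epsilon> j * \<bar>h\<bar>" using a(1) h unfolding A_def by auto
          have Ld: "L * dist a y \<le> L * (\<epsilon> j * dist x y)" using a(2) L by (rule mult_left_mono)
          have 2: "\<bar>F a - F y\<bar> \<le> L * (\<epsilon> j * dist x y)"
            using lipschitz_onD[OF F, of a y] Ld by (simp add: dist_real_def)
          have 3: "\<bar>F (a + h *\<^sub>R i) - F (y + h *\<^sub>R i)\<bar> \<le> L * (\<epsilon> j * dist x y)"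
            using lipschitz_onD[OF F, of "a + h *\<^sub>R i" "y + h *\<^sub>R i"] Ld by (simp add: dist_real_def)
          have eq: "2 * L * \<epsilon> j * dist x y = 2 * (L * (\<epsilon> j * dist x y))" by simp
          show ?thesis using 1 2 3 unfolding eq abs_le_iff by linarith
        qed
        then show ?thesis using \<delta>(1) q \<epsilon>[of j] by (intro exI[of _ q] exI[of _ "min \<delta> (1 / real (Suc k))"]) auto
      qed
      then have "\<forall>i\<in>Basis. \<exists>q \<delta>. 0 < \<delta> \<and> \<bar>q - D i\<bar> \<le> \<epsilon> j \<and> (\<forall>y. dist x y < \<delta> \<longrightarrow> (\<forall>h. \<bar>h\<bar> < \<delta> \<longrightarrow>
            \<bar>F (y + h *\<^sub>R i) - F y - h * q\<bar> \<le> \<epsilon> j * \<bar>h\<bar> + 2 * L * \<epsilon> j * dist x y))"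
        by (rule ballI)
      then obtain q \<delta> where *: "\<forall>i\<in>Basis. 0 < \<delta> i \<and> \<bar>q i - D i\<bar> \<le> \<epsilon> j \<and> (\<forall>y. dist x y < \<delta> i \<longrightarrow> (\<forall>h. \<bar>h\<bar> < \<delta> i \<longrightarrow>
            \<bar>F (y + h *\<^sub>R i) - F y - h * q i\<bar> \<le> \<epsilon> j * \<bar>h\<bar> + 2 * L * \<epsilon> j * dist x y))"
        unfolding bchoice_iff by (elim exE)
      then have q: "\<And>i. i \<in> Basis \<Longrightarrow> \<bar>q i - D i\<bar> \<le> \<epsilon> j"
        and \<delta>: "\<And>i. i \<in> Basis \<Longrightarrow> 0 < \<delta> i"
        and near: "\<And>i y h. i \<in> Basis \<Longrightarrow> dist x y < \<delta> i \<Longrightarrow> \<bar>h\<bar> < \<delta> i \<Longrightarrow>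
            \<bar>F (y + h *\<^sub>R i) - F y - h * q i\<bar> \<le> \<epsilon> j * \<bar>h\<bar> + 2 * L * \<epsilon> j * dist x y"
        by simp_all
      define d where "d = Min (\<delta> ` Basis)"
      have d: "0 < d" "\<And>i. i \<in> Basis \<Longrightarrow> d \<le> \<delta> i" unfolding d_def using \<delta> by auto
      show "\<exists>d>0. \<forall>y. norm (y - x) < d \<longrightarrow> norm (F y - F x - T (y - x)) \<le> e * norm (y - x)"
      proof (intro exI[of _ d] conjI allI impI d(1))
        fix z assume z: "norm (z - x) < d"
        define v where "v = z - x"
        \<comment> \<open>the corners of a path of coordinate segments from \<open>x\<close> to \<open>z\<close>, relative to \<open>x\<close>\<close>
        define s where "s B = (\<Sum>i\<in>B. (v \<bullet> i) *\<^sub>R i)" for B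
        have sn: "norm (s B) \<le> norm v" if "B \<subseteq> Basis" for B
        proof -
          have "finite B" using that finite_subset finite_Basis by blast
          have "s B \<bullet> b = (if b \<in> B then v \<bullet> b else 0)" if "b \<in> Basis" for b
          proof -
            have "s B \<bullet> b = (\<Sum>i\<in>B. if i = b then v \<bullet> b else 0)"
              unfolding s_def inner_sum_left using that \<open>B \<subseteq> Basis\<close>
              by (intro sum.cong) (auto simp: inner_Basis)
            then show ?thesis using \<open>finite B\<close> by simp
          qed
          then show ?thesis by (intro norm_le_componentwise) auto
        qed
        have tele: "\<bar>F (x + s B) - F x - (\<Sum>i\<in>B. (v \<bullet> i) * q i)\<bar> \<le> real (card B) * ((1 + 2 * L) * \<epsilon> j * norm v)"
          if "finite B" "B \<subseteq> Basis" for B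
          using that
        proof (induction B)
          case empty
          then show ?case by (simp add: s_def)
        next
          case (insert b B)
          have vb: "\<bar>v \<bullet> b\<bar> \<le> norm v" using insert.prems by (simp add: Basis_le_norm)
          have db: "dist x (x + s B) \<le> norm v" using sn[of B] insert.prems by (simp add: dist_norm)
          have lt: "norm v < \<delta> b" using z d(2)[of b] insert.prems by (auto simp: v_def)
          have "\<bar>F ((x + s B) + (v \<bullet> b) *\<^sub>R b) - F (x + s B) - (v \<bullet> b) * q b\<bar> \<le> \<epsilon> j * \<bar>v \<bullet> b\<bar> + 2 * L * \<epsilon> j * dist x (x + s B)"
            using vb db lt insert.prems by (intro near) auto
          also have "\<dots> \<le> \<epsilon> j * norm v + 2 * L * \<epsilon> j * norm v"
            using vb db L \<epsilon>[of j] by (intro add_mono mult_left_mono) auto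
          also have "\<dots> = (1 + 2 * L) * \<epsilon> j * norm v" by (simp add: algebra_simps)
          finally have 1: "\<bar>F ((x + s B) + (v \<bullet> b) *\<^sub>R b) - F (x + s B) - (v \<bullet> b) * q b\<bar> \<le> (1 + 2 * L) * \<epsilon> j * norm v" .
          have 2: "(x + s B) + (v \<bullet> b) *\<^sub>R b = x + s (insert b B)"
            using insert.hyps by (simp add: s_def add_ac)
          have 3: "\<bar>F (x + s B) - F x - (\<Sum>i\<in>B. (v \<bullet> i) * q i)\<bar> \<le> real (card B) * ((1 + 2 * L) * \<epsilon> j * norm v)"
            using insert by simp
          have 4: "real (card (insert b B)) * ((1 + 2 * L) * \<epsilon> j * norm v)
              = real (card B) * ((1 + 2 * L) * \<epsilon> j * norm v) + (1 + 2 * L) * \<epsilon> j * norm v"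
            using insert.hyps by (simp add: distrib_right)
          have 5: "(\<Sum>i\<in>insert b B. (v \<bullet> i) * q i) = (v \<bullet> b) * q b + (\<Sum>i\<in>B. (v \<bullet> i) * q i)"
            using insert.hyps by simp
          show ?case using 1 3 unfolding 2 4 5 abs_le_iff by linarith
        qed
        have sB: "s Basis = v" by (simp add: s_def euclidean_representation)
        have A1: "\<bar>F z - F x - (\<Sum>i\<in>Basis. (v \<bullet> i) * q i)\<bar> \<le> ?n * ((1 + 2 * L) * \<epsilon> j * norm v)"
          using tele[of Basis] unfolding sB by (simp add: v_def)
        have "\<bar>(\<Sum>i\<in>Basis. (v \<bullet> i) * q i) - T v\<bar> = \<bar>\<Sum>i\<in>Basis. (v \<bullet> i) * (q i - D i)\<bar>"
          unfolding T_def by (simp add: sum_subtractf[symmetric] right_diff_distrib)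
        also have "\<dots> \<le> (\<Sum>i\<in>(Basis::'a set). norm v * \<epsilon> j)"
          by (rule order_trans[OF sum_abs], rule sum_mono) (auto simp: abs_mult Basis_le_norm q intro!: mult_mono)
        also have "\<dots> = ?n * (\<epsilon> j * norm v)" by simp
        finally have A2: "\<bar>(\<Sum>i\<in>Basis. (v \<bullet> i) * q i) - T v\<bar> \<le> ?n * (\<epsilon> j * norm v)" .
        have "\<bar>F z - F x - T v\<bar> \<le> ?n * ((1 + 2 * L) * \<epsilon> j * norm v) + ?n * (\<epsilon> j * norm v)"
          using A1 A2 unfolding abs_le_iff by linarith
        also have "\<dots> = ?n * (2 + 2 * L) * \<epsilon> j * norm v" by (simp add: algebra_simps)
        also have "\<dots> \<le> e * norm v" using j' by (rule mult_right_mono) simp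
        finally show "norm (F z - F x - T (z - x)) \<le> e * norm (z - x)" by (simp add: v_def)
      qed
    qed
    then show False using x differentiableI by blast
  qed
  ultimately show ?thesis by (rule negligible_subset)
qed

text \<open>
  Near each point, \<open>F\<close> agrees with its composition with the nearest-point projection onto a small ball, and
  this composition is globally Lipschitz.
\<close>

lemma rademacher_locally_lipschitz:
  fixes F :: "'a::euclidean_space \<Rightarrow> real"
  assumes F: "locally_lipschitz F"
  shows "negligible {x. \<not> F differentiable at x}" (is "negligible ?S")
proof (rule iffD2[OF locally_negligible_alt], intro ballI)
  fix x assume x: "x \<in> ?S"
  obtain e L where e: "0 < e" "L-lipschitz_on (ball x e) F"
    using F unfolding locally_lipschitz_def by blast
  define G where "G = F \<circ> closest_point (cball x (e / 2))"
  have cp: "closest_point (cball x (e / 2)) y \<in> cball x (e / 2)" for y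
    using e by (intro closest_point_in_set) auto
  moreover have "cball x (e / 2) \<subseteq> ball x e" using e by auto
  ultimately have cp': "closest_point (cball x (e / 2)) y \<in> ball x e" for y by blast
  have "L-lipschitz_on UNIV G"
  proof (rule lipschitz_onI)
    fix y z
    have "dist (G y) (G z) \<le> L * dist (closest_point (cball x (e / 2)) y) (closest_point (cball x (e / 2)) z)"
      unfolding G_def o_def using cp' by (intro lipschitz_onD[OF e(2)])
    also have "\<dots> \<le> L * dist y z"
      using e lipschitz_on_nonneg[OF e(2)] by (intro mult_left_mono closest_point_lipschitz) auto
    finally show "dist (G y) (G z) \<le> L * dist y z" .
  qed (rule lipschitz_on_nonneg[OF e(2)])
  then have G: "negligible {x. \<not> G differentiable at x}" by (rule rademacher_real)
  have "?S \<inter> ball x (e / 2) \<subseteq> {x. \<not> G differentiable at x}"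
  proof safe
    fix y assume y: "y \<in> ball x (e / 2)" "\<not> F differentiable at y" "G differentiable at y"
    then obtain D where D: "(G has_derivative D) (at y)" unfolding differentiable_def by blast
    have "(F has_derivative D) (at y)"
    proof (rule has_derivative_transform_within_open[OF D])
      show "G z = F z" if "z \<in> ball x (e / 2)" for z
        using that by (simp add: G_def closest_point_self)
    qed (use y in auto)
    then show False using y(2) differentiableI by blast
  qed
  then have "negligible (?S \<inter> ball x (e / 2))" using G negligible_subset by blast
  then show "\<exists>U. openin (top_of_set ?S) U \<and> x \<in> U \<and> negligible U"
    using x e by (intro exI[of _ "?S \<inter> ball x (e / 2)"]) auto
qed

section \<open>Hausdorff measure of images\<close>

lemma hausdorff_pre_UN_countable:
  assumes C: "countable C" and \<delta>: "0 < \<delta>"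
  shows "hausdorff_pre k \<delta> (\<Union>i\<in>C. S i) \<le> (\<integral>\<^sup>+i. hausdorff_pre k \<delta> (S i) \<partial>count_space C)"
proof -
  define N where "N = to_nat_on C ` C"
  define T where "T n = (if n \<in> N then S (from_nat_into C n) else {})" for n
  have inj: "from_nat_into C (to_nat_on C i) = i" if "i \<in> C" for i
    using C that by simp
  have U: "(\<Union>i\<in>C. S i) = (\<Union>n. T n)"
    unfolding T_def N_def using inj by (auto split: if_splits)
  have "hausdorff_pre k \<delta> (\<Union>i\<in>C. S i) \<le> (\<Sum>n. hausdorff_pre k \<delta> (T n))"
    unfolding U by (rule hausdorff_pre_UN)
  also have "\<dots> = (\<integral>\<^sup>+n. hausdorff_pre k \<delta> (T n) \<partial>count_space UNIV)"
    by (rule nn_integral_count_space_nat[symmetric])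
  also have "\<dots> = (\<integral>\<^sup>+n. hausdorff_pre k \<delta> (T n) \<partial>count_space N)"
    by (subst nn_integral_count_space_indicator[of N])
      (auto simp: T_def indicator_def hausdorff_pre_empty[OF \<delta>] intro!: nn_integral_cong)
  also have "\<dots> = (\<integral>\<^sup>+i. hausdorff_pre k \<delta> (T (to_nat_on C i)) \<partial>count_space C)"
    by (rule nn_integral_bij_count_space[symmetric])
      (auto simp: N_def intro!: inj_on_imp_bij_betw inj_on_to_nat_on C)
  also have "\<dots> = (\<integral>\<^sup>+i. hausdorff_pre k \<delta> (S i) \<partial>count_space C)"
    by (intro nn_integral_cong) (auto simp: T_def N_def inj)
  finally show ?thesis .
qed

lemma hausdorff_pre_le_cballs:
  fixes S :: "'a::metric_space set"
  assumes cover: "S \<subseteq> (\<Union>i<N. T i)" and T: "\<And>i. i < N \<Longrightarrow> \<exists>z. T i \<subseteq> cball z s" and s: "0 \<le> s"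
  shows "hausdorff_pre k (2 * s) S \<le> ennreal (real N * (unit_ball_vol k * s ^ k))"
proof -
  define A where "A i = (if i < N then T i else {})" for i
  have d: "bounded (A i) \<and> diameter (A i) \<le> 2 * s" for i
  proof (cases "i < N")
    case True
    then obtain z where z: "T i \<subseteq> cball z s" using T by blast
    have "bounded (T i)" using z bounded_cball bounded_subset by blast
    moreover have "diameter (T i) \<le> 2 * s"
    proof (cases "T i = {}")
      case False
      have "dist x y \<le> 2 * s" if "x \<in> T i" "y \<in> T i" for x y
      proof -
        have "dist z x \<le> s" "dist z y \<le> s" using z that by auto
        then show ?thesis using dist_triangle3[of x y z] by linarith
      qed
      then show ?thesis unfolding diameter_def using False by (auto intro!: cSUP_least)
    qed (use s in simp)
    ultimately show ?thesis using True by (simp add: A_def)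
  qed (use s in \<open>simp add: A_def\<close>)
  have "A \<in> hausdorff_covers (2 * s) S"
    using cover d by (auto simp: hausdorff_covers_def A_def subset_eq)
  then have "hausdorff_pre k (2 * s) S \<le> (\<Sum>i. hausdorff_weight k (A i))" by (rule hausdorff_pre_le)
  also have "\<dots> = (\<Sum>i<N. hausdorff_weight k (A i))"
    by (rule suminf_finite) (auto simp: A_def)
  also have "\<dots> \<le> (\<Sum>i<N. ennreal (unit_ball_vol k * s ^ k))"
  proof (rule sum_mono)
    fix i
    have "(diameter (A i) / 2) ^ k \<le> s ^ k"
      using d[of i] diameter_ge_0[of "A i"] by (intro power_mono) auto
    then show "hausdorff_weight k (A i) \<le> ennreal (unit_ball_vol k * s ^ k)"
      unfolding hausdorff_weight_def by (auto intro!: ennreal_leI mult_left_mono)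
  qed
  also have "\<dots> = ennreal (real N * (unit_ball_vol k * s ^ k))"
    using s by (simp add: ennreal_mult ennreal_of_nat_eq_real_of_nat)
  finally show ?thesis .
qed

text \<open>
  By the covering lemma there are disjoint balls in \<open>V\<close> whose fivefold enlargements cover \<open>A\<close>. The images of
  the enlargements cover \<open>F ` A\<close> at a total cost controlled by the volume of the disjoint balls.
\<close>

lemma hausdorff_outer_image_le_open:
  fixes F :: "'a::euclidean_space \<Rightarrow> 'b::metric_space"
  assumes V: "open V" "A \<subseteq> V" and c: "0 \<le> c" and D: "0 < D"
    and loc: "\<And>x. x \<in> A \<Longrightarrow> \<exists>\<rho>0>0. \<forall>\<rho>. 0 < \<rho> \<longrightarrow> \<rho> < \<rho>0 \<longrightarrow>
      hausdorff_pre k (D * \<rho>) (F ` cball x \<rho>) \<le> ennreal (c * \<rho> ^ DIM('a))"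
  shows "hausdorff_outer k (F ` A) \<le> ennreal (c * 5 ^ DIM('a) / unit_ball_vol DIM('a)) * emeasure lebesgue V"
  unfolding hausdorff_outer_def
proof (rule SUP_least)
  let ?n = "DIM('a)"
  fix \<delta> :: real assume "\<delta> \<in> {0<..}"
  then have \<delta>: "0 < \<delta>" by simp
  have "\<forall>x\<in>A. \<exists>r. 0 < r \<and> r \<le> 1 \<and> cball x r \<subseteq> V \<and>
      hausdorff_pre k \<delta> (F ` cball x (5 * r)) \<le> ennreal (c * (5 * r) ^ ?n)"
  proof
    fix x assume x: "x \<in> A"
    then obtain \<rho>0 where \<rho>0: "0 < \<rho>0" "\<And>\<rho>. 0 < \<rho> \<Longrightarrow> \<rho> < \<rho>0 \<Longrightarrow>
      hausdorff_pre k (D * \<rho>) (F ` cball x \<rho>) \<le> ennreal (c * \<rho> ^ ?n)" using loc by blast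
    obtain e where e: "0 < e" "cball x e \<subseteq> V" using V x open_contains_cball by blast
    define r where "r = Min {1, e, \<rho>0 / 6, \<delta> / (5 * D)}"
    have r: "0 < r" "r \<le> 1" "r \<le> e" "r \<le> \<rho>0 / 6" "r \<le> \<delta> / (5 * D)"
      using \<rho>0 e \<delta> D by (auto simp: r_def)
    have "hausdorff_pre k \<delta> (F ` cball x (5 * r)) \<le> hausdorff_pre k (D * (5 * r)) (F ` cball x (5 * r))"
      using r(5) D by (intro hausdorff_pre_antimono) (simp add: field_simps)
    also have "\<dots> \<le> ennreal (c * (5 * r) ^ ?n)" using r(1,4) \<rho>0(1) by (intro \<rho>0(2)) auto
    finally show "\<exists>r. 0 < r \<and> r \<le> 1 \<and> cball x r \<subseteq> V \<and>
      hausdorff_pre k \<delta> (F ` cball x (5 * r)) \<le> ennreal (c * (5 * r) ^ ?n)"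
      using r e by (intro exI[of _ r]) auto
  qed
  then obtain r where r: "\<forall>x\<in>A. 0 < r x \<and> r x \<le> 1 \<and> cball x (r x) \<subseteq> V \<and>
      hausdorff_pre k \<delta> (F ` cball x (5 * r x)) \<le> ennreal (c * (5 * r x) ^ ?n)"
    unfolding bchoice_iff by blast
  have cov: "A \<subseteq> (\<Union>x\<in>A. cball x (r x))" using r by force
  obtain C where C: "countable C" "C \<subseteq> A"
     "pairwise (\<lambda>i j. disjnt (cball i (r i)) (cball j (r j))) C"
     "A \<subseteq> (\<Union>i\<in>C. cball i (5 * r i))"
    using Vitali_covering_lemma_cballs[where S=A and K=A and a="\<lambda>x. x" and r=r and B=1, OF cov] r by blast
  have "hausdorff_pre k \<delta> (F ` A) \<le> hausdorff_pre k \<delta> (\<Union>i\<in>C. F ` cball i (5 * r i))"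
    using C(4) by (intro hausdorff_pre_mono) blast
  also have "\<dots> \<le> (\<integral>\<^sup>+i. hausdorff_pre k \<delta> (F ` cball i (5 * r i)) \<partial>count_space C)"
    by (rule hausdorff_pre_UN_countable[OF C(1) \<delta>])
  also have "\<dots> \<le> (\<integral>\<^sup>+i. ennreal (c * 5 ^ ?n / unit_ball_vol ?n) * emeasure lebesgue (cball i (r i)) \<partial>count_space C)"
  proof (rule nn_integral_mono)
    fix i assume "i \<in> space (count_space C)"
    then have i: "i \<in> A" using C(2) by auto
    have "hausdorff_pre k \<delta> (F ` cball i (5 * r i)) \<le> ennreal (c * (5 * r i) ^ ?n)" using r i by blast
    also have "c * (5 * r i) ^ ?n = c * 5 ^ ?n / unit_ball_vol ?n * (unit_ball_vol ?n * r i ^ ?n)"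
      using unit_ball_vol_pos[of "real ?n"] by (simp add: power_mult_distrib less_imp_neq[THEN not_sym])
    also have "ennreal \<dots> = ennreal (c * 5 ^ ?n / unit_ball_vol ?n) * ennreal (unit_ball_vol ?n * r i ^ ?n)"
      using c r i by (intro ennreal_mult) auto
    also have "ennreal (unit_ball_vol ?n * r i ^ ?n) = emeasure lebesgue (cball i (r i))"
      using r i by (simp add: emeasure_cball less_imp_le)
    finally show "hausdorff_pre k \<delta> (F ` cball i (5 * r i)) \<le> ennreal (c * 5 ^ ?n / unit_ball_vol ?n) * emeasure lebesgue (cball i (r i))" .
  qed
  also have "\<dots> = ennreal (c * 5 ^ ?n / unit_ball_vol ?n) * (\<integral>\<^sup>+i. emeasure lebesgue (cball i (r i)) \<partial>count_space C)"
    by (rule nn_integral_cmult) auto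
  also have "(\<integral>\<^sup>+i. emeasure lebesgue (cball i (r i)) \<partial>count_space C) = emeasure lebesgue (\<Union>i\<in>C. cball i (r i))"
    using C(1,3) by (intro emeasure_UN_countable[symmetric]) (auto simp: disjoint_family_on_def pairwise_def disjnt_def)
  also have "\<dots> \<le> emeasure lebesgue V"
  proof (intro emeasure_mono UN_least)
    show "cball i (r i) \<subseteq> V" if "i \<in> C" for i using that C(2) r by blast
  qed (use V in auto)
  finally show "hausdorff_pre k \<delta> (F ` A) \<le> ennreal (c * 5 ^ ?n / unit_ball_vol ?n) * emeasure lebesgue V"
    by (simp add: mult_left_mono)
qed

lemma hausdorff_outer_image_le:
  fixes F :: "'a::euclidean_space \<Rightarrow> 'b::metric_space"
  assumes A: "A \<in> sets lebesgue" and c: "0 \<le> c" and D: "0 < D"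
    and loc: "\<And>x. x \<in> A \<Longrightarrow> \<exists>\<rho>0>0. \<forall>\<rho>. 0 < \<rho> \<longrightarrow> \<rho> < \<rho>0 \<longrightarrow>
      hausdorff_pre k (D * \<rho>) (F ` cball x \<rho>) \<le> ennreal (c * \<rho> ^ DIM('a))"
  shows "hausdorff_outer k (F ` A) \<le> ennreal (c * 5 ^ DIM('a) / unit_ball_vol DIM('a)) * emeasure lebesgue A"
proof -
  define K where "K = c * 5 ^ DIM('a) / unit_ball_vol DIM('a)"
  have c': "0 \<le> K" using c by (simp add: K_def)
  show ?thesis
    unfolding K_def[symmetric]
  proof (rule ennreal_le_epsilon)
    fix e :: real assume e: "0 < e"
    have "0 < e / (K + 1)" using e c' by auto
    then obtain V where V: "open V" "A \<subseteq> V" "V - A \<in> lmeasurable" "emeasure lebesgue (V - A) < ennreal (e / (K + 1))"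
      using sets_lebesgue_outer_open[OF A] by blast
    have "emeasure lebesgue V = emeasure lebesgue A + emeasure lebesgue (V - A)"
      using V A by (subst plus_emeasure) (auto simp: Un_absorb1)
    also have "\<dots> \<le> emeasure lebesgue A + ennreal (e / (K + 1))" using V by (intro add_left_mono) auto
    finally have "hausdorff_outer k (F ` A) \<le> ennreal K * (emeasure lebesgue A + ennreal (e / (K + 1)))"
      using hausdorff_outer_image_le_open[OF V(1,2) c D loc] unfolding K_def[symmetric]
      by (meson mult_left_mono order_trans zero_le)
    also have "\<dots> = ennreal K * emeasure lebesgue A + ennreal (K * (e / (K + 1)))"
      using c' e by (simp only: distrib_left) (simp add: ennreal_mult[symmetric])
    also have "\<dots> \<le> ennreal K * emeasure lebesgue A + ennreal e"
    proof (intro add_left_mono ennreal_leI)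
      have "K * (e / (K + 1)) = e * (K / (K + 1))" by simp
      also have "\<dots> \<le> e * 1" using c' e by (intro mult_left_mono) (auto simp: divide_le_eq)
      finally show "K * (e / (K + 1)) \<le> e" by simp
    qed
    finally show "hausdorff_outer k (F ` A) \<le> ennreal K * emeasure lebesgue A + ennreal e" .
  qed
qed

text \<open>
  The points at which \<open>F\<close> has local Lipschitz constant \<open>j\<close> satisfy the local hypothesis of the previous
  lemma with one constant for each \<open>j\<close>.
\<close>

lemma hausdorff_outer_image_negligible:
  fixes F :: "'a::euclidean_space \<Rightarrow> 'b::metric_space"
  assumes F: "locally_lipschitz F" and A: "negligible A"
  shows "hausdorff_outer DIM('a) (F ` A) = 0"
proof -
  let ?n = "DIM('a)"
  define B where "B j = {x\<in>A. \<exists>e>0. \<forall>y\<in>ball x e. dist (F x) (F y) \<le> real j * dist x y}" for j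
  have "hausdorff_outer ?n (F ` B j) = 0" for j
  proof -
    have nB: "negligible (B j)" using A by (rule negligible_subset) (auto simp: B_def)
    let ?M = "real j + 1" let ?c = "unit_ball_vol ?n * ?M ^ ?n"
    have "hausdorff_outer ?n (F ` B j) \<le> ennreal (?c * 5 ^ ?n / unit_ball_vol ?n) * emeasure lebesgue (B j)"
    proof (rule hausdorff_outer_image_le)
      show "B j \<in> sets lebesgue" using nB by (rule negligible_imp_sets)
      show "0 \<le> ?c" "0 < 2 * ?M" by auto
      fix x assume "x \<in> B j"
      then obtain e where e: "0 < e" "\<And>y. y \<in> ball x e \<Longrightarrow> dist (F x) (F y) \<le> real j * dist x y"
        unfolding B_def by blast
      show "\<exists>\<rho>0>0. \<forall>\<rho>. 0 < \<rho> \<longrightarrow> \<rho> < \<rho>0 \<longrightarrow> hausdorff_pre ?n (2 * ?M * \<rho>) (F ` cball x \<rho>) \<le> ennreal (?c * \<rho> ^ ?n)"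
      proof (intro exI[of _ e] conjI allI impI e(1))
        fix \<rho> assume \<rho>: "0 < \<rho>" "\<rho> < e"
        have "F ` cball x \<rho> \<subseteq> cball (F x) (?M * \<rho>)"
        proof safe
          fix y assume y: "y \<in> cball x \<rho>"
          have "dist (F x) (F y) \<le> real j * dist x y" using y \<rho> by (intro e(2)) auto
          also have "\<dots> \<le> ?M * \<rho>" using y by (intro mult_mono) auto
          finally show "F y \<in> cball (F x) (?M * \<rho>)" by simp
        qed
        then have "hausdorff_pre ?n (2 * (?M * \<rho>)) (F ` cball x \<rho>) \<le> ennreal (real 1 * (unit_ball_vol ?n * (?M * \<rho>) ^ ?n))"
          using \<rho> by (intro hausdorff_pre_le_cballs[where N=1 and T="\<lambda>_. F ` cball x \<rho>"]) auto
        then show "hausdorff_pre ?n (2 * ?M * \<rho>) (F ` cball x \<rho>) \<le> ennreal (?c * \<rho> ^ ?n)"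
          by (simp add: power_mult_distrib mult.assoc[symmetric])
      qed
    qed
    also have "emeasure lebesgue (B j) = 0" using nB unfolding negligible_iff_null_sets by (rule null_setsD1)
    finally show ?thesis by simp
  qed
  moreover have "F ` A \<subseteq> (\<Union>j. F ` B j)"
  proof safe
    fix x assume x: "x \<in> A"
    obtain e L where e: "0 < e" "L-lipschitz_on (ball x e) F" using F unfolding locally_lipschitz_def by blast
    obtain j :: nat where j: "L \<le> real j" using real_arch_simple by blast
    have "dist (F x) (F y) \<le> real j * dist x y" if "y \<in> ball x e" for y
    proof -
      have "dist (F x) (F y) \<le> L * dist x y" using e that by (intro lipschitz_onD[OF e(2)]) auto
      also have "\<dots> \<le> real j * dist x y" using j by (rule mult_right_mono) simp
      finally show ?thesis .
    qed
    then show "F x \<in> (\<Union>j. F ` B j)" using x e(1) by (intro UN_I[of j] imageI) (auto simp: B_def)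
  qed
  ultimately have "hausdorff_outer ?n (F ` A) \<le> (\<Sum>j. hausdorff_outer ?n (F ` B j))"
    by (intro order_trans[OF hausdorff_outer_mono hausdorff_outer_UN])
  also have "\<dots> = 0" using \<open>\<And>j. hausdorff_outer ?n (F ` B j) = 0\<close> by simp
  finally show ?thesis by simp
qed

lemma hausdorff_outer_singleton:
  assumes "0 < k"
  shows "hausdorff_outer k {z} = 0"
proof -
  have "hausdorff_pre k \<delta> {z} \<le> 0" if \<delta>: "0 < \<delta>" for \<delta>
  proof -
    have "(\<lambda>_::nat. {z}) \<in> hausdorff_covers \<delta> {z}" using \<delta> by (auto simp: hausdorff_covers_def)
    then have "hausdorff_pre k \<delta> {z} \<le> (\<Sum>i::nat. hausdorff_weight k {z})" by (rule hausdorff_pre_le)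
    also have "\<dots> = 0" using assms by (simp add: hausdorff_weight_def zero_power)
    finally show ?thesis .
  qed
  then show ?thesis unfolding hausdorff_outer_def by (auto intro!: antisym SUP_least)
qed

text \<open>
  The upper density of a set of finite measure is at least \<open>2\<^sup>-\<^sup>k\<close> at almost all of its points. Let \<open>B j\<close> be the
  points where the density is small at all scales below \<open>1 / (j + 1)\<close>. A covering set \<open>C\<close> of small diameter \<open>d\<close>
  that meets \<open>B j\<close> lies in the ball of radius \<open>d\<close> about a point of \<open>B j\<close>, so it captures measure at most
  \<open>c d\<^sup>k\<close>, which is \<open>\<theta> < 1\<close> times its weight. Economical coverings thus give that the measure of \<open>B j\<close> is at most
  \<open>\<theta>\<close> times itself.
\<close>

lemma hausdorff_density:
  fixes A :: "'e::metric_space set"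
  assumes k: "0 < k" and fin: "hausdorff_outer k A < top" and c: "0 \<le> c" "c * 2 ^ k < unit_ball_vol k"
  shows "hausdorff_outer k {z\<in>A. \<exists>\<delta>>0. \<forall>\<rho>. 0 < \<rho> \<longrightarrow> \<rho> < \<delta> \<longrightarrow>
      hausdorff_outer k (A \<inter> cball z \<rho>) \<le> ennreal (c * \<rho> ^ k)} = 0" (is "hausdorff_outer k ?B = 0")
proof -
  define \<theta> where "\<theta> = c * 2 ^ k / unit_ball_vol k"
  have vp: "0 < unit_ball_vol (real k)" by simp
  have \<theta>: "0 \<le> \<theta>" "\<theta> < 1" using c vp by (auto simp: \<theta>_def)
  define B where "B j = {z\<in>A. \<forall>\<rho>. 0 < \<rho> \<longrightarrow> \<rho> < 1 / real (Suc j) \<longrightarrow>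
      hausdorff_outer k (A \<inter> cball z \<rho>) \<le> ennreal (c * \<rho> ^ k)}" for j
  have B0: "hausdorff_outer k (B j) = 0" for j
  proof -
    let ?d = "1 / (2 * real (Suc j))"
    have le: "hausdorff_outer k (B j) \<le> ennreal \<theta> * (\<Sum>i. hausdorff_weight k (C i))"
      if C: "C \<in> hausdorff_covers ?d (B j)" for C
    proof -
      have bd: "bounded (C i)" "diameter (C i) \<le> ?d" for i using C by (auto simp: hausdorff_covers_def)
      have one: "hausdorff_outer k (B j \<inter> C i) \<le> ennreal \<theta> * hausdorff_weight k (C i)" for i
      proof (cases "B j \<inter> C i = {}")
        case False
        then obtain z where z: "z \<in> B j" "z \<in> C i" by blast
        have sub: "C i \<subseteq> cball z (diameter (C i))"
          using diameter_bounded_bound[OF bd(1)[of i] z(2)] by auto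
        show ?thesis
        proof (cases "diameter (C i) = 0")
          case True
          then have "hausdorff_outer k (B j \<inter> C i) \<le> hausdorff_outer k {z}"
            using sub by (intro hausdorff_outer_mono) auto
          then show ?thesis using hausdorff_outer_singleton[OF k, of z] by simp
        next
          case False
          then have pos: "0 < diameter (C i)" using diameter_ge_0[OF bd(1)[of i]] by simp
          have "hausdorff_outer k (B j \<inter> C i) \<le> hausdorff_outer k (A \<inter> cball z (diameter (C i)))"
            using sub by (intro hausdorff_outer_mono) (auto simp: B_def)
          also have "\<dots> \<le> ennreal (c * diameter (C i) ^ k)"
          proof -
            have "?d < 1 / real (Suc j)" by (simp add: field_simps)
            then have "diameter (C i) < 1 / real (Suc j)" using bd(2)[of i] by linarith
            then show ?thesis using z(1) pos unfolding B_def by blast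
          qed
          also have "c * diameter (C i) ^ k = \<theta> * (unit_ball_vol k * (diameter (C i) / 2) ^ k)"
            using vp by (simp add: \<theta>_def power_divide less_imp_neq[THEN not_sym])
          also have "ennreal \<dots> = ennreal \<theta> * hausdorff_weight k (C i)"
            using \<theta> z(2) diameter_ge_0[OF bd(1)[of i]]
            by (auto simp: hausdorff_weight_def intro!: ennreal_mult)
          finally show ?thesis .
        qed
      qed simp
      have "hausdorff_outer k (B j) \<le> hausdorff_outer k (\<Union>i. B j \<inter> C i)"
        using C by (intro hausdorff_outer_mono) (auto simp: hausdorff_covers_def)
      also have "\<dots> \<le> (\<Sum>i. hausdorff_outer k (B j \<inter> C i))" by (rule hausdorff_outer_UN)
      also have "\<dots> \<le> (\<Sum>i. ennreal \<theta> * hausdorff_weight k (C i))" by (intro suminf_le one) auto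
      finally show ?thesis by simp
    qed
    have finB: "hausdorff_outer k (B j) < top"
      using fin hausdorff_outer_mono[of "B j" A k] by (auto simp: B_def intro: le_less_trans)
    have "hausdorff_outer k (B j) \<le> ennreal \<theta> * hausdorff_outer k (B j)"
    proof (rule ennreal_le_epsilon)
      fix e :: real assume e: "0 < e"
      have "hausdorff_pre k ?d (B j) < hausdorff_outer k (B j) + ennreal e"
      proof -
        have "hausdorff_pre k ?d (B j) \<le> hausdorff_outer k (B j)" by (rule hausdorff_pre_le_outer) simp
        also have "\<dots> < hausdorff_outer k (B j) + ennreal e" using finB e by (cases "hausdorff_outer k (B j)") (auto simp: ennreal_plus[symmetric] ennreal_less_iff simp del: ennreal_plus)
        finally show ?thesis .
      qed
      then obtain C where C: "C \<in> hausdorff_covers ?d (B j)" "(\<Sum>i. hausdorff_weight k (C i)) < hausdorff_outer k (B j) + ennreal e"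
        unfolding hausdorff_pre_def INF_less_iff by blast
      have "hausdorff_outer k (B j) \<le> ennreal \<theta> * (\<Sum>i. hausdorff_weight k (C i))" by (rule le[OF C(1)])
      also have "\<dots> \<le> ennreal \<theta> * (hausdorff_outer k (B j) + ennreal e)"
        using C(2) by (intro mult_left_mono) auto
      also have "\<dots> = ennreal \<theta> * hausdorff_outer k (B j) + ennreal \<theta> * ennreal e" by (rule distrib_left)
      also have "ennreal \<theta> * ennreal e \<le> 1 * ennreal e" using \<theta> by (intro mult_right_mono) (auto simp flip: ennreal_1 intro!: ennreal_leI)
      finally show "hausdorff_outer k (B j) \<le> ennreal \<theta> * hausdorff_outer k (B j) + ennreal e"
        by (simp add: add_left_mono)
    qed
    then show ?thesis
    proof (cases "hausdorff_outer k (B j)")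
      case (real r)
      then have "r \<le> \<theta> * r" using \<open>hausdorff_outer k (B j) \<le> _\<close> \<theta> by (simp add: ennreal_mult[symmetric])
      then have "(1 - \<theta>) * r \<le> 0" by (simp add: algebra_simps)
      then have "r \<le> 0" using \<theta> by (simp add: mult_le_0_iff)
      then show ?thesis using real by simp
    qed (use finB in simp)
  qed
  have "?B \<subseteq> (\<Union>j. B j)"
  proof
    fix z assume z: "z \<in> ?B"
    then obtain \<delta> where \<delta>: "0 < \<delta>" "\<And>\<rho>. 0 < \<rho> \<Longrightarrow> \<rho> < \<delta> \<Longrightarrow> hausdorff_outer k (A \<inter> cball z \<rho>) \<le> ennreal (c * \<rho> ^ k)"
      by blast
    obtain j where j: "1 / real (Suc j) < \<delta>" using nat_approx_posE[OF \<delta>(1)] by blast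
    then have "z \<in> B j" using z \<delta>(2) unfolding B_def by auto
    then show "z \<in> (\<Union>j. B j)" by blast
  qed
  then have "hausdorff_outer k ?B \<le> (\<Sum>j. hausdorff_outer k (B j))"
    by (intro order_trans[OF hausdorff_outer_mono hausdorff_outer_UN])
  then show ?thesis using B0 by simp
qed

text \<open>
  The image of a covering set \<open>C\<close> lies in a ball of radius \<open>diameter C\<close>, twice the radius that enters its weight.
\<close>

lemma emeasure_image_le_hausdorff:
  fixes p :: "'b::metric_space \<Rightarrow> 'a::euclidean_space"
  assumes p: "\<And>x y. dist (p x) (p y) \<le> dist x y" and S: "p ` S \<in> sets lebesgue"
  shows "emeasure lebesgue (p ` S) \<le> 2 ^ DIM('a) * hausdorff_outer DIM('a) S"
proof -
  let ?n = "DIM('a)"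
  have "emeasure lebesgue (p ` S) \<le> 2 ^ ?n * (\<Sum>i. hausdorff_weight ?n (C i))" if C: "C \<in> hausdorff_covers 1 S" for C
  proof -
    have bd: "bounded (C i)" for i using C by (auto simp: hausdorff_covers_def)
    define z where "z i = (SOME z. z \<in> C i)" for i
    define D where "D i = (if C i = {} then {} else cball (p (z i)) (diameter (C i)))" for i
    have pC: "p ` C i \<subseteq> D i" for i
    proof (cases "C i = {}")
      case False
      then have zi: "z i \<in> C i" unfolding z_def by (auto intro: someI)
      have "dist (p (z i)) (p x) \<le> diameter (C i)" if "x \<in> C i" for x
        using p[of "z i" x] diameter_bounded_bound[OF bd zi that] by linarith
      then show ?thesis using False by (auto simp: D_def)
    qed simp
    have "S \<subseteq> (\<Union>i. C i)" using C by (simp add: hausdorff_covers_def)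
    then have "p ` S \<subseteq> (\<Union>i. p ` C i)" by blast
    also have "\<dots> \<subseteq> (\<Union>i. D i)" using pC by (intro UN_mono) auto
    finally have "p ` S \<subseteq> (\<Union>i. D i)" .
    then have "emeasure lebesgue (p ` S) \<le> emeasure lebesgue (\<Union>i. D i)"
      by (rule emeasure_mono) (auto simp: D_def)
    also have "\<dots> \<le> (\<Sum>i. emeasure lebesgue (D i))"
      by (rule emeasure_subadditive_countably) (auto simp: D_def)
    also have "\<dots> = (\<Sum>i. 2 ^ ?n * hausdorff_weight ?n (C i))"
    proof (rule suminf_cong)
      fix i
      have d: "0 \<le> diameter (C i)" by (rule diameter_ge_0[OF bd])
      show "emeasure lebesgue (D i) = 2 ^ ?n * hausdorff_weight ?n (C i)"
      proof (cases "C i = {}")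
        case False
        have "emeasure lebesgue (D i) = ennreal (unit_ball_vol ?n * diameter (C i) ^ ?n)"
          using False d by (simp add: D_def emeasure_cball)
        also have "unit_ball_vol ?n * diameter (C i) ^ ?n = 2 ^ ?n * (unit_ball_vol ?n * (diameter (C i) / 2) ^ ?n)"
          by (simp add: power_divide)
        also have "ennreal \<dots> = ennreal (2 ^ ?n) * ennreal (unit_ball_vol ?n * (diameter (C i) / 2) ^ ?n)"
          using d by (intro ennreal_mult) auto
        also have "ennreal (2 ^ ?n) = 2 ^ ?n" by (simp add: ennreal_power[symmetric])
        finally show ?thesis using False by (simp add: hausdorff_weight_def)
      qed (simp add: D_def)
    qed
    finally show ?thesis by simp
  qed
  then have "emeasure lebesgue (p ` S) / 2 ^ ?n \<le> hausdorff_pre ?n 1 S"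
    unfolding hausdorff_pre_def by (intro INF_greatest divide_le_posI_ennreal) (auto simp: zero_less_iff_neq_zero)
  then have "2 ^ ?n * (emeasure lebesgue (p ` S) / 2 ^ ?n) \<le> 2 ^ ?n * hausdorff_pre ?n 1 S"
    by (rule mult_left_mono) simp
  moreover have "2 ^ ?n * (emeasure lebesgue (p ` S) / 2 ^ ?n) = emeasure lebesgue (p ` S)"
  proof -
    have t: "(2::ennreal) ^ ?n = ennreal (2 ^ ?n)" by (simp add: ennreal_power[symmetric])
    show ?thesis unfolding t
      by (cases "emeasure lebesgue (p ` S)") (auto simp: divide_ennreal ennreal_mult[symmetric] ennreal_top_divide ennreal_mult_top)
  qed
  ultimately have "emeasure lebesgue (p ` S) \<le> 2 ^ ?n * hausdorff_pre ?n 1 S" by simp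
  also have "\<dots> \<le> 2 ^ ?n * hausdorff_outer ?n S"
    by (intro mult_left_mono hausdorff_pre_le_outer) auto
  finally show ?thesis .
qed

section \<open>Singular bases\<close>

text \<open>
  A maximum point \<open>v\<close> of \<open>T x \<bullet> x\<close> on the unit sphere of \<open>V\<close> is an eigenvector: for \<open>w = T v - \<mu> v\<close> the maximality
  along \<open>v + t w\<close> gives \<open>2 t |w|\<^sup>2 + O(t\<^sup>2) \<le> 0\<close> for small \<open>t > 0\<close>.
\<close>

lemma self_adjoint_eigenvector:
  fixes T :: "'a::euclidean_space \<Rightarrow> 'a"
  assumes lin: "linear T" and sa: "\<And>x y. T x \<bullet> y = x \<bullet> T y"
    and V: "subspace V" "\<And>x. x \<in> V \<Longrightarrow> T x \<in> V" and ne: "V \<noteq> {0}"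
  obtains v \<mu> where "v \<in> V" "norm v = 1" "T v = \<mu> *\<^sub>R v"
proof -
  let ?S = "V \<inter> sphere 0 1"
  have cT: "continuous_on UNIV T" using lin by (simp add: linear_continuous_on linear_linear)
  have "compact ?S" using V(1) by (auto intro!: closed_Int_compact closed_subspace)
  moreover obtain x where x: "x \<in> V" "x \<noteq> 0" using ne V(1) subspace_0 by blast
  then have "(1 / norm x) *\<^sub>R x \<in> ?S" using V(1) by (auto simp: subspace_scale)
  then have "?S \<noteq> {}" by blast
  moreover have "continuous_on ?S (\<lambda>x. T x \<bullet> x)"
    by (intro continuous_intros continuous_on_subset[OF cT]) auto
  ultimately have "\<exists>v\<in>?S. \<forall>y\<in>?S. T y \<bullet> y \<le> T v \<bullet> v"
    by (rule continuous_attains_sup)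
  then obtain v where v: "v \<in> ?S" and max: "\<And>y. y \<in> ?S \<Longrightarrow> T y \<bullet> y \<le> T v \<bullet> v"
    by blast
  define \<mu> where "\<mu> = T v \<bullet> v"
  have le: "T y \<bullet> y \<le> \<mu> * (y \<bullet> y)" if y: "y \<in> V" for y
  proof (cases "y = 0")
    case True
    then show ?thesis using lin by (simp add: linear_0)
  next
    case False
    have "(1 / norm y) *\<^sub>R y \<in> ?S" using V(1) y False by (auto simp: subspace_scale)
    then have "T ((1 / norm y) *\<^sub>R y) \<bullet> ((1 / norm y) *\<^sub>R y) \<le> \<mu>" unfolding \<mu>_def by (rule max)
    then have "(T y \<bullet> y) / (norm y)\<^sup>2 \<le> \<mu>" using lin by (simp add: linear_scale power2_eq_square)
    then show ?thesis using False by (simp add: divide_le_eq power2_norm_eq_inner)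
  qed
  define w where "w = T v - \<mu> *\<^sub>R v"
  have wV: "w \<in> V" using v V by (auto simp: w_def subspace_diff subspace_scale)
  have vv: "v \<bullet> v = 1" using v by (simp add: norm_eq_1)
  have vw: "v \<bullet> w = 0" by (simp add: w_def inner_diff_right \<mu>_def vv inner_commute)
  have Tvw: "T v \<bullet> w = w \<bullet> w"
  proof -
    have "w \<bullet> w = T v \<bullet> w - \<mu> * (v \<bullet> w)" by (subst (1) w_def) (simp add: inner_diff_left)
    then show ?thesis using vw by simp
  qed
  have "2 * t * (w \<bullet> w) + t\<^sup>2 * (T w \<bullet> w - \<mu> * (w \<bullet> w)) \<le> 0" for t
  proof -
    have "v + t *\<^sub>R w \<in> V" using v wV V(1) by (auto simp: subspace_add subspace_scale)
    from le[OF this] have "T v \<bullet> v + t * (T v \<bullet> w) + t * (T w \<bullet> v) + t * t * (T w \<bullet> w) \<le> \<mu> * (1 + t * t * (w \<bullet> w))"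
      using lin by (simp add: linear_add linear_scale inner_add_left inner_add_right vv vw inner_commute[of w v] algebra_simps)
    moreover have "T w \<bullet> v = w \<bullet> w" using Tvw sa[of w v] by (simp add: inner_commute)
    ultimately show ?thesis using Tvw unfolding \<mu>_def[symmetric] by (simp add: algebra_simps power2_eq_square)
  qed
  note quad = this
  have "w \<bullet> w = 0"
  proof (rule ccontr)
    assume "w \<bullet> w \<noteq> 0"
    then have pos: "0 < w \<bullet> w" by (simp add: less_le)
    define a where "a = \<bar>T w \<bullet> w - \<mu> * (w \<bullet> w)\<bar> + 1"
    have a: "0 < a" by (simp add: a_def)
    define t where "t = (w \<bullet> w) / a"
    have t: "0 < t" using pos a by (simp add: t_def)
    have "t\<^sup>2 * (T w \<bullet> w - \<mu> * (w \<bullet> w)) \<ge> - (t\<^sup>2 * a)"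
    proof -
      have "- a \<le> T w \<bullet> w - \<mu> * (w \<bullet> w)" unfolding a_def by linarith
      from mult_left_mono[OF this, of "t\<^sup>2"] show ?thesis by simp
    qed
    moreover have "t\<^sup>2 * a = t * (w \<bullet> w)" using a by (simp add: t_def power2_eq_square)
    ultimately have "t * (w \<bullet> w) \<le> 0" using quad[of t] by simp
    then show False using t pos by (simp add: mult_le_0_iff)
  qed
  then have "T v = \<mu> *\<^sub>R v" by (simp add: w_def)
  then show ?thesis using v that[of v \<mu>] by auto
qed

text \<open>
  The orthogonal complement of an eigenvector is invariant again, so the spectral theorem follows by induction on
  the dimension.
\<close>

lemma self_adjoint_eigenbasis:
  fixes T :: "'a::euclidean_space \<Rightarrow> 'a"
  assumes lin: "linear T" and sa: "\<And>x y. T x \<bullet> y = x \<bullet> T y"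
    and V: "subspace V" "\<And>x. x \<in> V \<Longrightarrow> T x \<in> V"
  shows "\<exists>B. B \<subseteq> V \<and> finite B \<and> card B = dim V \<and> pairwise orthogonal B \<and>
    (\<forall>b\<in>B. norm b = 1 \<and> (\<exists>\<mu>. T b = \<mu> *\<^sub>R b))"
  using V
proof (induction "dim V" arbitrary: V)
  case 0
  then have "V \<subseteq> {0}" by (metis dim_eq_0)
  then show ?case using 0 by (intro exI[of _ "{}"]) auto
next
  case (Suc d)
  then have "V \<noteq> {0}" by auto
  then obtain v \<mu> where v: "v \<in> V" "norm v = 1" "T v = \<mu> *\<^sub>R v"
    using self_adjoint_eigenvector[OF lin sa Suc.prems(1)] Suc.prems(2) by metis
  define W where "W = {x\<in>V. v \<bullet> x = 0}"
  have W: "subspace W" using Suc.prems(1) by (auto simp: W_def subspace_def inner_add_right)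
  have TW: "T x \<in> W" if "x \<in> W" for x
    using that Suc.prems(2) sa[of v x] v(3) by (auto simp: W_def)
  have vW: "v \<notin> W" using v(2) by (auto simp: W_def norm_eq_1)
  have WV: "W \<subseteq> V" by (auto simp: W_def)
  have span: "V \<subseteq> span (insert v W)"
  proof
    fix x assume x: "x \<in> V"
    have "x - (v \<bullet> x) *\<^sub>R v \<in> W" using x v Suc.prems(1)
      by (auto simp: W_def subspace_diff subspace_scale inner_diff_right norm_eq_1)
    then have "(x - (v \<bullet> x) *\<^sub>R v) + (v \<bullet> x) *\<^sub>R v \<in> span (insert v W)"
      by (intro span_add span_scale) (auto intro: span_base)
    then show "x \<in> span (insert v W)" by simp
  qed
  have "dim V = dim (insert v W)"
  proof (rule antisym)
    show "dim V \<le> dim (insert v W)" using span by (metis dim_span dim_subset)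
    show "dim (insert v W) \<le> dim V" using v WV by (intro dim_subset) auto
  qed
  also have "\<dots> = Suc (dim W)"
    using vW W by (subst dim_insert) (simp add: span_eq_iff[THEN iffD2])
  finally have dW: "d = dim W" using Suc.hyps(2) by simp
  obtain B where B: "B \<subseteq> W" "finite B" "card B = dim W" "pairwise orthogonal B"
    "\<forall>b\<in>B. norm b = 1 \<and> (\<exists>\<mu>. T b = \<mu> *\<^sub>R b)"
    using Suc.hyps(1)[OF dW W TW] by blast
  have vB: "v \<notin> B" using vW B(1) by blast
  show ?case
  proof (intro exI[of _ "insert v B"] conjI)
    show "insert v B \<subseteq> V" using v B WV by auto
    show "finite (insert v B)" using B by simp
    show "card (insert v B) = dim V" using B vB dW Suc.hyps(2) by simp
    show "pairwise orthogonal (insert v B)"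
      using B(1,4) by (auto simp: pairwise_insert orthogonal_def W_def inner_commute)
    show "\<forall>b\<in>insert v B. norm b = 1 \<and> (\<exists>\<mu>. T b = \<mu> *\<^sub>R b)" using v B(5) by blast
  qed
qed

lemma gram_inner:
  fixes L :: "real ^ 'n \<Rightarrow> 'b::real_inner"
  assumes "linear L"
  shows "(gram_matrix L *v x) \<bullet> y = L x \<bullet> L y"
proof -
  have Lx: "L z = (\<Sum>i\<in>UNIV. z $ i *\<^sub>R L (axis i 1))" for z
  proof -
    have "L z = L (\<Sum>i\<in>UNIV. z $ i *\<^sub>R axis i 1)"
      by (rule arg_cong[of _ _ L]) (simp add: vec_eq_iff axis_def if_distrib cong: if_cong)
    then show ?thesis by (simp add: linear_sum[OF assms] linear_scale[OF assms])
  qed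
  have "L x \<bullet> L y = (\<Sum>j\<in>UNIV. \<Sum>i\<in>UNIV. y $ j * (x $ i * (L (axis j 1) \<bullet> L (axis i 1))))"
    by (subst Lx[of x], subst Lx[of y])
      (simp add: inner_sum_left inner_sum_right sum_distrib_left inner_commute mult_ac)
  also have "\<dots> = (gram_matrix L *v x) \<bullet> y"
    by (simp add: inner_vec_def matrix_vector_mult_def gram_matrix_def sum_distrib_right sum_distrib_left mult_ac)
  finally show ?thesis by simp
qed

lemma det_conj_diag:
  fixes P :: "real ^ 'n ^ 'n"
  assumes "orthogonal_matrix P"
  shows "det (P ** D ** transpose P) = det D"
proof -
  have "det P * det P = 1" using det_orthogonal_matrix[OF assms] by auto
  then show ?thesis by (simp add: det_mul det_transpose mult_ac)
qed

text \<open>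
  An orthonormal eigenbasis of the Gram matrix. It also diagonalises the characteristic polynomial, so that the
  roots \<open>l\<close> of the eigenvalues are singular values in the sense of the definition.
\<close>

lemma singular_basis_exists:
  fixes L :: "real ^ 'n \<Rightarrow> 'b::real_inner"
  assumes L: "linear L"
  shows "\<exists>(f :: 'n \<Rightarrow> real ^ 'n) l. (\<forall>i j. f i \<bullet> f j = (if i = j then 1 else 0)) \<and>
    (\<forall>i j. L (f i) \<bullet> L (f j) = (if i = j then (l i)\<^sup>2 else 0)) \<and> singular_values L l"
proof -
  let ?G = "gram_matrix L"
  have "(?G *v x) \<bullet> y = x \<bullet> (?G *v y)" for x y
    by (metis gram_inner[OF L] inner_commute)
  then obtain B where B: "finite B" "card B = dim (UNIV :: (real^'n) set)" "pairwise orthogonal B"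
    "\<forall>b\<in>B. norm b = 1 \<and> (\<exists>\<mu>. ?G *v b = \<mu> *\<^sub>R b)"
    using self_adjoint_eigenbasis[of "(*v) ?G" UNIV] by auto
  have "card B = CARD('n)" using B(2) by simp
  then obtain f where f: "bij_betw f (UNIV :: 'n set) B"
    using B(1) finite_same_card_bij[of "UNIV :: 'n set" B] by auto
  have fB: "f i \<in> B" for i using f by (auto simp: bij_betw_def)
  have on: "f i \<bullet> f j = (if i = j then 1 else 0)" for i j
  proof (cases "i = j")
    case True
    then show ?thesis using B(4) fB[of i] by (simp add: norm_eq_1)
  next
    case False
    then have "f i \<noteq> f j" using f by (auto simp: bij_betw_def inj_def)
    then show ?thesis using B(3) fB[of i] fB[of j] False by (auto simp: pairwise_def orthogonal_def)
  qed
  have "\<exists>\<mu>. \<forall>i. ?G *v f i = \<mu> i *\<^sub>R f i" using B(4) fB by (intro choice) blast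
  then obtain \<mu> where \<mu>: "\<And>i. ?G *v f i = \<mu> i *\<^sub>R f i" by blast
  have LL: "L (f i) \<bullet> L (f j) = (if i = j then \<mu> i else 0)" for i j
    by (simp add: gram_inner[OF L, symmetric] \<mu> on)
  have \<mu>0: "0 \<le> \<mu> i" for i using LL[of i i] inner_ge_zero[of "L (f i)"] by simp
  define l where "l i = sqrt (\<mu> i)" for i
  have l2: "(l i)\<^sup>2 = \<mu> i" for i using \<mu>0 by (simp add: l_def)
  define P :: "real^'n^'n" where "P = (\<chi> i j. f j $ i)"
  have col: "column i P = f i" for i by (simp add: P_def column_def vec_eq_iff)
  have P: "orthogonal_matrix P"
    unfolding orthogonal_matrix_orthonormal_columns by (simp add: col on norm_eq_1 orthogonal_def)
  have "det (mat t - ?G) = (\<Prod>i\<in>UNIV. t - (l i)\<^sup>2)" for t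
  proof -
    define D :: "real^'n^'n" where "D = (\<chi> i j. if i = j then t - \<mu> i else 0)"
    have "(mat t - ?G) ** P = P ** D"
    proof -
      have "((mat t - ?G) ** P) $ a $ b = (P ** D) $ a $ b" for a b
      proof -
        have "((mat t - ?G) ** P) $ a $ b = ((mat t - ?G) *v f b) $ a"
          by (simp add: matrix_matrix_mult_def matrix_vector_mult_def P_def)
        also have "(mat t - ?G) *v f b = t *\<^sub>R f b - \<mu> b *\<^sub>R f b"
          by (simp add: matrix_vector_mult_diff_rdistrib \<mu>) (simp add: vec_eq_iff matrix_vector_mult_def mat_def if_distrib[of "\<lambda>c. c * _"] cong: if_cong)
        also have "\<dots> $ a = (P ** D) $ a $ b"
          by (simp add: matrix_matrix_mult_def P_def D_def if_distrib[of "\<lambda>c. _ * c"] algebra_simps cong: if_cong)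
        finally show ?thesis .
      qed
      then show ?thesis by (simp add: vec_eq_iff)
    qed
    then have "mat t - ?G = P ** D ** transpose P"
      using P unfolding orthogonal_matrix_def by (metis matrix_mul_assoc matrix_mul_rid)
    then have "det (mat t - ?G) = det D" using det_conj_diag[OF P] by simp
    also have "\<dots> = (\<Prod>i\<in>UNIV. t - \<mu> i)" by (subst det_diagonal) (auto simp: D_def)
    finally show ?thesis by (simp add: l2)
  qed
  then have "singular_values L l" using \<mu>0 by (simp add: singular_values_def l_def)
  then show ?thesis using on LL l2 by (intro exI[of _ f] exI[of _ l]) auto
qed

text \<open>
  \<open>(l i)\<^sup>2\<close> is an eigenvalue of the Gram matrix, and \<open>L\<close> stretches an eigenvector by \<open>l i\<close>. This bounds the set whose
  supremum is the 2-dilation.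
\<close>

lemma singular_values_le_norm:
  fixes L :: "real ^ 'n \<Rightarrow> 'b::real_inner"
  assumes L: "linear L" and K: "\<And>x. norm (L x) \<le> K * norm x" and l: "singular_values L l"
  shows "l i \<le> K"
proof -
  have "det (mat ((l i)\<^sup>2) - gram_matrix L) = 0"
    using l unfolding singular_values_def by auto
  then obtain x where x: "x \<noteq> 0" "(mat ((l i)\<^sup>2) - gram_matrix L) *v x = 0"
    using invertible_det_nz invertible_left_inverse matrix_left_invertible_ker by metis
  have "mat ((l i)\<^sup>2) *v x = (l i)\<^sup>2 *\<^sub>R x"
    by (simp add: vec_eq_iff matrix_vector_mult_def mat_def if_distrib[of "\<lambda>c. c * _"] cong: if_cong)
  then have "gram_matrix L *v x = (l i)\<^sup>2 *\<^sub>R x" using x(2) by (simp add: matrix_vector_mult_diff_rdistrib)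
  then have "(l i)\<^sup>2 * (x \<bullet> x) = L x \<bullet> L x" using gram_inner[OF L, of x x] by simp
  then have "(l i * norm x)\<^sup>2 = (norm (L x))\<^sup>2" by (simp add: power_mult_distrib power2_norm_eq_inner)
  moreover have "0 \<le> l i" using l by (simp add: singular_values_def)
  ultimately have "l i * norm x = norm (L x)" by (simp add: power2_eq_iff_nonneg)
  then have "l i * norm x \<le> K * norm x" using K[of x] by simp
  then show ?thesis using x(1) by simp
qed

lemma singular_values_product_le_two_dilation:
  fixes L :: "real ^ 'n \<Rightarrow> 'b::real_inner"
  assumes L: "bounded_linear L" and l: "singular_values L l" and ij: "i \<noteq> j"
  shows "l i * l j \<le> two_dilation L"
proof -
  obtain K where K: "0 \<le> K" "\<And>x. norm (L x) \<le> K * norm x"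
    using bounded_linear.nonneg_bounded[OF L] by (auto simp: mult.commute)
  have lin: "linear L" using L by (simp add: bounded_linear.linear)
  have "a \<le> K * K" if "a \<in> insert 0 {l i * l j | l i j. singular_values L l \<and> i \<noteq> j}" for a
    using that singular_values_le_norm[OF lin K(2)] K(1)
    by (auto simp: singular_values_def intro!: mult_mono)
  then show ?thesis
    unfolding two_dilation_def using l ij by (intro cSup_upper) (auto simp: bdd_above_def intro!: exI[of _ "K * K"])
qed

section \<open>The divergence along the tangent plane\<close>

text \<open>
  The trace is the same in all orthonormal bases: expand the vectors of each basis in the other one.
\<close>

lemma tangential_div_eq:
  assumes D: "linear D" and B: "orthonormal_basis B S"
  shows "tangential_div D S = (\<Sum>b\<in>B. D b \<bullet> b)"
proof -
  define B' where "B' = (SOME B. orthonormal_basis B S)"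
  have B': "orthonormal_basis B' S" unfolding B'_def using B by (rule someI)
  have ex: "x = (\<Sum>b\<in>A. (x \<bullet> b) *\<^sub>R b)" if "orthonormal_basis A S" "x \<in> S" for A x
    using that orthonormal_basis_expand[of A x] by (simp add: orthonormal_basis_def)
  have inS: "x \<in> S" if "x \<in> A" "orthonormal_basis A S" for A x
    using that span_base[of x A] by (auto simp: orthonormal_basis_def)
  have 1: "D b \<bullet> b = (\<Sum>b'\<in>B'. (b \<bullet> b') * (D b \<bullet> b'))" if "b \<in> B" for b
  proof -
    have "D b \<bullet> b = D b \<bullet> (\<Sum>b'\<in>B'. (b \<bullet> b') *\<^sub>R b')"
      using ex[OF B' inS[OF that B]] by simp
    then show ?thesis by (simp add: inner_sum_right)
  qed
  have 2: "D b' \<bullet> b' = (\<Sum>b\<in>B. (b' \<bullet> b) * (D b \<bullet> b'))" if "b' \<in> B'" for b'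
  proof -
    have "D b' \<bullet> b' = D (\<Sum>b\<in>B. (b' \<bullet> b) *\<^sub>R b) \<bullet> b'"
      using ex[OF B inS[OF that B']] by simp
    then show ?thesis by (simp add: inner_sum_left linear_sum[OF D] linear_scale[OF D])
  qed
  have "tangential_div D S = (\<Sum>b'\<in>B'. D b' \<bullet> b')" by (simp add: tangential_div_def B'_def)
  also have "\<dots> = (\<Sum>b'\<in>B'. \<Sum>b\<in>B. (b' \<bullet> b) * (D b \<bullet> b'))" by (intro sum.cong refl 2)
  also have "\<dots> = (\<Sum>b\<in>B. \<Sum>b'\<in>B'. (b \<bullet> b') * (D b \<bullet> b'))"
    by (subst sum.swap) (simp add: inner_commute)
  also have "\<dots> = (\<Sum>b\<in>B. D b \<bullet> b)" by (intro sum.cong refl 1[symmetric])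
  finally show ?thesis .
qed

lemma bessel:
  fixes e :: "'n::finite \<Rightarrow> 'e::real_inner"
  assumes e: "\<And>i j. e i \<bullet> e j = (if i = j then 1 else 0)"
  shows "(\<Sum>i\<in>UNIV. (x \<bullet> e i)\<^sup>2) \<le> x \<bullet> x"
proof -
  let ?p = "\<Sum>i\<in>UNIV. (x \<bullet> e i) *\<^sub>R e i"
  have xp: "x \<bullet> ?p = (\<Sum>i\<in>UNIV. (x \<bullet> e i)\<^sup>2)" by (simp add: inner_sum_right power2_eq_square)
  have pp: "?p \<bullet> ?p = (\<Sum>i\<in>UNIV. (x \<bullet> e i)\<^sup>2)"
    by (simp add: inner_sum_left inner_sum_right e power2_eq_square if_distrib[of "\<lambda>c. _ * c"] cong: if_cong)
  have "0 \<le> (x - ?p) \<bullet> (x - ?p)" by (rule inner_ge_zero)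
  also have "\<dots> = x \<bullet> x - 2 * (x \<bullet> ?p) + ?p \<bullet> ?p"
    by (simp add: inner_diff_left inner_diff_right inner_commute)
  finally show ?thesis unfolding xp pp by simp
qed

lemma orthonormal_family_expansion:
  fixes f :: "'n \<Rightarrow> real ^ 'n"
  assumes f: "\<And>i j. f i \<bullet> f j = (if i = j then 1 else 0)"
  shows "(\<Sum>k\<in>UNIV. (x \<bullet> f k) *\<^sub>R f k) = x"
proof -
  define P :: "real^'n^'n" where "P = (\<chi> i j. f j $ i)"
  have col: "column i P = f i" for i by (simp add: P_def column_def vec_eq_iff)
  have "orthogonal_matrix P"
    unfolding orthogonal_matrix_orthonormal_columns by (simp add: col f norm_eq_1 orthogonal_def)
  then have PP: "P ** transpose P = mat 1" by (simp add: orthogonal_matrix_def)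
  have "x = P *v (transpose P *v x)" by (simp only: matrix_vector_mul_assoc PP matrix_vector_mul_lid)
  also have "\<dots> = (\<Sum>k\<in>UNIV. (x \<bullet> f k) *\<^sub>R f k)"
    by (simp add: vec_eq_iff matrix_vector_mult_def transpose_def P_def inner_vec_def mult_ac)
  finally show ?thesis by simp
qed

definition graph_plane :: "('a::real_vector \<Rightarrow> 'b::real_vector) \<Rightarrow> ('a \<times> 'b) set" where
  "graph_plane L = range (\<lambda>v. (v, L v))"

text \<open>
  For a singular basis \<open>f\<close> the vectors \<open>(f i, L (f i))\<close> are orthogonal, of length \<open>sqrt (1 + (l i)\<^sup>2)\<close>.
\<close>

lemma graph_plane_singular_basis:
  fixes L :: "real ^ 'n \<Rightarrow> 'b::real_inner" and f :: "'n \<Rightarrow> real ^ 'n"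
  assumes L: "linear L" and f: "\<And>i j. f i \<bullet> f j = (if i = j then 1 else 0)"
    and Lf: "\<And>i j. L (f i) \<bullet> L (f j) = (if i = j then (l i)\<^sup>2 else 0)"
  defines "e \<equiv> \<lambda>i. (1 / sqrt (1 + (l i)\<^sup>2)) *\<^sub>R (f i, L (f i))"
  shows "e i \<bullet> e j = (if i = j then 1 else 0)" "orthonormal_basis (range e) (graph_plane L)"
proof -
  have p: "0 < 1 + (l i)\<^sup>2" for i by (simp add: add_pos_nonneg)
  show on: "e i \<bullet> e j = (if i = j then 1 else 0)" for i j
    using p[of i] by (simp add: e_def inner_Pair f Lf real_sqrt_mult[symmetric] power2_eq_square[symmetric] add_divide_distrib[symmetric] less_imp_neq[OF p, THEN not_sym])
  have lin: "linear (\<lambda>v. (v, L v))" using L by (auto intro!: linearI simp: linear_add linear_scale)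
  have "graph_plane L \<subseteq> span (range e)"
  proof
    fix z assume "z \<in> graph_plane L"
    then obtain v where z: "z = (v, L v)" by (auto simp: graph_plane_def)
    have "z = (\<lambda>v. (v, L v)) (\<Sum>k\<in>UNIV. (v \<bullet> f k) *\<^sub>R f k)"
      using orthonormal_family_expansion[OF f, of v] z by simp
    also have "\<dots> = (\<Sum>k\<in>UNIV. (v \<bullet> f k) *\<^sub>R (f k, L (f k)))"
      unfolding linear_sum[OF lin] by (simp add: linear_scale[OF L])
    also have "\<dots> = (\<Sum>k\<in>UNIV. ((v \<bullet> f k) * sqrt (1 + (l k)\<^sup>2)) *\<^sub>R e k)"
      using p by (intro sum.cong refl) (simp add: e_def less_imp_neq[OF p, THEN not_sym])
    also have "\<dots> \<in> span (range e)" by (intro span_sum span_scale span_base) auto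
    finally show "z \<in> span (range e)" .
  qed
  moreover have "span (range e) \<subseteq> graph_plane L"
  proof (rule span_minimal)
    show "range e \<subseteq> graph_plane L"
      by (auto simp: e_def graph_plane_def linear_scale[OF L] intro!: image_eqI)
    show "subspace (graph_plane L)"
      unfolding graph_plane_def using linear_subspace_image[OF lin subspace_UNIV] .
  qed
  ultimately show "orthonormal_basis (range e) (graph_plane L)"
    using on unfolding orthonormal_basis_def
    by (auto simp: pairwise_def orthogonal_def norm_eq_1 split: if_splits intro!: finite_imageI)
qed

lemma tangential_div_family:
  fixes e :: "'n::finite \<Rightarrow> 'e::real_inner"
  assumes D: "linear D" and e: "\<And>i j. e i \<bullet> e j = (if i = j then 1 else 0)" "orthonormal_basis (range e) S"
  shows "tangential_div D S = (\<Sum>i\<in>UNIV. D (e i) \<bullet> e i)"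
proof -
  have "inj e" using e(1) by (metis injI zero_neq_one)
  then show ?thesis unfolding tangential_div_eq[OF D e(2)] by (simp add: sum.reindex)
qed

lemma tangential_div_singular:
  fixes L :: "real ^ 'n \<Rightarrow> 'b::real_inner" and f :: "'n \<Rightarrow> real ^ 'n"
  assumes L: "linear L" and D: "linear D" and f: "\<And>i j. f i \<bullet> f j = (if i = j then 1 else 0)"
    and Lf: "\<And>i j. L (f i) \<bullet> L (f j) = (if i = j then (l i)\<^sup>2 else 0)"
  shows "tangential_div D (graph_plane L) = (\<Sum>i\<in>UNIV. (D (f i, L (f i)) \<bullet> (f i, L (f i))) / (1 + (l i)\<^sup>2))"
proof -
  have p: "0 < 1 + (l i)\<^sup>2" for i by (simp add: add_pos_nonneg)
  show ?thesis
    unfolding tangential_div_family[OF D graph_plane_singular_basis[OF L f Lf]]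
  proof (intro sum.cong refl)
    fix i
    have "(1 / sqrt (1 + (l i)\<^sup>2)) * (1 / sqrt (1 + (l i)\<^sup>2)) = 1 / (1 + (l i)\<^sup>2)"
      using p[of i] by (simp only: times_divide_times_eq mult_1 real_sqrt_mult_self abs_of_pos)
    then have c: "(1 / sqrt (1 + (l i)\<^sup>2)) * ((1 / sqrt (1 + (l i)\<^sup>2)) * x) = x / (1 + (l i)\<^sup>2)" for x
      by (metis mult.assoc mult_1 times_divide_eq_left)
    show "D ((1 / sqrt (1 + (l i)\<^sup>2)) *\<^sub>R (f i, L (f i))) \<bullet> ((1 / sqrt (1 + (l i)\<^sup>2)) *\<^sub>R (f i, L (f i)))
        = (D (f i, L (f i)) \<bullet> (f i, L (f i))) / (1 + (l i)\<^sup>2)"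
      by (simp only: linear_scale[OF D] inner_scaleR_left inner_scaleR_right c)
  qed
qed

text \<open>
  The entries of the inverse of the induced metric \<open>1 + L\<^sup>T L\<close>, written out by Cramer's rule. As quotients of
  determinants they are visibly measurable functions of the entries of \<open>L\<close>.
\<close>

definition inverse_metric :: "(real ^ 'n \<Rightarrow> 'b::real_inner) \<Rightarrow> 'n \<Rightarrow> 'n \<Rightarrow> real" where
  "inverse_metric L a b =
     det (\<chi> i j. if j = a then axis b 1 $ i else (mat 1 + gram_matrix L) $ i $ j) / det (mat 1 + gram_matrix L)"

text \<open>
  The divergence in the basis of coordinate tangent vectors. In contrast to an orthonormal basis, this basis
  depends measurably on the base point.
\<close>

lemma tangential_div_inverse_metric:
  fixes L :: "real ^ 'n \<Rightarrow> 'b::real_inner"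
  assumes L: "linear L" and D: "linear D"
  shows "tangential_div D (graph_plane L) = (\<Sum>a\<in>UNIV. \<Sum>b\<in>UNIV. inverse_metric L a b *
     (D (axis a 1, L (axis a 1)) \<bullet> (axis b 1, L (axis b 1))))"
proof -
  obtain f :: "'n \<Rightarrow> real ^ 'n" and l where f: "\<And>i j. f i \<bullet> f j = (if i = j then 1 else 0)"
    and Lf: "\<And>i j. L (f i) \<bullet> L (f j) = (if i = j then (l i)\<^sup>2 else 0)"
    using singular_basis_exists[OF L] by auto
  let ?M = "mat 1 + gram_matrix L"
  have p: "0 < 1 + (l i)\<^sup>2" for i by (simp add: add_pos_nonneg)
  have Mx: "(?M *v x) \<bullet> y = x \<bullet> y + L x \<bullet> L y" for x y
    by (simp add: matrix_vector_mult_add_rdistrib inner_add_left gram_inner[OF L])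
  have "\<exists>B. B ** ?M = mat 1"
    unfolding matrix_left_invertible_ker
  proof (intro allI impI)
    fix x assume "?M *v x = 0"
    then have "x \<bullet> x + L x \<bullet> L x = 0" using Mx[of x x] by simp
    then show "x = 0" by (simp add: add_nonneg_eq_0_iff)
  qed
  then have dM: "det ?M \<noteq> 0" using invertible_left_inverse invertible_det_nz by blast
  have Mf: "?M *v f k = (1 + (l k)\<^sup>2) *\<^sub>R f k" for k
  proof -
    have "?M *v f k = (\<Sum>j\<in>UNIV. ((?M *v f k) \<bullet> f j) *\<^sub>R f j)" using orthonormal_family_expansion[OF f] by simp
    also have "\<dots> = (\<Sum>j\<in>UNIV. if k = j then (1 + (l k)\<^sup>2) *\<^sub>R f k else 0)"
      unfolding Mx by (intro sum.cong refl) (simp add: f Lf)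
    finally show ?thesis by simp
  qed
  define N where "N a b = (\<Sum>k\<in>UNIV. f k $ a * f k $ b / (1 + (l k)\<^sup>2))" for a b
  have N: "inverse_metric L a b = N a b" for a b
  proof -
    let ?x = "\<Sum>k\<in>UNIV. (f k $ b / (1 + (l k)\<^sup>2)) *\<^sub>R f k"
    have "?M *v ?x = (\<Sum>k\<in>UNIV. (f k $ b / (1 + (l k)\<^sup>2)) *\<^sub>R (?M *v f k))"
      by (simp add: linear_sum[OF matrix_vector_mul_linear] linear_scale[OF matrix_vector_mul_linear])
    also have "\<dots> = (\<Sum>k\<in>UNIV. (axis b 1 \<bullet> f k) *\<^sub>R f k)"
      unfolding Mf using p by (intro sum.cong refl) (simp add: less_imp_neq[OF p, THEN not_sym] inner_axis')
    also have "\<dots> = axis b 1" by (rule orthonormal_family_expansion[OF f])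
    finally have "?x = (\<chi> k. det (\<chi> i j. if j = k then axis b 1 $ i else ?M $ i $ j) / det ?M)"
      unfolding cramer[OF dM] .
    then have "?x $ a = inverse_metric L a b" by (simp add: inverse_metric_def)
    then show ?thesis by (simp add: N_def mult_ac)
  qed
  have lin: "linear (\<lambda>v. (v, L v))" using L by (auto intro!: linearI simp: linear_add linear_scale)
  have ax: "(\<Sum>a\<in>UNIV. v $ a *\<^sub>R (axis a 1, L (axis a 1))) = (v, L v)" for v
  proof -
    have "(v, L v) = (\<lambda>v. (v, L v)) (\<Sum>i\<in>UNIV. v $ i *\<^sub>R axis i 1)"
      by (simp add: basis_expansion[of v, unfolded scalar_mult_eq_scaleR])
    also have "\<dots> = (\<Sum>a\<in>UNIV. v $ a *\<^sub>R (axis a 1, L (axis a 1)))"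
      unfolding linear_sum[OF lin] by (simp add: linear_scale[OF L])
    finally show ?thesis by simp
  qed
  have "D (f k, L (f k)) \<bullet> (f k, L (f k)) = (\<Sum>a\<in>UNIV. \<Sum>b\<in>UNIV. f k $ a * (f k $ b *
      (D (axis a 1, L (axis a 1)) \<bullet> (axis b 1, L (axis b 1)))))" for k
    unfolding ax[of "f k", symmetric] linear_sum[OF D] linear_scale[OF D]
    by (simp only: inner_sum_left inner_sum_right inner_scaleR_left inner_scaleR_right sum_distrib_left, subst sum.swap)
      (simp add: mult_ac)
  then have "tangential_div D (graph_plane L) = (\<Sum>k\<in>UNIV. \<Sum>a\<in>UNIV. \<Sum>b\<in>UNIV. (f k $ a * f k $ b / (1 + (l k)\<^sup>2)) *
      (D (axis a 1, L (axis a 1)) \<bullet> (axis b 1, L (axis b 1))))"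
    unfolding tangential_div_singular[OF L D f Lf] by (simp add: sum_divide_distrib mult_ac)
  also have "\<dots> = (\<Sum>a\<in>UNIV. \<Sum>k\<in>UNIV. \<Sum>b\<in>UNIV. (f k $ a * f k $ b / (1 + (l k)\<^sup>2)) *
      (D (axis a 1, L (axis a 1)) \<bullet> (axis b 1, L (axis b 1))))"
    by (rule sum.swap)
  also have "\<dots> = (\<Sum>a\<in>UNIV. \<Sum>b\<in>UNIV. \<Sum>k\<in>UNIV. (f k $ a * f k $ b / (1 + (l k)\<^sup>2)) *
      (D (axis a 1, L (axis a 1)) \<bullet> (axis b 1, L (axis b 1))))"
    by (intro sum.cong refl sum.swap)
  also have "\<dots> = (\<Sum>a\<in>UNIV. \<Sum>b\<in>UNIV. inverse_metric L a b *
     (D (axis a 1, L (axis a 1)) \<bullet> (axis b 1, L (axis b 1))))"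
    unfolding N N_def by (simp add: sum_distrib_right)
  finally show ?thesis .
qed

section \<open>Coordinates of the target space\<close>

lift_definition unit_seq :: "nat \<Rightarrow> fin_seq" is "\<lambda>a i. if i = a then 1 else 0"
  by (rule finite_subset[of _ "{_}"]) auto

lemma inner_unit_seq: "y \<bullet> unit_seq a = coord y a"
proof -
  have "unit_seq a \<bullet> y = (\<Sum>i\<in>{a}. coord (unit_seq a) i * coord y i)"
    by (rule inner_fin_seq_superset) (auto simp: unit_seq.rep_eq)
  then show ?thesis by (simp add: unit_seq.rep_eq inner_commute)
qed

lemma coord_sum: "coord (\<Sum>i\<in>A. f i) a = (\<Sum>i\<in>A. coord (f i) a)"
  by (simp add: inner_unit_seq[symmetric] inner_sum_left)

lemma bounded_linear_coord: "bounded_linear (\<lambda>y. coord y a)"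
  using bounded_linear_inner_left[of "unit_seq a"] by (simp add: inner_unit_seq)

lemma coord_space_expansion:
  assumes "y \<in> coord_space m"
  shows "y = (\<Sum>a<m. coord y a *\<^sub>R unit_seq a)"
proof (rule fin_seq_eqI)
  fix i
  show "coord y i = coord (\<Sum>a<m. coord y a *\<^sub>R unit_seq a) i"
    using assms by (auto simp: coord_sum scaleR_fin_seq.rep_eq unit_seq.rep_eq coord_space_def
        if_distrib[of "\<lambda>c. _ * c"] cong: if_cong)
qed

lemma subspace_coord_space: "subspace (coord_space m)"
  by (auto simp: subspace_def coord_space_def plus_fin_seq.rep_eq scaleR_fin_seq.rep_eq zero_fin_seq.rep_eq)

lemma closed_coord_space: "closed (coord_space m)"
proof -
  have "coord_space m = (\<Inter>i\<in>{m..}. {y. coord y i = 0})" by (auto simp: coord_space_def)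
  moreover have "closed {y. coord y i = 0}" for i
    using bounded_linear.continuous_on[OF bounded_linear_coord continuous_on_id]
    by (intro closed_Collect_eq continuous_on_const) auto
  ultimately show ?thesis by auto
qed

text \<open>
  Bounded closed sets are compact by induction on the number of coordinates.
\<close>

lemma compact_coord_space_cball: "compact (coord_space m \<inter> cball 0 R)"
proof (induction m)
  case 0
  have "coord_space 0 = {0}" by (auto simp: coord_space_def zero_fin_seq.rep_eq intro!: fin_seq_eqI)
  then have "coord_space 0 \<inter> cball 0 R \<subseteq> {0}" by auto
  then show ?case using finite_subset by (intro finite_imp_compact) auto
next
  case (Suc m)
  let ?K = "(\<lambda>(y, t). y + t *\<^sub>R unit_seq m) ` ((coord_space m \<inter> cball 0 R) \<times> {-R..R})"
  have "compact ?K"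
    by (intro compact_continuous_image compact_Times Suc.IH) (auto intro!: continuous_intros simp: split_def)
  moreover have "coord_space (Suc m) \<inter> cball 0 R \<subseteq> ?K"
  proof
    fix y assume y: "y \<in> coord_space (Suc m) \<inter> cball 0 R"
    define x where "x = y - coord y m *\<^sub>R unit_seq m"
    have x: "x \<in> coord_space m" using y
      by (auto simp: x_def coord_space_def minus_fin_seq.rep_eq scaleR_fin_seq.rep_eq unit_seq.rep_eq)
    define t where "t = coord y m"
    have yx: "y = x + t *\<^sub>R unit_seq m" by (simp add: x_def t_def)
    have xu: "x \<bullet> unit_seq m = 0" using x by (simp add: inner_unit_seq coord_space_def)
    have uu: "unit_seq m \<bullet> unit_seq m = 1" by (simp add: inner_unit_seq unit_seq.rep_eq)
    have "y \<bullet> y = x \<bullet> x + t\<^sup>2"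
      unfolding yx by (simp add: inner_add_left inner_add_right inner_commute[of "unit_seq m" x] power2_eq_square xu uu)
    then have sq: "(norm y)\<^sup>2 = (norm x)\<^sup>2 + t\<^sup>2" by (simp only: power2_norm_eq_inner)
    have "(norm x)\<^sup>2 \<le> (norm y)\<^sup>2" unfolding sq by simp
    then have "norm x \<le> norm y" by (rule power2_le_imp_le) simp
    moreover have "\<bar>t\<bar>\<^sup>2 \<le> (norm y)\<^sup>2" unfolding sq by simp
    then have "\<bar>t\<bar> \<le> norm y" by (rule power2_le_imp_le) simp
    ultimately have "norm x \<le> norm y" "\<bar>t\<bar> \<le> norm y" by simp_all
    moreover have "norm y \<le> R" using y by simp
    ultimately have "(x, t) \<in> (coord_space m \<inter> cball 0 R) \<times> {-R..R}"
      using x by (simp only: mem_Times_iff fst_conv snd_conv Int_iff mem_cball_0 atLeastAtMost_iff simp_thms) linarith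
    then show "y \<in> ?K" by (rule image_eqI[rotated]) (simp only: yx split)
  qed
  moreover have "closed (coord_space (Suc m) \<inter> cball 0 R)" by (intro closed_Int closed_coord_space closed_cball)
  ultimately show ?case by (metis compact_Int_closed inf.absorb_iff2)
qed

lemma differentiable_coordinatewise:
  fixes u :: "'a::real_normed_vector \<Rightarrow> fin_seq"
  assumes u: "range u \<subseteq> coord_space m"
  shows "u differentiable at x \<longleftrightarrow> (\<forall>a<m. (\<lambda>x. coord (u x) a) differentiable at x)"
proof
  assume "u differentiable at x"
  then obtain D where D: "(u has_derivative D) (at x)" by (auto simp: differentiable_def)
  show "\<forall>a<m. (\<lambda>x. coord (u x) a) differentiable at x"
    using bounded_linear.has_derivative[OF bounded_linear_coord D] by (auto simp: differentiable_def)
next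
  assume *: "\<forall>a<m. (\<lambda>x. coord (u x) a) differentiable at x"
  have "(\<lambda>x. \<Sum>a<m. coord (u x) a *\<^sub>R unit_seq a) differentiable at x"
    using * by (intro differentiable_sum differentiable_scaleR) auto
  moreover have "(\<lambda>x. \<Sum>a<m. coord (u x) a *\<^sub>R unit_seq a) = u"
    using coord_space_expansion[of _ m, symmetric] u by (intro ext) auto
  ultimately show "u differentiable at x" by simp
qed

text \<open>
  \<open>F\<close> is differentiable at \<open>x\<close> if and only if for every tolerance \<open>c j\<close> there are a slope \<open>q\<close> from a countable
  dense set and a scale \<open>c k\<close> with \<open>x \<in> A j k q\<close>: the slopes for decreasing tolerances form a Cauchy
  sequence, which converges to the gradient.
\<close>

lemma borel_differentiability_set:
  fixes F :: "'a::euclidean_space \<Rightarrow> real"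
  assumes F: "continuous_on UNIV F"
  shows "{x. F differentiable at x} \<in> sets borel"
proof -
  obtain Q :: "'a set" where Q: "countable Q" "\<And>X. open X \<Longrightarrow> X \<noteq> {} \<Longrightarrow> \<exists>d\<in>Q. d \<in> X"
    using countable_dense_setE by blast
  define c where "c j = 1 / real (Suc j)" for j
  have c: "0 < c j" for j by (simp add: c_def)
  define A where "A j k q = (\<Inter>h\<in>ball 0 (c k). {x. \<bar>F (x + h) - F x - q \<bullet> h\<bar> \<le> c j * norm h})" for j k q
  have clA: "closed (A j k q)" for j k q
    unfolding A_def
    by (intro closed_INT ballI closed_Collect_le continuous_intros continuous_on_compose2[OF F]) auto
  have "{x. F differentiable at x} = (\<Inter>j. \<Union>k. \<Union>q\<in>Q. A j k q)"
  proof (intro equalityI subsetI)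
    fix x assume "x \<in> {x. F differentiable at x}"
    then obtain D where D: "(F has_derivative D) (at x)" by (auto simp: differentiable_def)
    define g where "g = (\<Sum>b\<in>Basis. D b *\<^sub>R b)"
    have lin: "linear D" using D has_derivative_linear by blast
    have Dg: "D h = g \<bullet> h" for h
    proof -
      have "D h = D (\<Sum>b\<in>Basis. (h \<bullet> b) *\<^sub>R b)" by (simp add: euclidean_representation)
      also have "\<dots> = h \<bullet> g" by (simp add: linear_sum[OF lin] linear_scale[OF lin] g_def inner_sum_right mult.commute)
      also have "\<dots> = g \<bullet> h" by (rule inner_commute)
      finally show ?thesis .
    qed
    show "x \<in> (\<Inter>j. \<Union>k. \<Union>q\<in>Q. A j k q)"
    proof
      fix j
      obtain q where q: "q \<in> Q" "q \<in> ball g (c j / 2)" using Q(2)[of "ball g (c j / 2)"] c[of j] by auto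
      have "0 < c j / 2" using c[of j] by simp
      then obtain d where d: "0 < d" "\<And>y. norm (y - x) < d \<Longrightarrow> norm (F y - F x - D (y - x)) \<le> c j / 2 * norm (y - x)"
        using D unfolding has_derivative_at_alt by blast
      obtain k where k: "c k < d" using nat_approx_posE[OF d(1)] unfolding c_def by blast
      have "x \<in> A j k q"
        unfolding A_def
      proof (intro INT_I CollectI)
        fix h :: 'a assume "h \<in> ball 0 (c k)"
        then have h: "norm h < d" using k by simp
        have "\<bar>F (x + h) - F x - g \<bullet> h\<bar> \<le> c j / 2 * norm h" using d(2)[of "x + h"] h by (simp add: Dg)
        moreover have "\<bar>g \<bullet> h - q \<bullet> h\<bar> \<le> c j / 2 * norm h"
        proof -
          have "\<bar>(g - q) \<bullet> h\<bar> \<le> norm (g - q) * norm h" by (rule Cauchy_Schwarz_ineq2)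
          also have "\<dots> \<le> c j / 2 * norm h" using q(2) by (intro mult_right_mono) (auto simp: dist_norm)
          finally show ?thesis by (simp add: inner_diff_left)
        qed
        ultimately show "\<bar>F (x + h) - F x - q \<bullet> h\<bar> \<le> c j * norm h" unfolding abs_le_iff by (simp add: field_simps)
      qed
      then show "x \<in> (\<Union>k. \<Union>q\<in>Q. A j k q)" using q by blast
    qed
  next
    fix x assume x: "x \<in> (\<Inter>j. \<Union>k. \<Union>q\<in>Q. A j k q)"
    then have "\<forall>j. \<exists>k q. x \<in> A j k q" by blast
    then obtain k q where kq: "\<And>j. x \<in> A j (k j) (q j)" unfolding choice_iff by blast
    have est: "\<bar>F (x + h) - F x - q j \<bullet> h\<bar> \<le> c j * norm h" if "norm h < c (k j)" for j h
      using kq[of j] that unfolding A_def by auto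
    have dq: "norm (q i - q j) \<le> c i + c j" for i j
    proof (cases "q i = q j")
      case True
      then show ?thesis using c[of i] c[of j] by simp
    next
      case False
      define t where "t = min (c (k i)) (c (k j)) / 2 / norm (q i - q j)"
      have t: "0 < t" using c[of "k i"] c[of "k j"] False by (simp add: t_def)
      define h where "h = t *\<^sub>R (q i - q j)"
      have nh: "norm h = min (c (k i)) (c (k j)) / 2" using t False c[of "k i"] c[of "k j"] by (simp add: h_def t_def)
      have "norm h < c (k i)" "norm h < c (k j)" unfolding nh using c[of "k i"] c[of "k j"] by (auto simp: min_def)
      from est[OF this(1)] est[OF this(2)] have "\<bar>q i \<bullet> h - q j \<bullet> h\<bar> \<le> (c i + c j) * norm h"
        unfolding abs_le_iff by (simp add: algebra_simps)
      moreover have "q i \<bullet> h - q j \<bullet> h = norm (q i - q j) * norm h"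
      proof -
        have "q i \<bullet> h - q j \<bullet> h = t * ((q i - q j) \<bullet> (q i - q j))"
          by (simp only: h_def inner_scaleR_right inner_diff_left right_diff_distrib)
        then show ?thesis using t by (simp add: h_def power2_norm_eq_inner[symmetric] power2_eq_square)
      qed
      ultimately have "norm (q i - q j) * norm h \<le> (c i + c j) * norm h" by (simp add: abs_mult)
      moreover have "0 < norm h" unfolding nh using c[of "k i"] c[of "k j"] by simp
      ultimately show ?thesis by simp
    qed
    have c0: "c \<longlonglongrightarrow> 0" unfolding c_def using LIMSEQ_inverse_real_of_nat by (simp add: inverse_eq_divide)
    have "Cauchy q"
    proof (rule metric_CauchyI)
      fix e :: real assume "0 < e"
      then obtain M where M: "\<And>n. n \<ge> M \<Longrightarrow> c n < e / 2"
        using order_tendstoD(2)[OF c0, of "e / 2"] by (auto simp: eventually_sequentially)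
      have "dist (q i) (q j) < e" if "i \<ge> M" "j \<ge> M" for i j
        using dq[of i j] M[OF that(1)] M[OF that(2)] by (simp add: dist_norm)
      then show "\<exists>M. \<forall>m\<ge>M. \<forall>n\<ge>M. dist (q m) (q n) < e" by blast
    qed
    then obtain g where g: "q \<longlonglongrightarrow> g" using Cauchy_convergent convergent_def by blast
    have gq: "norm (g - q j) \<le> c j" for j
    proof (rule LIMSEQ_le[OF _ _ exI[of _ 0]])
      show "(\<lambda>i. norm (q i - q j)) \<longlonglongrightarrow> norm (g - q j)" by (intro tendsto_intros g)
      show "(\<lambda>i. c i + c j) \<longlonglongrightarrow> c j" using tendsto_add[OF c0 tendsto_const[of "c j"]] by simp
    qed (use dq in auto)
    have "(F has_derivative (\<lambda>h. g \<bullet> h)) (at x)"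
      unfolding has_derivative_at_alt
    proof (intro conjI allI impI)
      show "bounded_linear ((\<bullet>) g)" by (rule bounded_linear_inner_right)
      fix e :: real assume "0 < e"
      then obtain j where j: "c j < e / 2" using nat_approx_posE[of "e / 2"] unfolding c_def by auto
      show "\<exists>d>0. \<forall>y. norm (y - x) < d \<longrightarrow> norm (F y - F x - g \<bullet> (y - x)) \<le> e * norm (y - x)"
      proof (intro exI[of _ "c (k j)"] conjI allI impI c)
        fix y assume y: "norm (y - x) < c (k j)"
        have "\<bar>F y - F x - q j \<bullet> (y - x)\<bar> \<le> c j * norm (y - x)" using est[OF y] by simp
        moreover have "\<bar>g \<bullet> (y - x) - q j \<bullet> (y - x)\<bar> \<le> c j * norm (y - x)"
        proof -
          have "\<bar>(g - q j) \<bullet> (y - x)\<bar> \<le> norm (g - q j) * norm (y - x)" by (rule Cauchy_Schwarz_ineq2)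
          also have "\<dots> \<le> c j * norm (y - x)" using gq by (rule mult_right_mono) simp
          finally show ?thesis by (simp add: inner_diff_left)
        qed
        ultimately have "\<bar>F y - F x - g \<bullet> (y - x)\<bar> \<le> 2 * c j * norm (y - x)" unfolding abs_le_iff by simp
        also have "\<dots> \<le> e * norm (y - x)" using j by (intro mult_right_mono) auto
        finally show "norm (F y - F x - g \<bullet> (y - x)) \<le> e * norm (y - x)" by simp
      qed
    qed
    then show "x \<in> {x. F differentiable at x}" by (auto simp: differentiable_def)
  qed
  also have "\<dots> \<in> sets borel"
    using Q(1) borel_closed[OF clA]
    by (intro sets.countable_INT'' sets.countable_UN') auto
  finally show ?thesis .
qed

section \<open>Lipschitz graphs and their area measure\<close>

locale lipschitz_graph =
  fixes m :: nat and u :: "real ^ 'n \<Rightarrow> fin_seq"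
  assumes u_range: "range u \<subseteq> coord_space m" and u_lip: "locally_lipschitz u"
begin

definition gr :: "real ^ 'n \<Rightarrow> (real ^ 'n) \<times> fin_seq" where "gr x = (x, u x)"
definition \<D> :: "(real ^ 'n) set" where "\<D> = {x. u differentiable at x}"
definition Du :: "real ^ 'n \<Rightarrow> real ^ 'n \<Rightarrow> fin_seq" where "Du x = frechet_derivative u (at x)"

abbreviation H :: "((real ^ 'n) \<times> fin_seq) measure" where "H \<equiv> hausdorff_measure CARD('n)"

text \<open>
  The area measure of the graph, projected to the base.
\<close>

definition \<mu> :: "(real ^ 'n) measure" where
  "\<mu> = distr (restrict_space H (graph_of u)) borel fst"

lemma fst_gr [simp]: "fst (gr x) = x" and snd_gr [simp]: "snd (gr x) = u x"
  by (simp_all add: gr_def)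

lemma u_in: "u x \<in> coord_space m" using u_range by auto

lemma gr_ambient: "gr x \<in> ambient m" by (simp add: gr_def ambient_def u_in)

lemma graph_eq: "graph_of u = range gr" by (simp add: graph_of_def gr_def)

lemma continuous_u: "continuous_on UNIV u"
proof (rule continuous_at_imp_continuous_on, rule ballI)
  fix x
  obtain e L where "0 < e" "L-lipschitz_on (ball x e) u" using u_lip unfolding locally_lipschitz_def by blast
  then show "isCont u x" using lipschitz_on_continuous_on[of L "ball x e" u]
    by (metis centre_in_ball continuous_on_eq_continuous_at open_ball)
qed

lemma continuous_gr: "continuous_on UNIV gr"
  unfolding gr_def by (intro continuous_intros continuous_u)

lemma lipschitz_gr: "locally_lipschitz gr"
  unfolding locally_lipschitz_def
proof
  fix x
  obtain e L where e: "0 < e" "L-lipschitz_on (ball x e) u" using u_lip unfolding locally_lipschitz_def by blast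
  have "(1 + L)-lipschitz_on (ball x e) gr"
  proof (rule lipschitz_onI)
    fix y z assume yz: "y \<in> ball x e" "z \<in> ball x e"
    have "dist (gr y) (gr z) \<le> dist y z + dist (u y) (u z)"
      unfolding gr_def dist_Pair_Pair by (rule sqrt_sum_squares_le_sum) auto
    also have "dist (u y) (u z) \<le> L * dist y z" using e yz by (intro lipschitz_onD)
    finally show "dist (gr y) (gr z) \<le> (1 + L) * dist y z" by (simp add: algebra_simps)
  qed (use lipschitz_on_nonneg[OF e(2)] in simp)
  then show "\<exists>e>0. \<exists>L. L-lipschitz_on (ball x e) gr" using e by blast
qed

lemma closed_graph: "closed (graph_of u)"
proof -
  have "graph_of u = {z. snd z = u (fst z)}" by (auto simp: graph_of_def image_def)
  moreover have "closed {z. snd z = u (fst z)}"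
    by (intro closed_Collect_eq continuous_intros continuous_on_compose2[OF continuous_u]) auto
  ultimately show ?thesis by simp
qed

lemma graph_borel: "graph_of u \<in> sets borel" by (rule borel_closed[OF closed_graph])

lemma fst_vimage_borel: "A \<in> sets borel \<Longrightarrow> (fst -` A :: ((real ^ 'n) \<times> fin_seq) set) \<in> sets borel"
  using measurable_sets[OF borel_measurable_continuous_onI[OF continuous_on_fst[OF continuous_on_id]], of A]
  by simp

lemma gr_image: "gr ` A = fst -` A \<inter> graph_of u"
  by (auto simp: gr_def graph_of_def)

lemma gr_image_borel: "A \<in> sets borel \<Longrightarrow> gr ` A \<in> sets borel"
  unfolding gr_image using fst_vimage_borel graph_borel by auto

lemma sets_\<mu> [simp, measurable_cong]: "sets \<mu> = sets borel" by (simp add: \<mu>_def)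

lemma space_\<mu> [simp]: "space \<mu> = UNIV" by (simp add: \<mu>_def)

lemma fst_measurable_restrict: "fst \<in> restrict_space H (graph_of u) \<rightarrow>\<^sub>M borel"
proof -
  have "fst \<in> (borel :: ((real ^ 'n) \<times> fin_seq) measure) \<rightarrow>\<^sub>M borel"
    by (intro borel_measurable_continuous_onI continuous_intros)
  then have "fst \<in> H \<rightarrow>\<^sub>M borel" by (simp cong: measurable_cong_sets)
  then show ?thesis by (rule measurable_restrict_space1)
qed

lemma space_H: "space H = UNIV"
  using sets_eq_imp_space_eq[OF sets_hausdorff_measure] by simp

lemma emeasure_\<mu>: "A \<in> sets borel \<Longrightarrow> emeasure \<mu> A = hausdorff_outer CARD('n) (gr ` A)"
proof -
  assume A: "A \<in> sets borel"
  have "emeasure \<mu> A = emeasure (restrict_space H (graph_of u)) (fst -` A \<inter> graph_of u)"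
    unfolding \<mu>_def by (subst emeasure_distr[OF fst_measurable_restrict A]) (simp add: space_restrict_space space_H)
  also have "\<dots> = emeasure H (fst -` A \<inter> graph_of u)"
    by (rule emeasure_restrict_space) (auto simp: space_H graph_borel)
  also have "\<dots> = hausdorff_outer CARD('n) (gr ` A)"
    unfolding gr_image[symmetric] by (rule emeasure_hausdorff_measure[OF gr_image_borel[OF A]])
  finally show ?thesis .
qed

lemma integral_graph:
  fixes \<phi> :: "_ \<Rightarrow> real"
  assumes m: "(\<lambda>x. indicator A x * \<phi> (gr x)) \<in> borel_measurable borel"
  shows "(LINT z:gr ` A|H. \<phi> z) = (\<integral>x. indicator A x * \<phi> (gr x) \<partial>\<mu>)"
proof -
  have "(\<integral>x. indicator A x * \<phi> (gr x) \<partial>\<mu>) =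
      (\<integral>z. indicator A (fst z) * \<phi> (gr (fst z)) \<partial>restrict_space H (graph_of u))"
    unfolding \<mu>_def by (rule integral_distr[OF fst_measurable_restrict m])
  also have "\<dots> = (\<integral>z. indicator (graph_of u) z *\<^sub>R (indicator A (fst z) * \<phi> (gr (fst z))) \<partial>H)"
    by (rule integral_restrict_space) (simp add: space_H graph_borel)
  also have "\<dots> = (LINT z:gr ` A|H. \<phi> z)"
    unfolding set_lebesgue_integral_def
  proof (rule Bochner_Integration.integral_cong[OF refl])
    fix z
    show "indicator (graph_of u) z *\<^sub>R (indicator A (fst z) * \<phi> (gr (fst z))) = indicator (gr ` A) z *\<^sub>R \<phi> z"
      by (auto simp: indicator_def graph_of_def gr_def image_def)
  qed
  finally show ?thesis by simp
qed

lemma locally_lipschitz_coord: "locally_lipschitz (\<lambda>x. coord (u x) a)"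
  unfolding locally_lipschitz_def
proof
  fix x
  obtain e L where e: "0 < e" "L-lipschitz_on (ball x e) u" using u_lip unfolding locally_lipschitz_def by blast
  have "L-lipschitz_on (ball x e) (\<lambda>x. coord (u x) a)"
  proof (rule lipschitz_onI)
    fix y z assume yz: "y \<in> ball x e" "z \<in> ball x e"
    have "dist (coord (u y) a) (coord (u z) a) = \<bar>(u y - u z) \<bullet> unit_seq a\<bar>"
      by (simp only: dist_real_def inner_diff_left) (simp only: inner_unit_seq)
    also have "\<dots> \<le> norm (u y - u z) * norm (unit_seq a)" by (rule Cauchy_Schwarz_ineq2)
    also have "norm (unit_seq a) = 1" by (simp add: norm_eq_1 inner_unit_seq unit_seq.rep_eq)
    also have "norm (u y - u z) * 1 \<le> L * dist y z" using lipschitz_onD[OF e(2) yz] by (simp add: dist_norm)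
    finally show "dist (coord (u y) a) (coord (u z) a) \<le> L * dist y z" .
  qed (rule lipschitz_on_nonneg[OF e(2)])
  then show "\<exists>e>0. \<exists>L. L-lipschitz_on (ball x e) (\<lambda>x. coord (u x) a)" using e by blast
qed

lemma \<D>_eq: "\<D> = (\<Inter>a\<in>{..<m}. {x. (\<lambda>x. coord (u x) a) differentiable at x})"
  unfolding \<D>_def using differentiable_coordinatewise[OF u_range] by auto

lemma continuous_coord_u: "continuous_on UNIV (\<lambda>x. coord (u x) a)"
  by (rule bounded_linear.continuous_on[OF bounded_linear_coord continuous_u])

lemma \<D>_borel [measurable]: "\<D> \<in> sets borel"
  unfolding \<D>_eq by (intro sets.countable_INT'' borel_differentiability_set continuous_coord_u) auto

lemma negligible_not_\<D>: "negligible (- \<D>)"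
proof -
  have "- \<D> = (\<Union>a\<in>{..<m}. {x. \<not> (\<lambda>x. coord (u x) a) differentiable at x})" unfolding \<D>_eq by auto
  then show ?thesis
    using rademacher_locally_lipschitz[OF locally_lipschitz_coord] by (auto intro!: negligible_UN_countable)
qed

lemma \<mu>_negligible: "negligible N \<Longrightarrow> N \<in> sets borel \<Longrightarrow> emeasure \<mu> N = 0"
  using hausdorff_outer_image_negligible[OF lipschitz_gr] by (simp add: emeasure_\<mu>)

lemma AE_\<mu>_\<D>: "AE x in \<mu>. x \<in> \<D>"
  using \<mu>_negligible[OF negligible_not_\<D>] by (intro AE_I[of _ _ "- \<D>"]) auto

lemma has_derivative_Du: "x \<in> \<D> \<Longrightarrow> (u has_derivative Du x) (at x)"
  unfolding \<D>_def Du_def by (simp add: frechet_derivative_works)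

lemma linear_Du: "x \<in> \<D> \<Longrightarrow> linear (Du x)"
  using has_derivative_Du has_derivative_linear by blast

lemma Du_in: "x \<in> \<D> \<Longrightarrow> Du x v \<in> coord_space m"
proof -
  assume x: "x \<in> \<D>"
  have "coord (Du x v) a = 0" if "m \<le> a" for a
  proof -
    have "((\<lambda>x. coord (u x) a) has_derivative (\<lambda>v. coord (Du x v) a)) (at x)"
      by (rule bounded_linear.has_derivative[OF bounded_linear_coord has_derivative_Du[OF x]])
    moreover have "(\<lambda>x. coord (u x) a) = (\<lambda>x. 0)" using u_in that by (auto simp: coord_space_def)
    ultimately have "(\<lambda>v. coord (Du x v) a) = (\<lambda>v. 0)"
      using has_derivative_unique by (metis has_derivative_const)
    then show ?thesis by meson
  qed
  then show ?thesis by (simp add: coord_space_def)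
qed

lemma measurable_partial:
  "(\<lambda>x. indicator \<D> x * coord (Du x v) a) \<in> borel_measurable borel"
proof (rule borel_measurable_LIMSEQ_real)
  let ?s = "\<lambda>k x. indicator \<D> x * ((coord (u (x + (1 / real (Suc k)) *\<^sub>R v)) a - coord (u x) a) / (1 / real (Suc k)))"
  show "?s k \<in> borel_measurable borel" for k
    by (intro borel_measurable_times borel_measurable_indicator \<D>_borel borel_measurable_continuous_onI
      continuous_intros continuous_on_compose2[OF continuous_coord_u]) auto
  fix x
  show "(\<lambda>k. ?s k x) \<longlonglongrightarrow> indicator \<D> x * coord (Du x v) a"
  proof (cases "x \<in> \<D>")
    case True
    have d: "((\<lambda>x. coord (u x) a) has_derivative (\<lambda>v. coord (Du x v) a)) (at x)"
      by (rule bounded_linear.has_derivative[OF bounded_linear_coord has_derivative_Du[OF True]])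
    have l: "((\<lambda>t::real. x + t *\<^sub>R v) has_derivative (\<lambda>t. t *\<^sub>R v)) (at 0)"
      by (auto intro!: derivative_eq_intros)
    have "((\<lambda>t. coord (u (x + t *\<^sub>R v)) a) has_derivative (\<lambda>t. coord (Du x (t *\<^sub>R v)) a)) (at 0)"
      using has_derivative_compose[OF l, of "\<lambda>x. coord (u x) a" "\<lambda>v. coord (Du x v) a"] d by simp
    moreover have "coord (Du x (t *\<^sub>R v)) a = coord (Du x v) a * t" for t
      by (simp add: linear_scale[OF linear_Du[OF True]] scaleR_fin_seq.rep_eq)
    ultimately have "((\<lambda>t. coord (u (x + t *\<^sub>R v)) a) has_field_derivative coord (Du x v) a) (at 0)"
      by (simp add: has_field_derivative_def)
    then have lim: "((\<lambda>t. (coord (u (x + t *\<^sub>R v)) a - coord (u x) a) / t) \<longlongrightarrow> coord (Du x v) a) (at 0)"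
      by (simp add: has_field_derivative_iff)
    have "filterlim (\<lambda>k. 1 / real (Suc k)) (at 0) sequentially"
      unfolding filterlim_at using LIMSEQ_inverse_real_of_nat by (auto simp: inverse_eq_divide)
    from filterlim_compose[OF lim this] show ?thesis using True by simp
  qed simp
qed

text \<open>
  On a compact set finitely many balls suffice on each of which \<open>gr\<close> is Lipschitz.
\<close>

lemma \<mu>_bounded_finite: 
  assumes "bounded B" "B \<in> sets borel"
  shows "emeasure \<mu> B < top"
proof -
  obtain R where R: "B \<subseteq> cball 0 R" using assms(1) by (auto simp: bounded_iff subset_eq)
  have "\<exists>e>0. hausdorff_outer CARD('n) (gr ` ball x e) < top" for x
  proof -
    obtain e L where e: "0 < e" "L-lipschitz_on (ball x e) gr" using lipschitz_gr unfolding locally_lipschitz_def by blast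
    have L: "0 \<le> L" using e lipschitz_on_nonneg by blast
    let ?c = "unit_ball_vol CARD('n) * (L + 1) ^ CARD('n)"
    have "hausdorff_outer CARD('n) (gr ` ball x e) \<le>
        ennreal (?c * 5 ^ DIM(real^'n) / unit_ball_vol DIM(real^'n)) * emeasure lebesgue (ball x e)"
    proof (rule hausdorff_outer_image_le)
      show "0 \<le> ?c" "0 < 2 * (L + 1)" using L by auto
      fix y assume y: "y \<in> ball x e"
      then obtain d where d: "0 < d" "ball y d \<subseteq> ball x e" using openE[OF open_ball y] by blast
      show "\<exists>\<rho>0>0. \<forall>\<rho>. 0 < \<rho> \<longrightarrow> \<rho> < \<rho>0 \<longrightarrow>
        hausdorff_pre CARD('n) (2 * (L + 1) * \<rho>) (gr ` cball y \<rho>) \<le> ennreal (?c * \<rho> ^ DIM(real^'n))"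
      proof (intro exI[of _ d] conjI allI impI d(1))
        fix \<rho> assume \<rho>: "0 < \<rho>" "\<rho> < d"
        have "gr ` cball y \<rho> \<subseteq> cball (gr y) ((L + 1) * \<rho>)"
        proof (rule image_subsetI)
          fix z assume z: "z \<in> cball y \<rho>"
          then have "z \<in> ball x e" using d(2) \<rho> by (auto simp: subset_eq)
          then have "dist (gr y) (gr z) \<le> L * dist y z" using y by (intro lipschitz_onD[OF e(2)])
          also have "\<dots> \<le> (L + 1) * \<rho>" using z L by (intro mult_mono) auto
          finally show "gr z \<in> cball (gr y) ((L + 1) * \<rho>)" by simp
        qed
        then have "hausdorff_pre CARD('n) (2 * ((L + 1) * \<rho>)) (gr ` cball y \<rho>) \<le> ennreal (real 1 * (unit_ball_vol CARD('n) * ((L + 1) * \<rho>) ^ CARD('n)))"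
          using \<rho> L
          by (intro hausdorff_pre_le_cballs[where N=1 and T="\<lambda>_. gr ` cball y \<rho>"] exI[of _ "gr y"]) auto
        then show "hausdorff_pre CARD('n) (2 * (L + 1) * \<rho>) (gr ` cball y \<rho>) \<le> ennreal (?c * \<rho> ^ DIM(real^'n))"
          by (simp only: power_mult_distrib mult.assoc[symmetric] DIM_cart DIM_real mult_1_right of_nat_1 mult_1)
      qed
    qed auto
    also have "\<dots> < top"
      using fmeasurableD2[OF lmeasurable_ball[of x e]] by (simp add: ennreal_mult_less_top less_top)
    finally show ?thesis using e(1) by blast
  qed
  then have "\<forall>x. \<exists>e. e > 0 \<and> hausdorff_outer CARD('n) (gr ` ball x e) < top" by blast
  then obtain e where e: "\<And>x. 0 < e x" "\<And>x. hausdorff_outer CARD('n) (gr ` ball x (e x)) < top"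
    unfolding choice_iff by blast
  have cov: "cball 0 R \<subseteq> (\<Union>x\<in>UNIV. ball x (e x))" using e(1) centre_in_ball by blast
  obtain C where "C \<subseteq> (UNIV :: (real ^ 'n) set)" and C: "finite C" "cball 0 R \<subseteq> (\<Union>x\<in>C. ball x (e x))"
    by (rule compactE_image[OF compact_cball[of 0 R] open_ball cov])
  have "emeasure \<mu> B \<le> emeasure \<mu> (\<Union>x\<in>C. ball x (e x))"
  proof (rule emeasure_mono)
    show "(\<Union>x\<in>C. ball x (e x)) \<in> sets \<mu>" by (simp add: borel_open open_UN)
  qed (rule subset_trans[OF R C(2)])
  also have "\<dots> \<le> (\<Sum>x\<in>C. emeasure \<mu> (ball x (e x)))" using C(1) by (intro emeasure_subadditive_finite) auto
  also have "\<dots> < top" using e(2) C(1) by (simp add: emeasure_\<mu>)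
  finally show ?thesis .
qed

lemma tangent_plane_gr: "tangent_plane u (gr x) = graph_plane (Du x)"
  by (simp add: tangent_plane_def graph_plane_def Du_def)

lemma regular_graph_eq: "regular_graph u = gr ` \<D>"
  by (auto simp: regular_graph_def gr_def \<D>_def)

text \<open>
  The tangential divergence as a function on the base, set to \<open>0\<close> at the null set of points without tangent plane.
\<close>

definition tdiv :: "(((real ^ 'n) \<times> fin_seq) \<Rightarrow> ((real ^ 'n) \<times> fin_seq) \<Rightarrow> ((real ^ 'n) \<times> fin_seq)) \<Rightarrow> real ^ 'n \<Rightarrow> real" where
  "tdiv X' x = indicator \<D> x * tangential_div (X' (gr x)) (graph_plane (Du x))"

lemma Du_expansion: "x \<in> \<D> \<Longrightarrow> Du x v = (\<Sum>a<m. coord (Du x v) a *\<^sub>R unit_seq a)"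
  by (rule coord_space_expansion[OF Du_in])

lemma measurable_det:
  fixes A :: "'a \<Rightarrow> real ^ 'n ^ 'n"
  assumes "\<And>i j. (\<lambda>x. A x $ i $ j) \<in> borel_measurable M"
  shows "(\<lambda>x. det (A x)) \<in> borel_measurable M"
  unfolding det_def using assms by (intro borel_measurable_sum borel_measurable_times borel_measurable_prod borel_measurable_const)

text \<open>
  The divergence is a polynomial in the inverse metric, the partial derivatives of \<open>u\<close>, and the coefficients of the
  field.
\<close>

lemma measurable_tdiv:
  assumes lin: "\<And>z. linear (X' z)" and cont: "\<And>v. continuous_on UNIV (\<lambda>z. X' z v)"
  shows "tdiv X' \<in> borel_measurable borel"
proof -
  define p where "p a i x = indicator \<D> x * coord (Du x (axis i 1)) a" for a i x
  have pm [measurable]: "p a i \<in> borel_measurable borel" for a i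
    unfolding p_def by (rule measurable_partial)
  define g where "g i j x = (\<Sum>a<m. p a i x * p a j x)" for i j x
  define M where "M x = (mat 1 + (\<chi> i j. g i j x) :: real^'n^'n)" for x
  have gm: "g i j \<in> borel_measurable borel" for i j unfolding g_def by measurable
  have Mm: "(\<lambda>x. M x $ i $ j) \<in> borel_measurable borel" for i j
    unfolding M_def using gm by simp
  define N where "N a b x = det (\<chi> i j. if j = a then axis b 1 $ i else M x $ i $ j) / det (M x)" for a b x
  have Nm: "N a b \<in> borel_measurable borel" for a b
    unfolding N_def
  proof (intro borel_measurable_divide measurable_det)
    fix i j
    show "(\<lambda>x. (\<chi> i j. if j = a then axis b 1 $ i else M x $ i $ j) $ i $ j) \<in> borel_measurable borel"
      using Mm by (cases "j = a") auto
  qed (rule Mm)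
  define E1 where "E1 = (\<lambda>i. (axis i 1, 0) :: (real^'n) \<times> fin_seq)"
  define E2 where "E2 = (\<lambda>a. (0, unit_seq a) :: (real^'n) \<times> fin_seq)"
  define S where "S i j x = X' (gr x) (E1 i) \<bullet> E1 j + (\<Sum>a<m. p a i x * (X' (gr x) (E2 a) \<bullet> E1 j))
     + (\<Sum>b<m. p b j x * (X' (gr x) (E1 i) \<bullet> E2 b + (\<Sum>a<m. p a i x * (X' (gr x) (E2 a) \<bullet> E2 b))))" for i j x
  have Xm [measurable]: "(\<lambda>x. X' (gr x) v \<bullet> w) \<in> borel_measurable borel" for v w
    by (intro borel_measurable_continuous_onI continuous_intros continuous_on_compose2[OF cont continuous_gr]) auto
  have Sm: "S i j \<in> borel_measurable borel" for i j
    unfolding S_def by measurable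
  have eq: "tdiv X' x = indicator \<D> x * (\<Sum>i\<in>UNIV. \<Sum>j\<in>UNIV. N i j x * S i j x)" for x
  proof (cases "x \<in> \<D>")
    case True
    have pD: "p a i x = coord (Du x (axis i 1)) a" for a i using True by (simp add: p_def)
    have "g i j x = Du x (axis i 1) \<bullet> Du x (axis j 1)" for i j
      unfolding g_def pD by (rule inner_coord_space[OF Du_in[OF True], symmetric])
    then have M: "M x = mat 1 + gram_matrix (Du x)" by (simp add: M_def gram_matrix_def)
    have N: "N a b x = inverse_metric (Du x) a b" for a b
      unfolding N_def inverse_metric_def M ..
    have ax: "(axis i 1, Du x (axis i 1)) = E1 i + (\<Sum>a<m. p a i x *\<^sub>R E2 a)" for i
      by (subst Du_expansion[OF True]) (simp add: E1_def E2_def pD sum_prod prod_eq_iff fst_sum snd_sum)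
    have "X' (gr x) (axis i 1, Du x (axis i 1)) \<bullet> (axis j 1, Du x (axis j 1)) = S i j x" for i j
      unfolding ax linear_add[OF lin] linear_sum[OF lin] linear_scale[OF lin] S_def
      by (simp add: inner_add_left inner_add_right inner_sum_left inner_sum_right sum.distrib distrib_left sum_distrib_left del: scaleR_Pair)
    then show ?thesis
      using True unfolding tdiv_def tangential_div_inverse_metric[OF linear_Du[OF True] lin] N by simp
  qed (simp add: tdiv_def)
  have "(\<lambda>x. indicator \<D> x * (\<Sum>i\<in>UNIV. \<Sum>j\<in>UNIV. N i j x * S i j x)) \<in> borel_measurable borel"
    using Nm Sm by (intro borel_measurable_times borel_measurable_sum borel_measurable_indicator \<D>_borel)
  moreover have "tdiv X' = (\<lambda>x. indicator \<D> x * (\<Sum>i\<in>UNIV. \<Sum>j\<in>UNIV. N i j x * S i j x))"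
    by (rule ext) (rule eq)
  ultimately show ?thesis by (simp only:)
qed

text \<open>
  The basis depends on the point only, not on the field, so divergences of several fields can be compared.
\<close>

lemma tdiv_family:
  assumes "x \<in> \<D>"
  shows "\<exists>e :: 'n \<Rightarrow> (real ^ 'n) \<times> fin_seq.
    (\<forall>i j. e i \<bullet> e j = (if i = j then 1 else 0)) \<and> (\<forall>i. e i \<in> ambient m) \<and>
    (\<forall>X'. linear (X' (gr x)) \<longrightarrow> tdiv X' x = (\<Sum>i\<in>UNIV. X' (gr x) (e i) \<bullet> e i))"
proof -
  obtain f :: "'n \<Rightarrow> real ^ 'n" and l where f: "\<And>i j. f i \<bullet> f j = (if i = j then 1 else 0)"
    and Lf: "\<And>i j. Du x (f i) \<bullet> Du x (f j) = (if i = j then (l i)\<^sup>2 else 0)"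
    and "singular_values (Du x) l"
    using singular_basis_exists[OF linear_Du[OF assms]] by auto
  define e where "e = (\<lambda>i. (1 / sqrt (1 + (l i)\<^sup>2)) *\<^sub>R (f i, Du x (f i)))"
  show ?thesis
  proof (intro exI[of _ e] conjI allI impI)
    show "e i \<bullet> e j = (if i = j then 1 else 0)" for i j
      using graph_plane_singular_basis(1)[OF linear_Du[OF assms] f Lf] unfolding e_def .
    show "e i \<in> ambient m" for i
      using Du_in[OF assms] subspace_scale[OF subspace_coord_space] by (auto simp: e_def ambient_def)
    show "tdiv X' x = (\<Sum>i\<in>UNIV. X' (gr x) (e i) \<bullet> e i)" if "linear (X' (gr x))" for X'
      using assms tangential_div_family[OF that graph_plane_singular_basis[OF linear_Du[OF assms] f Lf]]
      unfolding tdiv_def e_def by simp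
  qed
qed

text \<open>
  The operator norm of \<open>X' z\<close> on the ambient space is controlled by the finitely many values \<open>X' z v\<close> at the vectors \<open>v\<close>
  of a basis, and these are continuous functions of \<open>z\<close>.
\<close>

lemma integrable_tdiv:
  assumes lin: "\<And>z. linear (X' z)" and cont: "\<And>v. continuous_on UNIV (\<lambda>z. X' z v)"
    and supp: "\<And>x v. \<rho> \<le> norm (x - x0) \<Longrightarrow> X' (gr x) v = 0"
  shows "integrable \<mu> (tdiv X')"
proof -
  define E1 where "E1 = (\<lambda>i. (axis i 1, 0) :: (real^'n) \<times> fin_seq)"
  define E2 where "E2 = (\<lambda>a. (0, unit_seq a) :: (real^'n) \<times> fin_seq)"
  define h where "h x = (\<Sum>i\<in>UNIV. norm (X' (gr x) (E1 i))) + (\<Sum>a<m. norm (X' (gr x) (E2 a)))" for x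
  have ch: "continuous_on (cball x0 \<rho>) h"
    unfolding h_def by (intro continuous_intros continuous_on_compose2[OF cont continuous_on_subset[OF continuous_gr]]) auto
  obtain K where K: "\<And>x. x \<in> cball x0 \<rho> \<Longrightarrow> h x \<le> K"
  proof -
    have "bounded (h ` cball x0 \<rho>)" using compact_continuous_image[OF ch compact_cball] compact_imp_bounded by blast
    then obtain a where "\<forall>y\<in>h ` cball x0 \<rho>. norm y \<le> a" unfolding bounded_iff by blast
    then show ?thesis using that[of a] by force
  qed
  have nb: "norm (X' (gr x) e) \<le> h x * norm e" if e: "e \<in> ambient m" for x e
  proof -
    have s: "snd e \<in> coord_space m" using e by (auto simp: ambient_def)
    have "e = (\<Sum>i\<in>UNIV. (fst e $ i) *\<^sub>R E1 i) + (\<Sum>a<m. coord (snd e) a *\<^sub>R E2 a)"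
      using coord_space_expansion[OF s] basis_expansion[of "fst e", unfolded scalar_mult_eq_scaleR]
      by (simp add: prod_eq_iff fst_sum snd_sum E1_def E2_def)
    then have "X' (gr x) e = X' (gr x) ((\<Sum>i\<in>UNIV. (fst e $ i) *\<^sub>R E1 i) + (\<Sum>a<m. coord (snd e) a *\<^sub>R E2 a))"
      by simp
    also have "\<dots> = (\<Sum>i\<in>UNIV. (fst e $ i) *\<^sub>R X' (gr x) (E1 i)) + (\<Sum>a<m. coord (snd e) a *\<^sub>R X' (gr x) (E2 a))"
      by (simp only: linear_add[OF lin] linear_sum[OF lin] linear_scale[OF lin])
    also have "norm \<dots> \<le> (\<Sum>i\<in>UNIV. norm e * norm (X' (gr x) (E1 i))) + (\<Sum>a<m. norm e * norm (X' (gr x) (E2 a)))"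
    proof (intro norm_triangle_le add_mono)
      have 1: "\<bar>fst e $ i\<bar> \<le> norm e" for i
        using component_le_norm_cart[of "fst e" i] norm_fst_le[of "fst e" "snd e"] by simp
      show "norm (\<Sum>i\<in>UNIV. (fst e $ i) *\<^sub>R X' (gr x) (E1 i)) \<le> (\<Sum>i\<in>UNIV. norm e * norm (X' (gr x) (E1 i)))"
        using 1 by (intro sum_norm_le) (auto intro!: mult_right_mono)
      have 2: "\<bar>coord (snd e) a\<bar> \<le> norm e" for a
      proof -
        have "\<bar>snd e \<bullet> unit_seq a\<bar> \<le> norm (snd e) * norm (unit_seq a)" by (rule Cauchy_Schwarz_ineq2)
        also have "norm (unit_seq a) = 1" by (simp add: norm_eq_1 inner_unit_seq unit_seq.rep_eq)
        finally show ?thesis using norm_snd_le[of "snd e" "fst e"] by (simp add: inner_unit_seq)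
      qed
      show "norm (\<Sum>a<m. coord (snd e) a *\<^sub>R X' (gr x) (E2 a)) \<le> (\<Sum>a<m. norm e * norm (X' (gr x) (E2 a)))"
        using 2 by (intro sum_norm_le) (auto intro!: mult_right_mono)
    qed
    also have "\<dots> = h x * norm e" by (simp add: h_def sum_distrib_left[symmetric] algebra_simps)
    finally show ?thesis .
  qed

  have bnd: "norm (tdiv X' x) \<le> real CARD('n) * \<bar>K\<bar>" if x: "x \<in> cball x0 \<rho>" for x
  proof (cases "x \<in> \<D>")
    case True
    obtain e :: "'n \<Rightarrow> (real ^ 'n) \<times> fin_seq" where e: "\<And>i j. e i \<bullet> e j = (if i = j then 1 else 0)"
      "\<And>i. e i \<in> ambient m" "tdiv X' x = (\<Sum>i\<in>UNIV. X' (gr x) (e i) \<bullet> e i)"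
      using tdiv_family[OF True] lin by blast
    have ne: "norm (e i) = 1" for i using e(1)[of i i] by (simp add: norm_eq_1)
    have "norm (tdiv X' x) \<le> (\<Sum>i\<in>(UNIV::'n set). \<bar>K\<bar>)"
      unfolding e(3)
    proof (rule sum_norm_le)
      fix i
      have "norm (X' (gr x) (e i) \<bullet> e i) \<le> norm (X' (gr x) (e i)) * norm (e i)"
        using Cauchy_Schwarz_ineq2 by simp
      also have "\<dots> \<le> h x" using nb[OF e(2)[of i], of x] by (simp add: ne)
      also have "\<dots> \<le> \<bar>K\<bar>" using K[OF x] by simp
      finally show "norm (X' (gr x) (e i) \<bullet> e i) \<le> \<bar>K\<bar>" .
    qed
    then show ?thesis by simp
  qed (simp add: tdiv_def)
  show ?thesis
  proof (rule integrableI_bounded_set[where A="cball x0 \<rho>" and B="real CARD('n) * \<bar>K\<bar>"])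
    show "tdiv X' \<in> borel_measurable \<mu>" using measurable_tdiv[OF lin cont] by (simp cong: measurable_cong_sets)
    show "emeasure \<mu> (cball x0 \<rho>) < \<infinity>" using \<mu>_bounded_finite[of "cball x0 \<rho>"] by simp
    show "AE x in \<mu>. x \<in> cball x0 \<rho> \<longrightarrow> norm (tdiv X' x) \<le> real CARD('n) * \<bar>K\<bar>" using bnd by simp
    have "tdiv X' x = 0" if "x \<notin> cball x0 \<rho>" for x
    proof (cases "x \<in> \<D>")
      case True
      obtain e :: "'n \<Rightarrow> (real ^ 'n) \<times> fin_seq" where e: "tdiv X' x = (\<Sum>i\<in>UNIV. X' (gr x) (e i) \<bullet> e i)"
        using tdiv_family[OF True] lin by blast
      have "\<rho> \<le> norm (x - x0)" using that by (simp add: dist_norm norm_minus_commute)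
      then show ?thesis unfolding e using supp by simp
    qed (simp add: tdiv_def)
    then show "AE x in \<mu>. x \<notin> cball x0 \<rho> \<longrightarrow> tdiv X' x = 0" by simp
  qed auto
qed

end

section \<open>Stationarity on the base\<close>

text \<open>
  The square of the positive part, from which all cut-off functions are built because it is \<open>C\<^sup>1\<close>.
\<close>

definition pos_sq :: "real \<Rightarrow> real" where "pos_sq t = (max 0 t)\<^sup>2"

lemma pos_sq_deriv: "(pos_sq has_real_derivative 2 * max 0 t) (at t)"
proof (cases t "0::real" rule: linorder_cases)
  case less
  have "(pos_sq has_real_derivative 0) (at t)"
    by (rule has_field_derivative_transform_within_open[of "\<lambda>_. 0" _ _ "{..<0}"])
      (use less in \<open>auto simp: pos_sq_def\<close>)
  then show ?thesis using less by simp
next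
  case greater
  have "(pos_sq has_real_derivative 2 * t) (at t)"
    by (rule has_field_derivative_transform_within_open[of "\<lambda>t. t\<^sup>2" _ _ "{0<..}"])
      (use greater in \<open>auto simp: pos_sq_def intro!: derivative_eq_intros\<close>)
  then show ?thesis using greater by simp
next
  case equal
  have "((\<lambda>h. (pos_sq (0 + h) - pos_sq 0) / h) \<longlongrightarrow> 0) (at 0)"
  proof (rule Lim_null_comparison)
    show "\<forall>\<^sub>F h in at 0. norm ((pos_sq (0 + h) - pos_sq 0) / h) \<le> \<bar>h\<bar>"
      unfolding eventually_at
      by (rule exI[of _ 1]) (auto simp: pos_sq_def max_def power2_eq_square)
    show "((\<lambda>h::real. \<bar>h\<bar>) \<longlongrightarrow> 0) (at 0)" by (rule tendsto_eq_intros refl | simp)+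
  qed
  then show ?thesis using equal by (simp add: DERIV_def)
qed

lemma pos_sq_nonneg [simp]: "0 \<le> pos_sq t" by (simp add: pos_sq_def)
lemma pos_sq_zero: "t \<le> 0 \<Longrightarrow> pos_sq t = 0" by (simp add: pos_sq_def)
lemma pos_sq_1 [simp]: "pos_sq 1 = 1" by (simp add: pos_sq_def)
lemma pos_sq_ge1: "1 \<le> t \<Longrightarrow> 1 \<le> pos_sq t" by (simp add: pos_sq_def)

lemma continuous_pos_sq [continuous_intros]: "continuous_on S f \<Longrightarrow> continuous_on S (\<lambda>x. pos_sq (f x))"
  unfolding pos_sq_def by (intro continuous_intros)

lemma subspace_ambient: "subspace (ambient m)"
  using subspace_coord_space[of m] by (auto simp: subspace_def ambient_def zero_prod_def)

locale stationary_graph = lipschitz_graph m u for m and u :: "real ^ 'n \<Rightarrow> fin_seq" +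
  assumes stat: "stationary_varifold (ambient m) CARD('n) (regular_graph u) (tangent_plane u)"
begin

text \<open>
  The graph over a bounded set is bounded. So if the support of \<open>X\<close> is bounded in the base direction only, a cut-off
  in the vertical direction that equals \<open>1\<close> near the graph turns \<open>X\<close> into a test field with the same divergence.
\<close>

lemma stationary_cutoff:
  assumes XA: "\<And>z. z \<in> ambient m \<Longrightarrow> X z \<in> ambient m"
    and der: "\<And>z. (X has_derivative X' z) (at z)"
    and cont: "\<And>v. continuous_on UNIV (\<lambda>z. X' z v)"
    and supp: "\<And>z. \<rho> \<le> norm (fst z - x0) \<Longrightarrow> X z = 0"
    and suppd: "\<And>z v. \<rho> \<le> norm (fst z - x0) \<Longrightarrow> X' z v = 0"
  shows "(\<integral>x. tdiv X' x \<partial>\<mu>) = 0"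
proof -
  have cX: "continuous_on UNIV X"
    using der by (intro continuous_at_imp_continuous_on ballI) (metis has_derivative_continuous)
  have lin: "linear (X' z)" for z using der has_derivative_linear by blast
  obtain R where R: "0 < R" "\<And>x. x \<in> cball x0 \<rho> \<Longrightarrow> norm (u x) < R"
  proof -
    have "bounded (u ` cball x0 \<rho>)"
      using compact_continuous_image[OF continuous_on_subset[OF continuous_u] compact_cball] compact_imp_bounded by blast
    then obtain a where "\<forall>y\<in>u ` cball x0 \<rho>. norm y \<le> a" unfolding bounded_iff by blast
    then show ?thesis using that[of "\<bar>a\<bar> + 1"] by force
  qed
  define c where "c = 1 / R\<^sup>2"
  have c: "0 < c" "c * R\<^sup>2 = 1" using R(1) by (auto simp: c_def)
  define s where "s z = c * (snd z \<bullet> snd z)" for z :: "(real^'n) \<times> fin_seq"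
  define s' where "s' z v = c * (2 * (snd z \<bullet> snd v))" for z v :: "(real^'n) \<times> fin_seq"
  \<comment> \<open>equal to \<open>1\<close> for \<open>t \<le> 1\<close> and to \<open>0\<close> for \<open>t \<ge> 2\<close>\<close>
  define \<theta> where "\<theta> t = pos_sq (1 - pos_sq (t - 1))" for t
  define \<theta>' where "\<theta>' t = 2 * max 0 (1 - pos_sq (t - 1)) * (- (2 * max 0 (t - 1)))" for t
  have ds: "(s has_derivative s' z) (at z)" for z
    unfolding s_def s'_def by (auto intro!: derivative_eq_intros simp: inner_commute)
  have d\<theta>: "(\<theta> has_real_derivative \<theta>' t) (at t)" for t
  proof -
    have "((\<lambda>t. pos_sq (t - 1)) has_real_derivative 2 * max 0 (t - 1) * 1) (at t)"
      by (rule DERIV_chain2[OF pos_sq_deriv]) (auto intro!: derivative_eq_intros)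
    then have "((\<lambda>t. 1 - pos_sq (t - 1)) has_real_derivative - (2 * max 0 (t - 1))) (at t)"
      by (auto intro!: derivative_eq_intros)
    from DERIV_chain2[OF pos_sq_deriv this] show ?thesis unfolding \<theta>_def \<theta>'_def .
  qed
  have dc: "((\<lambda>z. \<theta> (s z)) has_derivative (\<lambda>v. s' z v * \<theta>' (s z))) (at z)" for z
    by (rule DERIV_compose_FDERIV[OF d\<theta> ds])
  define Y where "Y z = \<theta> (s z) *\<^sub>R X z" for z
  define Y' where "Y' z v = \<theta> (s z) *\<^sub>R X' z v + (s' z v * \<theta>' (s z)) *\<^sub>R X z" for z v
  have dY: "(Y has_derivative Y' z) (at z)" for z
    unfolding Y_def Y'_def by (rule has_derivative_scaleR[OF dc der])
  have cs: "continuous_on UNIV s" unfolding s_def by (intro continuous_intros)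
  have cs': "continuous_on UNIV (\<lambda>z. s' z v)" for v unfolding s'_def by (intro continuous_intros)
  have cY: "continuous_on UNIV (\<lambda>z. Y' z v)" for v
    unfolding Y'_def \<theta>_def \<theta>'_def by (intro continuous_intros cont cX cs cs')
  have on_graph: "Y' (gr x) = X' (gr x)" for x
  proof (rule ext)
    fix v
    show "Y' (gr x) v = X' (gr x) v"
    proof (cases "\<rho> \<le> norm (x - x0)")
      case True
      then show ?thesis using supp[of "gr x"] suppd[of "gr x"] by (simp add: Y'_def)
    next
      case False
      then have "norm (u x) < R" by (intro R(2)) (simp add: dist_norm norm_minus_commute)
      then have "(norm (u x))\<^sup>2 \<le> R\<^sup>2" by (intro power_mono) auto
      then have "s (gr x) \<le> c * R\<^sup>2" unfolding s_def power2_norm_eq_inner[symmetric] using c(1) by simp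
      then have "s (gr x) \<le> 1" using c(2) by simp
      then show ?thesis by (simp add: Y'_def \<theta>_def \<theta>'_def pos_sq_zero)
    qed
  qed
  let ?K = "cball x0 \<rho> \<times> (coord_space m \<inter> cball 0 (2 * R))"
  have tf: "test_field (ambient m) Y Y'"
    unfolding test_field_def
  proof (intro conjI ballI)
    show "Y ` ambient m \<subseteq> ambient m"
      unfolding Y_def by (intro image_subsetI subspace_scale[OF subspace_ambient] XA)
    show "(Y has_derivative Y' z) (at z within ambient m)" for z by (rule has_derivative_at_withinI[OF dY])
    show "continuous_on (ambient m) (\<lambda>z. Y' z v)" for v by (rule continuous_on_subset[OF cY]) simp
    show "\<exists>K. compact K \<and> K \<subseteq> ambient m \<and> (\<forall>z\<in>ambient m - K. Y z = 0)"
    proof (intro exI[of _ ?K] conjI ballI)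
      show "compact ?K" by (intro compact_Times compact_cball compact_coord_space_cball)
      show "?K \<subseteq> ambient m" by (auto simp: ambient_def)
      fix z assume z: "z \<in> ambient m - ?K"
      show "Y z = 0"
      proof (cases "\<rho> \<le> norm (fst z - x0)")
        case True
        then show ?thesis using supp by (simp add: Y_def)
      next
        case False
        then have "fst z \<in> cball x0 \<rho>" by (simp add: dist_norm norm_minus_commute)
        then have "2 * R < norm (snd z)" using z by (auto simp: ambient_def mem_Times_iff)
        then have "(2 * R)\<^sup>2 \<le> (norm (snd z))\<^sup>2" using R(1) by (intro power_mono) auto
        then have "c * (2 * R)\<^sup>2 \<le> s z" unfolding s_def power2_norm_eq_inner[symmetric] using c(1) by simp
        then have "4 \<le> s z" using c(2) by (simp add: power_mult_distrib)
        then have "\<theta> (s z) = 0" using pos_sq_ge1[of "s z - 1"] by (simp add: \<theta>_def pos_sq_zero)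
        then show ?thesis by (simp add: Y_def)
      qed
    qed
  qed
  have tY: "indicator \<D> x * tangential_div (Y' (gr x)) (tangent_plane u (gr x)) = tdiv X' x" for x
    by (simp add: tdiv_def tangent_plane_gr on_graph)
  have "(LINT z:gr ` \<D>|H. tangential_div (Y' z) (tangent_plane u z)) = 0"
    using stat tf unfolding stationary_varifold_def regular_graph_eq by blast
  moreover have "(\<lambda>x. indicator \<D> x * tangential_div (Y' (gr x)) (tangent_plane u (gr x))) \<in> borel_measurable borel"
    unfolding tY using measurable_tdiv[OF lin cont] .
  ultimately show ?thesis using integral_graph[where A=\<D> and \<phi>="\<lambda>z. tangential_div (Y' z) (tangent_plane u z)"] unfolding tY by simp
qed

end

section \<open>Area bounds under a bound on the 2-dilation\<close>

text \<open>
  The graph over a slab of a ball of radius \<open>\<rho>\<close>, as cut in the covering lemma below, lies in a ball of radius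
  \<open>slab_const * \<rho>\<close>: \<open>2 \<rho>\<close> from the base, \<open>2 \<rho>\<close> from the direction of largest stretching, \<open>2 \<rho>\<close> from the error of
  the linear approximation, and the rest from the other directions.
\<close>

definition slab_const :: "nat \<Rightarrow> real \<Rightarrow> real" where
  "slab_const n \<Lambda> = 6 + 2 * real n * sqrt \<Lambda>"

definition area_const :: "nat \<Rightarrow> real \<Rightarrow> real" where
  "area_const n \<Lambda> = (5 * slab_const n \<Lambda>) ^ n"

locale dilation_graph = lipschitz_graph m u for m and u :: "real ^ 'n \<Rightarrow> fin_seq" +
  fixes \<Lambda> :: real
  assumes \<Lambda>0: "0 \<le> \<Lambda>"
    and dil: "AE x in lebesgue. u differentiable at x \<longrightarrow> two_dilation (frechet_derivative u (at x)) \<le> \<Lambda>"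
begin

text \<open>
  A measurable function that equals the largest singular value up to a factor between \<open>1\<close> and \<open>n\<close>.
\<close>

definition q :: "real ^ 'n \<Rightarrow> real" where "q x = indicator \<D> x * (\<Sum>i\<in>UNIV. norm (Du x (axis i 1)))"

lemma q_nonneg: "0 \<le> q x" by (auto simp: q_def intro!: mult_nonneg_nonneg sum_nonneg)

lemma measurable_q [measurable]: "q \<in> borel_measurable borel"
proof -
  have "q x = (\<Sum>i\<in>UNIV. sqrt (\<Sum>a<m. (indicator \<D> x * coord (Du x (axis i 1)) a)\<^sup>2))" for x
  proof (cases "x \<in> \<D>")
    case True
    then show ?thesis
      unfolding q_def norm_eq_sqrt_inner by (simp add: inner_coord_space[OF Du_in[OF True]] power2_eq_square)
  qed (simp add: q_def)
  moreover have "(\<lambda>x. \<Sum>i\<in>UNIV. sqrt (\<Sum>a<m. (indicator \<D> x * coord (Du x (axis i 1)) a)\<^sup>2)) \<in> borel_measurable borel"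
  proof -
    have [measurable]: "(\<lambda>x. indicator \<D> x * coord (Du x (axis i 1)) a) \<in> borel_measurable borel" for i a
      by (rule measurable_partial)
    show ?thesis by measurable
  qed
  ultimately show ?thesis by presburger
qed

definition good :: "real ^ 'n \<Rightarrow> bool" where
  "good x \<longleftrightarrow> x \<in> \<D> \<and> two_dilation (Du x) \<le> \<Lambda>"

lemma bad_null: "\<exists>N\<in>null_sets lborel. {x. \<not> good x} \<subseteq> N"
proof -
  have "AE x in lebesgue. x \<in> \<D>"
    using negligible_not_\<D> unfolding negligible_iff_null_sets by (intro AE_I'[of "- \<D>"]) auto
  with dil have "AE x in lebesgue. good x"
    by eventually_elim (auto simp: good_def \<D>_def Du_def)
  then have "AE x in lborel. good x" using AE_completion_iff by blast
  then show ?thesis unfolding eventually_ae_filter by auto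
qed

lemma AE_good: "AE x in \<mu>. good x"
proof -
  obtain N where N: "N \<in> null_sets lborel" "{x. \<not> good x} \<subseteq> N" using bad_null by blast
  have "negligible N" "N \<in> sets borel" using N by (auto simp: negligible_iff_null_sets null_sets_completionI)
  then have "N \<in> null_sets \<mu>" using \<mu>_negligible by auto
  then show ?thesis using N(2) by (intro AE_I'[of N]) auto
qed

text \<open>
  A singular basis with a marked index \<open>k\<close> for the largest singular value: the bound on the 2-dilation leaves
  no other large one.
\<close>

definition singular_frame :: "real ^ 'n \<Rightarrow> ('n \<Rightarrow> real ^ 'n) \<Rightarrow> ('n \<Rightarrow> real) \<Rightarrow> 'n \<Rightarrow> bool" where
  "singular_frame x f l k \<longleftrightarrow> (\<forall>i j. f i \<bullet> f j = (if i = j then 1 else 0)) \<and>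
    (\<forall>i j. Du x (f i) \<bullet> Du x (f j) = (if i = j then (l i)\<^sup>2 else 0)) \<and> (\<forall>i. 0 \<le> l i) \<and>
    (\<forall>i. l i \<le> l k) \<and> (\<forall>i. i \<noteq> k \<longrightarrow> l i * l k \<le> \<Lambda> \<and> l i \<le> sqrt \<Lambda>) \<and>
    l k \<le> q x \<and> q x \<le> real CARD('n) * l k"

lemma singular_frameD:
  assumes sf: "singular_frame x f l k"
  shows "f i \<bullet> f j = (if i = j then 1 else 0)"
    and "Du x (f i) \<bullet> Du x (f j) = (if i = j then (l i)\<^sup>2 else 0)"
    and "0 \<le> l i" and "l i \<le> l k" and "i \<noteq> k \<Longrightarrow> l i * l k \<le> \<Lambda>" and "i \<noteq> k \<Longrightarrow> l i \<le> sqrt \<Lambda>"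
    and "l k \<le> q x" and "q x \<le> real CARD('n) * l k"
proof -
  note c = sf[unfolded singular_frame_def]
  show "f i \<bullet> f j = (if i = j then 1 else 0)" by (rule c[THEN conjunct1, rule_format])
  show "Du x (f i) \<bullet> Du x (f j) = (if i = j then (l i)\<^sup>2 else 0)"
    by (rule c[THEN conjunct2, THEN conjunct1, rule_format])
  note d = c[THEN conjunct2, THEN conjunct2]
  show "0 \<le> l i" "l i \<le> l k" "l k \<le> q x" "q x \<le> real CARD('n) * l k" using d by blast+
  show "l i * l k \<le> \<Lambda>" "l i \<le> sqrt \<Lambda>" if "i \<noteq> k" using d that by blast+
qed

lemma good_singular:
  assumes x: "good x"
  shows "\<exists>f l k. singular_frame x f l k"
proof -
  have D: "x \<in> \<D>" and td: "two_dilation (Du x) \<le> \<Lambda>" using x by (auto simp: good_def)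
  note lin = linear_Du[OF D]
  have bl: "bounded_linear (Du x)" using has_derivative_Du[OF D] has_derivative_bounded_linear by blast
  obtain f :: "'n \<Rightarrow> real ^ 'n" and l where f: "\<And>i j. f i \<bullet> f j = (if i = j then 1 else 0)"
    and Lf: "\<And>i j. Du x (f i) \<bullet> Du x (f j) = (if i = j then (l i)\<^sup>2 else 0)"
    and sv: "singular_values (Du x) l"
    using singular_basis_exists[OF lin] by auto
  have l0: "0 \<le> l i" for i using sv by (simp add: singular_values_def)
  have nf: "norm (f i) = 1" for i using f[of i i] by (simp add: norm_eq_1)
  have nL: "norm (Du x (f i)) = l i" for i using Lf[of i i] l0[of i] by (simp add: norm_eq_sqrt_inner)
  obtain k where k: "\<And>i. l i \<le> l k"
  proof -
    have "Max (range l) \<in> range l" by (intro Max_in) auto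
    then obtain k where "Max (range l) = l k" by (elim rangeE)
    then show ?thesis using that[of k] by (metis Max_ge finite_class.finite_UNIV finite_imageI rangeI)
  qed
  have off: "l i * l k \<le> \<Lambda>" if "i \<noteq> k" for i
    using singular_values_product_le_two_dilation[OF bl sv that] td by simp
  have off2: "l i \<le> sqrt \<Lambda>" if "i \<noteq> k" for i
  proof (rule real_le_rsqrt)
    have "(l i)\<^sup>2 \<le> l i * l k" unfolding power2_eq_square using k[of i] l0[of i] by (rule mult_left_mono)
    then show "(l i)\<^sup>2 \<le> \<Lambda>" using off[OF that] by linarith
  qed
  have q: "q x = (\<Sum>i\<in>UNIV. norm (Du x (axis i 1)))" using D by (simp add: q_def)
  have "l k \<le> q x"
  proof -
    have "Du x (f k) = Du x (\<Sum>i\<in>UNIV. (f k $ i) *\<^sub>R axis i 1)"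
      by (simp add: basis_expansion[of "f k", unfolded scalar_mult_eq_scaleR])
    also have "\<dots> = (\<Sum>i\<in>UNIV. (f k $ i) *\<^sub>R Du x (axis i 1))" by (simp add: linear_sum[OF lin] linear_scale[OF lin])
    also have "norm \<dots> \<le> (\<Sum>i\<in>UNIV. norm (Du x (axis i 1)))"
    proof (rule sum_norm_le)
      fix i show "norm ((f k $ i) *\<^sub>R Du x (axis i 1)) \<le> norm (Du x (axis i 1))"
        using component_le_norm_cart[of "f k" i] nf[of k] by (simp add: mult_left_le_one_le)
    qed
    finally show ?thesis using nL q by simp
  qed
  moreover have "q x \<le> real CARD('n) * l k"
  proof -
    have "norm (Du x (axis i 1)) \<le> l k" for i
    proof -
      have "(norm (Du x (axis i 1)))\<^sup>2 = Du x (\<Sum>j\<in>UNIV. (axis i 1 \<bullet> f j) *\<^sub>R f j) \<bullet> Du x (\<Sum>j\<in>UNIV. (axis i 1 \<bullet> f j) *\<^sub>R f j)"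
        unfolding orthonormal_family_expansion[OF f] by (simp add: power2_norm_eq_inner)
      also have "\<dots> = (\<Sum>j\<in>UNIV. (axis i 1 \<bullet> f j)\<^sup>2 * (l j)\<^sup>2)"
        by (simp add: linear_sum[OF lin] linear_scale[OF lin] inner_sum_left inner_sum_right Lf power2_eq_square
          if_distrib[of "\<lambda>c. _ * c"] mult_ac cong: if_cong)
      also have "\<dots> \<le> (\<Sum>j\<in>UNIV. (axis i 1 \<bullet> f j)\<^sup>2 * (l k)\<^sup>2)"
        using k l0 by (intro sum_mono mult_left_mono power_mono) auto
      also have "\<dots> = (l k)\<^sup>2 * (\<Sum>j\<in>UNIV. (axis i 1 \<bullet> f j)\<^sup>2)" by (simp add: sum_distrib_left mult.commute)
      also have "\<dots> \<le> (l k)\<^sup>2 * 1" using bessel[OF f, of "axis i 1"] by (intro mult_left_mono) (auto simp: inner_axis)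
      finally have "(norm (Du x (axis i 1)))\<^sup>2 \<le> (l k)\<^sup>2" by simp
      then show ?thesis by (rule power2_le_imp_le) (rule l0)
    qed
    then have "q x \<le> (\<Sum>i\<in>(UNIV::'n set). l k)" unfolding q by (intro sum_mono)
    then show ?thesis by simp
  qed
  ultimately show ?thesis
    using f Lf l0 k off off2 unfolding singular_frame_def by (intro exI[of _ f] exI[of _ l] exI[of _ k]) auto
qed

text \<open>
  All singular values but the largest are at most \<open>sqrt \<Lambda>\<close>, so large stretching happens in a single direction \<open>v\<close>.
\<close>

lemma good_slab:
  assumes x: "good x"
  shows "\<exists>v. norm v = 1 \<and> (\<forall>h. norm (Du x h) \<le> q x * \<bar>h \<bullet> v\<bar> + real CARD('n) * sqrt \<Lambda> * norm h)"
proof -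
  have lin: "linear (Du x)" using x linear_Du by (auto simp: good_def)
  obtain f l k where sf: "singular_frame x f l k" using good_singular[OF x] by blast
  note f = singular_frameD(1)[OF sf] and Lf = singular_frameD(2)[OF sf] and l0 = singular_frameD(3)[OF sf]
    and off = singular_frameD(6)[OF sf] and lq = singular_frameD(7)[OF sf]
  have nf: "norm (f i) = 1" for i using f[of i i] by (simp add: norm_eq_1)
  have nL: "norm (Du x (f i)) = l i" for i using Lf[of i i] l0[of i] by (simp add: norm_eq_sqrt_inner)
  have "norm (Du x h) \<le> q x * \<bar>h \<bullet> f k\<bar> + real CARD('n) * sqrt \<Lambda> * norm h" for h
  proof -
    have "Du x h = Du x (\<Sum>j\<in>UNIV. (h \<bullet> f j) *\<^sub>R f j)" unfolding orthonormal_family_expansion[OF f] ..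
    also have "\<dots> = (\<Sum>j\<in>UNIV. (h \<bullet> f j) *\<^sub>R Du x (f j))" by (simp add: linear_sum[OF lin] linear_scale[OF lin])
    also have "norm \<dots> \<le> (\<Sum>j\<in>UNIV. (if j = k then q x * \<bar>h \<bullet> f k\<bar> else 0) + sqrt \<Lambda> * norm h)"
    proof (rule sum_norm_le)
      fix j
      have hj: "\<bar>h \<bullet> f j\<bar> \<le> norm h" using Cauchy_Schwarz_ineq2[of h "f j"] nf by simp
      show "norm ((h \<bullet> f j) *\<^sub>R Du x (f j)) \<le> (if j = k then q x * \<bar>h \<bullet> f k\<bar> else 0) + sqrt \<Lambda> * norm h"
      proof (cases "j = k")
        case True
        have "\<bar>h \<bullet> f k\<bar> * l k \<le> \<bar>h \<bullet> f k\<bar> * q x" using lq by (intro mult_left_mono) auto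
        then show ?thesis using True \<Lambda>0 by (simp add: nL mult.commute add_increasing2)
      next
        case False
        have "\<bar>h \<bullet> f j\<bar> * l j \<le> norm h * sqrt \<Lambda>" using hj off[OF False] l0[of j] by (intro mult_mono) auto
        then show ?thesis using False by (simp add: nL mult.commute)
      qed
    qed
    also have "\<dots> = q x * \<bar>h \<bullet> f k\<bar> + real CARD('n) * sqrt \<Lambda> * norm h" by (simp add: sum.distrib)
    finally show ?thesis .
  qed
  then show ?thesis using nf by blast
qed

lemma slab_const_pos: "0 < slab_const CARD('n) \<Lambda>" using \<Lambda>0 by (simp add: slab_const_def add_pos_nonneg)
lemma area_const_pos: "0 < area_const CARD('n) \<Lambda>" using slab_const_pos by (simp add: area_const_def)

text \<open>
  About \<open>K\<close> slabs perpendicular to the direction \<open>v\<close> of largest stretching cut a ball of radius \<open>\<rho>\<close> into pieces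
  over which the graph has diameter comparable to \<open>\<rho>\<close>. So the cost of the covering is linear in \<open>K\<close>, whereas a
  Lipschitz bound alone would give \<open>K\<^sup>n\<close>.
\<close>

lemma good_local_cover:
  assumes x: "good x" and K: "0 \<le> K" "q x \<le> K"
  shows "\<exists>\<rho>0>0. \<forall>\<rho>. 0 < \<rho> \<longrightarrow> \<rho> < \<rho>0 \<longrightarrow> hausdorff_pre CARD('n) (2 * slab_const CARD('n) \<Lambda> * \<rho>) (gr ` cball x \<rho>)
    \<le> ennreal ((K + 2) * (unit_ball_vol CARD('n) * slab_const CARD('n) \<Lambda> ^ CARD('n)) * \<rho> ^ DIM(real^'n))"
proof -
  let ?n = "CARD('n)"
  have D: "x \<in> \<D>" using x by (simp add: good_def)
  have lin: "linear (Du x)" by (rule linear_Du[OF D])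
  obtain v where v: "norm v = 1" "\<And>h. norm (Du x h) \<le> q x * \<bar>h \<bullet> v\<bar> + real ?n * sqrt \<Lambda> * norm h"
    using good_slab[OF x] by blast
  obtain d where d: "0 < d" "\<And>y. norm (y - x) < d \<Longrightarrow> norm (u y - u x - Du x (y - x)) \<le> 1 * norm (y - x)"
    using has_derivative_Du[OF D] unfolding has_derivative_at_alt by (meson zero_less_one)
  \<comment> \<open>at least \<open>K\<close> slabs, and at least one for \<open>K = 0\<close>\<close>
  define N where "N = nat \<lceil>K\<rceil> + 1"
  have N: "0 < N" "K \<le> real N" "real N \<le> K + 2" using K(1) unfolding N_def by linarith+
  show ?thesis
  proof (intro exI[of _ d] conjI allI impI d(1))
    fix \<rho> assume \<rho>: "0 < \<rho>" "\<rho> < d"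
    define S where "S i = {y \<in> cball x \<rho>. - \<rho> + 2 * \<rho> * real i / real N \<le> (y - x) \<bullet> v \<and>
        (y - x) \<bullet> v \<le> - \<rho> + 2 * \<rho> * (real i + 1) / real N}" for i
    have cover: "cball x \<rho> \<subseteq> (\<Union>i<N. S i)"
    proof
      fix y assume y: "y \<in> cball x \<rho>"
      define t where "t = (y - x) \<bullet> v"
      have "\<bar>t\<bar> \<le> norm (y - x) * norm v" unfolding t_def by (rule Cauchy_Schwarz_ineq2)
      then have t: "- \<rho> \<le> t" "t \<le> \<rho>" using y v(1) by (auto simp: dist_norm norm_minus_commute)
      have tS: "y \<in> S i \<longleftrightarrow> - \<rho> + 2 * \<rho> * real i / real N \<le> t \<and> t \<le> - \<rho> + 2 * \<rho> * (real i + 1) / real N" for i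
        using y by (simp add: S_def t_def)
      show "y \<in> (\<Union>i<N. S i)"
      proof (cases "t = \<rho>")
        case True
        have "y \<in> S (N - 1)" using N(1) \<rho> True unfolding tS by (auto simp: of_nat_diff field_simps)
        then show ?thesis using N(1) by (intro UN_I[of "N - 1"]) auto
      next
        case False
        define s where "s = (t + \<rho>) * real N / (2 * \<rho>)"
        have s: "0 \<le> s" "s < real N" using t False \<rho> N(1) by (auto simp: s_def divide_less_eq mult.commute)
        define i where "i = nat \<lfloor>s\<rfloor>"
        have i: "real i \<le> s" "s \<le> real i + 1" using s(1) by (auto simp: i_def)
        have iN: "i < N" using i(1) s(2) by linarith
        have ts: "t = - \<rho> + 2 * \<rho> * s / real N" using \<rho> N(1) by (simp add: s_def)
        have "2 * \<rho> * real i / real N \<le> 2 * \<rho> * s / real N" "2 * \<rho> * s / real N \<le> 2 * \<rho> * (real i + 1) / real N"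
          using i \<rho> by (auto intro!: divide_right_mono)
        then have "y \<in> S i" unfolding tS ts by simp
        then show ?thesis using iN by blast
      qed
    qed
    have small: "\<exists>z. gr ` S i \<subseteq> cball z (slab_const CARD('n) \<Lambda> * \<rho>)" for i
    proof (cases "S i = {}")
      case False
      then obtain y0 where y0: "y0 \<in> S i" by blast
      have "dist (gr y0) (gr y) \<le> slab_const CARD('n) \<Lambda> * \<rho>" if y: "y \<in> S i" for y
      proof -
        have n: "norm (y - x) \<le> \<rho>" "norm (y0 - x) \<le> \<rho>" using y y0 by (auto simp: S_def dist_norm norm_minus_commute)
        have yy: "norm (y - y0) \<le> 2 * \<rho>" using n norm_triangle_ineq4[of "y - x" "y0 - x"] by simp
        have "\<bar>(y - y0) \<bullet> v\<bar> \<le> 2 * \<rho> / real N"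
        proof -
          have "(y - y0) \<bullet> v = (y - x) \<bullet> v - (y0 - x) \<bullet> v" by (simp add: inner_diff_left)
          moreover have "2 * \<rho> * (real i + 1) / real N = 2 * \<rho> * real i / real N + 2 * \<rho> / real N"
            by (simp add: add_divide_distrib distrib_left)
          ultimately show ?thesis using y y0 unfolding S_def abs_le_iff by auto
        qed
        then have "q x * \<bar>(y - y0) \<bullet> v\<bar> \<le> real N * (2 * \<rho> / real N)"
          using K N by (intro mult_mono) auto
        then have 1: "q x * \<bar>(y - y0) \<bullet> v\<bar> \<le> 2 * \<rho>" using N(1) by simp
        have 2: "real ?n * sqrt \<Lambda> * norm (y - y0) \<le> real ?n * sqrt \<Lambda> * (2 * \<rho>)"
          using yy \<Lambda>0 by (intro mult_left_mono) auto
        have 3: "norm (u y - u x - Du x (y - x)) \<le> \<rho>" "norm (u y0 - u x - Du x (y0 - x)) \<le> \<rho>"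
          using d(2)[of y] d(2)[of y0] n \<rho> by auto
        have "u y - u y0 = (u y - u x - Du x (y - x)) - (u y0 - u x - Du x (y0 - x)) + Du x (y - y0)"
          by (simp add: linear_diff[OF lin])
        also have "norm \<dots> \<le> norm (u y - u x - Du x (y - x)) + norm (u y0 - u x - Du x (y0 - x)) + norm (Du x (y - y0))"
          using norm_triangle_ineq norm_triangle_ineq4 by (meson add_right_mono order_trans)
        also have "\<dots> \<le> \<rho> + \<rho> + (2 * \<rho> + real ?n * sqrt \<Lambda> * (2 * \<rho>))"
          using v(2)[of "y - y0"] 1 2 3 by linarith
        finally have uu: "norm (u y - u y0) \<le> 4 * \<rho> + real ?n * sqrt \<Lambda> * (2 * \<rho>)" by simp
        have "dist (gr y0) (gr y) \<le> dist y0 y + dist (u y0) (u y)"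
          unfolding gr_def dist_Pair_Pair by (rule sqrt_sum_squares_le_sum) auto
        also have "\<dots> \<le> 2 * \<rho> + (4 * \<rho> + real ?n * sqrt \<Lambda> * (2 * \<rho>))"
          using yy uu by (intro add_mono) (simp_all add: dist_norm norm_minus_commute)
        also have "\<dots> = slab_const CARD('n) \<Lambda> * \<rho>" by (simp add: slab_const_def algebra_simps)
        finally show ?thesis .
      qed
      then show ?thesis by (intro exI[of _ "gr y0"]) auto
    qed simp
    have "gr ` cball x \<rho> \<subseteq> (\<Union>i<N. gr ` S i)" using cover by blast
    then have "hausdorff_pre ?n (2 * (slab_const CARD('n) \<Lambda> * \<rho>)) (gr ` cball x \<rho>)
        \<le> ennreal (real N * (unit_ball_vol ?n * (slab_const CARD('n) \<Lambda> * \<rho>) ^ ?n))"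
      using small slab_const_pos \<rho> by (intro hausdorff_pre_le_cballs) auto
    also have "\<dots> \<le> ennreal ((K + 2) * (unit_ball_vol ?n * slab_const CARD('n) \<Lambda> ^ ?n) * \<rho> ^ DIM(real^'n))"
    proof (rule ennreal_leI)
      have "real N * (unit_ball_vol ?n * (slab_const CARD('n) \<Lambda> * \<rho>) ^ ?n) \<le> (K + 2) * (unit_ball_vol ?n * (slab_const CARD('n) \<Lambda> * \<rho>) ^ ?n)"
        using N slab_const_pos \<rho> by (intro mult_right_mono) auto
      then show "real N * (unit_ball_vol ?n * (slab_const CARD('n) \<Lambda> * \<rho>) ^ ?n) \<le> (K + 2) * (unit_ball_vol ?n * slab_const CARD('n) \<Lambda> ^ ?n) * \<rho> ^ DIM(real^'n)"
        by (simp add: power_mult_distrib mult_ac)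
    qed
    finally show "hausdorff_pre ?n (2 * slab_const CARD('n) \<Lambda> * \<rho>) (gr ` cball x \<rho>)
      \<le> ennreal ((K + 2) * (unit_ball_vol ?n * slab_const CARD('n) \<Lambda> ^ ?n) * \<rho> ^ DIM(real^'n))" by (simp add: mult.assoc)
  qed
qed

lemma area_bound:
  assumes A: "A \<in> sets borel" and K: "0 \<le> K" "\<And>x. x \<in> A \<Longrightarrow> q x \<le> K"
  shows "emeasure \<mu> A \<le> ennreal (area_const CARD('n) \<Lambda> * (K + 2)) * emeasure lborel A"
proof -
  let ?n = "CARD('n)"
  obtain N where N: "N \<in> null_sets lborel" "{x. \<not> good x} \<subseteq> N" using bad_null by blast
  have Nn: "negligible N" "N \<in> sets borel" using N by (auto simp: negligible_iff_null_sets null_sets_completionI)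
  let ?c = "(K + 2) * (unit_ball_vol ?n * slab_const CARD('n) \<Lambda> ^ ?n)"
  have "emeasure \<mu> A \<le> emeasure \<mu> ((A - N) \<union> N)" using A Nn by (intro emeasure_mono) auto
  also have "\<dots> = emeasure \<mu> (A - N)"
    using A Nn \<mu>_negligible[OF Nn] by (intro emeasure_Un_null_set) (auto intro!: null_setsI)
  also have "\<dots> = hausdorff_outer ?n (gr ` (A - N))" using A Nn by (intro emeasure_\<mu>) auto
  also have "\<dots> \<le> ennreal (?c * 5 ^ DIM(real^'n) / unit_ball_vol DIM(real^'n)) * emeasure lebesgue (A - N)"
  proof (rule hausdorff_outer_image_le)
    show "A - N \<in> sets lebesgue" using A Nn by auto
    show "0 \<le> ?c" using K slab_const_pos by auto
    show "0 < 2 * slab_const CARD('n) \<Lambda>" using slab_const_pos by simp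
    fix x assume "x \<in> A - N"
    then show "\<exists>\<rho>0>0. \<forall>\<rho>. 0 < \<rho> \<longrightarrow> \<rho> < \<rho>0 \<longrightarrow>
        hausdorff_pre ?n (2 * slab_const CARD('n) \<Lambda> * \<rho>) (gr ` cball x \<rho>) \<le> ennreal (?c * \<rho> ^ DIM(real^'n))"
      using N(2) K by (intro good_local_cover) auto
  qed
  also have "?c * 5 ^ DIM(real^'n) / unit_ball_vol DIM(real^'n) = area_const CARD('n) \<Lambda> * (K + 2)"
    using unit_ball_vol_pos[of "real ?n"] by (simp add: area_const_def power_mult_distrib less_imp_neq[THEN not_sym])
  also have "emeasure lebesgue (A - N) \<le> emeasure lborel A"
    using A Nn by (simp, intro emeasure_mono) auto
  finally show ?thesis by (simp add: mult_left_mono)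
qed

text \<open>
  Apply the area bound on the sets where \<open>q\<close> has a given integer part.
\<close>

lemma area_weighted:
  assumes A: "A \<in> sets borel"
  shows "(\<integral>\<^sup>+x. ennreal (1 / (1 + q x)) * indicator A x \<partial>\<mu>) \<le> ennreal (3 * area_const CARD('n) \<Lambda>) * emeasure lborel A"
proof -
  define B where "B j = {x \<in> A. real j \<le> q x \<and> q x < real j + 1}" for j :: nat
  have Bb: "B j \<in> sets borel" for j unfolding B_def using A by measurable
  have UB: "A = (\<Union>j. B j)"
  proof
    show "A \<subseteq> (\<Union>j. B j)"
    proof
      fix x assume x: "x \<in> A"
      have "x \<in> B (nat \<lfloor>q x\<rfloor>)" using x q_nonneg[of x] by (auto simp: B_def)
      then show "x \<in> (\<Union>j. B j)" by blast
    qed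
  qed (auto simp: B_def)
  have dB: "disjoint_family B"
    unfolding disjoint_family_on_def
  proof (intro ballI impI)
    fix i j :: nat assume "i \<noteq> j"
    then show "B i \<inter> B j = {}" by (auto simp: B_def)
  qed
  have "(\<integral>\<^sup>+x. ennreal (1 / (1 + q x)) * indicator A x \<partial>\<mu>) \<le> (\<integral>\<^sup>+x. (\<Sum>j. ennreal (1 / (1 + real j)) * indicator (B j) x) \<partial>\<mu>)"
  proof (rule nn_integral_mono)
    fix x
    show "ennreal (1 / (1 + q x)) * indicator A x \<le> (\<Sum>j. ennreal (1 / (1 + real j)) * indicator (B j) x)"
    proof (cases "x \<in> A")
      case True
      then obtain j where j: "x \<in> B j" using UB by blast
      have "ennreal (1 / (1 + q x)) * indicator A x \<le> ennreal (1 / (1 + real j)) * indicator (B j) x"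
        using True j q_nonneg[of x] by (auto simp: B_def intro!: ennreal_leI divide_left_mono)
      also have "\<dots> \<le> (\<Sum>j. ennreal (1 / (1 + real j)) * indicator (B j) x)"
      proof -
        define g where "g j = ennreal (1 / (1 + real j)) * indicator (B j) x" for j
        have "g j \<le> suminf g" using sum_le_suminf[of g "{j}"] by simp
        then show ?thesis unfolding g_def .
      qed
      finally show ?thesis .
    qed simp
  qed
  also have "\<dots> = (\<Sum>j. (\<integral>\<^sup>+x. ennreal (1 / (1 + real j)) * indicator (B j) x \<partial>\<mu>))"
    using Bb by (intro nn_integral_suminf) auto
  also have "\<dots> = (\<Sum>j. ennreal (1 / (1 + real j)) * emeasure \<mu> (B j))"
    using Bb by (intro suminf_cong) (simp add: nn_integral_cmult)
  also have "\<dots> \<le> (\<Sum>j. ennreal (3 * area_const CARD('n) \<Lambda>) * emeasure lborel (B j))"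
  proof (intro suminf_le allI)
    fix j :: nat
    have "emeasure \<mu> (B j) \<le> ennreal (area_const CARD('n) \<Lambda> * ((real j + 1) + 2)) * emeasure lborel (B j)"
      by (rule area_bound[OF Bb]) (auto simp: B_def)
    then have "ennreal (1 / (1 + real j)) * emeasure \<mu> (B j) \<le>
        ennreal (1 / (1 + real j)) * (ennreal (area_const CARD('n) \<Lambda> * ((real j + 1) + 2)) * emeasure lborel (B j))"
      by (rule mult_left_mono) simp
    also have "\<dots> = ennreal (1 / (1 + real j) * (area_const CARD('n) \<Lambda> * ((real j + 1) + 2))) * emeasure lborel (B j)"
      using area_const_pos by (subst ennreal_mult) (simp_all only: mult.assoc, auto)
    also have "\<dots> \<le> ennreal (3 * area_const CARD('n) \<Lambda>) * emeasure lborel (B j)"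
    proof (intro mult_right_mono ennreal_leI)
      have "((real j + 1) + 2) / (1 + real j) \<le> 3" by (simp add: divide_le_eq)
      then have "area_const CARD('n) \<Lambda> * (((real j + 1) + 2) / (1 + real j)) \<le> area_const CARD('n) \<Lambda> * 3"
        using area_const_pos by (intro mult_left_mono) auto
      then show "1 / (1 + real j) * (area_const CARD('n) \<Lambda> * ((real j + 1) + 2)) \<le> 3 * area_const CARD('n) \<Lambda>" by (simp add: mult.commute)
    qed simp
    finally show "ennreal (1 / (1 + real j)) * emeasure \<mu> (B j) \<le> ennreal (3 * area_const CARD('n) \<Lambda>) * emeasure lborel (B j)" .
  qed auto
  also have "\<dots> = ennreal (3 * area_const CARD('n) \<Lambda>) * (\<Sum>j. emeasure lborel (B j))" by simp
  also have "(\<Sum>j. emeasure lborel (B j)) = emeasure lborel A"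
    unfolding UB using Bb dB by (intro suminf_emeasure) auto
  finally show ?thesis .
qed

end

section \<open>Euclidean volume growth\<close>

definition first_variation_const :: "nat \<Rightarrow> real \<Rightarrow> real" where
  "first_variation_const n \<Lambda> = real n * (2 * real n + sqrt \<Lambda> + real n * \<Lambda>)"

definition volume_const :: "nat \<Rightarrow> real \<Rightarrow> real" where
  "volume_const n \<Lambda> = (96 * first_variation_const n \<Lambda> * area_const n \<Lambda> + 6 * real n * area_const n \<Lambda>) * 2 ^ n"

context lipschitz_graph
begin

lemma tdiv_cong_sum:
  assumes "\<And>z v. X' z v = P' z v + Q' z v" "\<And>z. linear (P' z)" "\<And>z. linear (Q' z)" "\<And>z. linear (X' z)"
  shows "tdiv X' x = tdiv P' x + tdiv Q' x"
proof (cases "x \<in> \<D>")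
  case True
  obtain e :: "'n \<Rightarrow> (real ^ 'n) \<times> fin_seq" where
    e: "\<And>X'. linear (X' (gr x)) \<Longrightarrow> tdiv X' x = (\<Sum>i\<in>UNIV. X' (gr x) (e i) \<bullet> e i)"
    using tdiv_family[OF True] by blast
  show ?thesis unfolding e[of X', OF assms(4)] e[of P', OF assms(2)] e[of Q', OF assms(3)] assms(1)
    by (simp only: inner_add_left sum.distrib)
qed (simp add: tdiv_def)

end

locale minimal_dilation_graph = dilation_graph m u \<Lambda> + stationary_graph m u
  for m and u :: "real ^ 'n \<Rightarrow> fin_seq" and \<Lambda>
begin

lemma fvc_nonneg: "0 \<le> first_variation_const CARD('n) \<Lambda>" using \<Lambda>0 by (simp add: first_variation_const_def)

text \<open>
  Multiplied by \<open>1 + q\<close>, that is by the area element up to constants, each term stays bounded: for the largest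
  singular value because \<open>t (1 + t) \<le> 2 (1 + t\<^sup>2)\<close>, for the others because \<open>l i * l k \<le> \<Lambda>\<close>.
\<close>

lemma frame_sum_bound:
  assumes sf: "singular_frame x f l k"
  shows "(\<Sum>i\<in>UNIV. l i / (1 + (l i)\<^sup>2)) \<le> first_variation_const CARD('n) \<Lambda> / (1 + q x)"
proof -
  note l0 = singular_frameD(3)[OF sf] and off = singular_frameD(5,6)[OF sf] and ql = singular_frameD(8)[OF sf]
  have p: "0 < 1 + (l i)\<^sup>2" for i by (simp add: add_pos_nonneg)
  have q1: "0 < 1 + q x" using q_nonneg[of x] by simp
  let ?n = "real CARD('n)"
  have n1: "1 \<le> ?n" using zero_less_card_finite[where 'a='n] by simp
  let ?C = "2 * ?n + sqrt \<Lambda> + ?n * \<Lambda>"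
  have one: "l i / (1 + (l i)\<^sup>2) \<le> ?C / (1 + q x)" for i
  proof -
    have "(1 + q x) * l i \<le> ?C * (1 + (l i)\<^sup>2)"
    proof (cases "i = k")
      case True
      have "1 + q x \<le> ?n + ?n * l k" using ql n1 by linarith
      then have "(1 + q x) * l k \<le> (?n + ?n * l k) * l k" using l0[of k] by (rule mult_right_mono)
      also have "\<dots> = ?n * (l k + (l k)\<^sup>2)" by (simp add: algebra_simps power2_eq_square)
      also have "l k + (l k)\<^sup>2 \<le> 2 * (1 + (l k)\<^sup>2)"
      proof -
        have "l k \<le> 2 * l k" using l0[of k] by simp
        also have "\<dots> \<le> 1 + (l k)\<^sup>2" using sum_squares_bound[of 1 "l k"] by simp
        finally show ?thesis by simp
      qed
      then have "?n * (l k + (l k)\<^sup>2) \<le> ?n * (2 * (1 + (l k)\<^sup>2))" by (rule mult_left_mono) simp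
      also have "\<dots> = 2 * ?n * (1 + (l k)\<^sup>2)" by simp
      also have "\<dots> \<le> ?C * (1 + (l k)\<^sup>2)" using \<Lambda>0 by (intro mult_right_mono) auto
      finally show ?thesis using True by simp
    next
      case False
      have "q x * l i \<le> ?n * l k * l i" using ql l0[of i] by (rule mult_right_mono)
      also have "\<dots> = ?n * (l i * l k)" by simp
      also have "\<dots> \<le> ?n * \<Lambda>" using off(1)[OF False] by (intro mult_left_mono) auto
      finally have "q x * l i \<le> ?n * \<Lambda>" .
      moreover have "(1 + q x) * l i = l i + q x * l i" by (simp add: distrib_right)
      ultimately have "(1 + q x) * l i \<le> sqrt \<Lambda> + ?n * \<Lambda>" using off(2)[OF False] by simp
      also have "\<dots> \<le> ?C * 1" by simp
      finally have "(1 + q x) * l i \<le> ?C * 1" .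
      also have "\<dots> \<le> ?C * (1 + (l i)\<^sup>2)" using \<Lambda>0 by (intro mult_left_mono) auto
      finally show ?thesis .
    qed
    then show ?thesis using p[of i] q1 by (simp add: divide_le_eq le_divide_eq mult.commute)
  qed
  have "(\<Sum>i\<in>UNIV. l i / (1 + (l i)\<^sup>2)) \<le> (\<Sum>i\<in>(UNIV :: 'n set). ?C / (1 + q x))" by (intro sum_mono one)
  then show ?thesis by (simp add: first_variation_const_def)
qed

text \<open>
  Stationarity is tested with \<open>X = \<eta> \<psi>\<close>, where \<open>\<eta>\<close> cuts off in the base and \<open>\<psi>\<close> is a bounded vertical field, the gradient
  of the convex function \<open>r\<^sup>2 sqrt (1 + |y - y0|\<^sup>2 / r\<^sup>2)\<close>. The derivative of \<open>\<psi>\<close> contributes \<open>P \<ge> 0\<close>, which on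
  the set \<open>W\<close> in question is at least \<open>2 l\<^sup>2 / (1 + l\<^sup>2)\<close> for the largest singular value \<open>l\<close>. The derivative of
  \<open>\<eta>\<close> contributes \<open>Q\<close>, of size at most a constant times \<open>1 / (1 + q)\<close>, whose integral is controlled by the
  Lebesgue measure of the base. As \<open>\<integral> P = - \<integral> Q\<close> and \<open>1 \<le> P + 2 n / (1 + q)\<close> on \<open>W\<close>, the area of \<open>W\<close> is bounded.
\<close>

theorem volume_bound:
  fixes y0 :: fin_seq and x0 :: "real ^ 'n"
  assumes y0: "y0 \<in> coord_space m" and r: "0 < r"
  shows "emeasure \<mu> {x. norm (x - x0) < r \<and> norm (u x - y0) < r}
    \<le> ennreal (volume_const CARD('n) \<Lambda> * unit_ball_vol CARD('n) * r ^ CARD('n))"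
proof -
  let ?n = "real CARD('n)"
  define a where "a = 1 / r\<^sup>2"
  have a: "0 < a" "a * r\<^sup>2 = 1" using r by (auto simp: a_def)
  define \<eta> where "\<eta> x = pos_sq (4 - a * ((x - x0) \<bullet> (x - x0)))" for x
  define \<eta>' where "\<eta>' x v = - (a * (2 * ((x - x0) \<bullet> v))) * (2 * max 0 (4 - a * ((x - x0) \<bullet> (x - x0))))" for x v
  define w where "w y = 1 + a * ((y - y0) \<bullet> (y - y0))" for y
  define \<psi> where "\<psi> y = (1 / sqrt (w y)) *\<^sub>R (y - y0)" for y
  define \<psi>' where "\<psi>' y k = (1 / sqrt (w y)) *\<^sub>R k - (a * ((y - y0) \<bullet> k) / (w y * sqrt (w y))) *\<^sub>R (y - y0)" for y k
  define X where "X z = (0 :: real^'n, \<eta> (fst z) *\<^sub>R \<psi> (snd z))" for z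
  define P' where "P' z v = (0 :: real^'n, \<eta> (fst z) *\<^sub>R \<psi>' (snd z) (snd v))" for z v :: "(real^'n) \<times> fin_seq"
  define Q' where "Q' z v = (0 :: real^'n, \<eta>' (fst z) (fst v) *\<^sub>R \<psi> (snd z))" for z v :: "(real^'n) \<times> fin_seq"
  define X' where "X' z v = P' z v + Q' z v" for z v
  have w1: "1 \<le> w y" for y using a by (simp add: w_def)
  have w0: "0 < w y" for y using w1[of y] by linarith
  have sw: "0 < sqrt (w y)" for y using w0 by simp
  have d\<eta>: "(\<eta> has_derivative \<eta>' x) (at x)" for x
  proof -
    have "((\<lambda>x. 4 - a * ((x - x0) \<bullet> (x - x0))) has_derivative (\<lambda>v. - (a * (2 * ((x - x0) \<bullet> v))))) (at x)"
      by (auto intro!: derivative_eq_intros simp: inner_commute)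
    from DERIV_compose_FDERIV[OF pos_sq_deriv this] show ?thesis unfolding \<eta>_def \<eta>'_def .
  qed
  have dw: "(w has_derivative (\<lambda>k. a * (2 * ((y - y0) \<bullet> k)))) (at y)" for y
    unfolding w_def by (auto intro!: derivative_eq_intros simp: inner_commute)
  have d\<psi>: "(\<psi> has_derivative \<psi>' y) (at y)" for y
  proof -
    have "((\<lambda>t. 1 / sqrt t) has_real_derivative - (1 / (2 * w y * sqrt (w y)))) (at (w y))"
      using w0[of y] by (auto intro!: derivative_eq_intros simp: field_simps power2_eq_square)
    from DERIV_compose_FDERIV[OF this dw]
    have "((\<lambda>y. 1 / sqrt (w y)) has_derivative (\<lambda>k. a * (2 * ((y - y0) \<bullet> k)) * - (1 / (2 * w y * sqrt (w y))))) (at y)" .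
    then have "((\<lambda>y. 1 / sqrt (w y)) has_derivative (\<lambda>k. - (a * ((y - y0) \<bullet> k) / (w y * sqrt (w y))))) (at y)"
      by (simp add: mult_ac)
    then have "(\<psi> has_derivative (\<lambda>k. (1 / sqrt (w y)) *\<^sub>R k + (- (a * ((y - y0) \<bullet> k) / (w y * sqrt (w y)))) *\<^sub>R (y - y0))) (at y)"
      unfolding \<psi>_def by (rule has_derivative_scaleR) (auto intro!: derivative_eq_intros)
    then show ?thesis unfolding \<psi>'_def by simp
  qed
  have dX: "(X has_derivative X' z) (at z)" for z
  proof -
    have 1: "((\<lambda>z. \<eta> (fst z)) has_derivative (\<lambda>v. \<eta>' (fst z) (fst v))) (at z)"
      by (rule has_derivative_compose[OF has_derivative_fst[OF has_derivative_ident] d\<eta>])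
    have 2: "((\<lambda>z. \<psi> (snd z)) has_derivative (\<lambda>v. \<psi>' (snd z) (snd v))) (at z)"
      by (rule has_derivative_compose[OF has_derivative_snd[OF has_derivative_ident] d\<psi>])
    show ?thesis unfolding X_def X'_def P'_def Q'_def
      using has_derivative_Pair[OF has_derivative_const[of "0::real^'n"] has_derivative_scaleR[OF 1 2]] by simp
  qed
  have cw: "continuous_on UNIV w" unfolding w_def by (intro continuous_intros)
  have c\<eta>: "continuous_on UNIV \<eta>" unfolding \<eta>_def by (intro continuous_intros)
  have c\<eta>': "continuous_on UNIV (\<lambda>x. \<eta>' x v)" for v unfolding \<eta>'_def by (intro continuous_intros)
  have c\<psi>: "continuous_on UNIV \<psi>" unfolding \<psi>_def by (intro continuous_intros cw) (simp add: less_imp_neq[OF w0, THEN not_sym])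
  have c\<psi>': "continuous_on UNIV (\<lambda>y. \<psi>' y k)" for k
    unfolding \<psi>'_def using sw w0 by (intro continuous_intros cw) (auto simp: less_imp_neq[THEN not_sym])
  have cP: "continuous_on UNIV (\<lambda>z. P' z v)" for v
    unfolding P'_def
    by (intro continuous_intros continuous_on_compose2[OF c\<eta>] continuous_on_compose2[OF c\<psi>']) auto
  have cQ: "continuous_on UNIV (\<lambda>z. Q' z v)" for v
    unfolding Q'_def
    by (intro continuous_intros continuous_on_compose2[OF c\<eta>'] continuous_on_compose2[OF c\<psi>]) auto
  have linP: "linear (P' z)" for z
    using has_derivative_linear[OF d\<psi>, of "snd z"]
    by (intro linearI) (simp_all add: P'_def linear_add linear_scale scaleR_add_right)
  have linQ: "linear (Q' z)" for z
    using has_derivative_linear[OF d\<eta>, of "fst z"]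
    by (intro linearI) (simp_all add: Q'_def linear_add linear_scale scaleR_add_left)
  have linX: "linear (X' z)" for z using dX has_derivative_linear by blast
  have cX': "continuous_on UNIV (\<lambda>z. X' z v)" for v unfolding X'_def by (intro continuous_intros cP cQ)
  have far: "4 - a * ((x - x0) \<bullet> (x - x0)) \<le> 0" if "2 * r \<le> norm (x - x0)" for x
  proof -
    have "(2 * r)\<^sup>2 \<le> (norm (x - x0))\<^sup>2" using that r by (intro power_mono) auto
    then have "a * (2 * r)\<^sup>2 \<le> a * (norm (x - x0))\<^sup>2" using a(1) by simp
    then show ?thesis using a(2) by (simp add: power2_norm_eq_inner power_mult_distrib)
  qed
  have supp: "\<eta> x = 0" "\<eta>' x v = 0" if "2 * r \<le> norm (x - x0)" for x v
    using far[OF that] by (simp_all add: \<eta>_def \<eta>'_def pos_sq_zero)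
  have XA: "X z \<in> ambient m" if "z \<in> ambient m" for z
    using that y0 subspace_coord_space[of m] by (auto simp: X_def ambient_def \<psi>_def subspace_scale subspace_diff)
  have int0: "(\<integral>x. tdiv X' x \<partial>\<mu>) = 0"
    by (rule stationary_cutoff[OF XA dX cX', of "2 * r" x0])
      (auto simp: X_def X'_def P'_def Q'_def supp zero_prod_def)
  have iP: "integrable \<mu> (tdiv P')"
    by (rule integrable_tdiv[OF linP cP, of "2 * r" x0]) (simp add: P'_def supp zero_prod_def)
  have iQ: "integrable \<mu> (tdiv Q')"
    by (rule integrable_tdiv[OF linQ cQ, of "2 * r" x0]) (simp add: Q'_def supp zero_prod_def)
  have split: "tdiv X' x = tdiv P' x + tdiv Q' x" for x
    by (rule tdiv_cong_sum[OF X'_def linP linQ linX])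
  have PQ: "(\<integral>x. tdiv P' x \<partial>\<mu>) = - (\<integral>x. tdiv Q' x \<partial>\<mu>)"
    using int0 iP iQ unfolding split by simp
  have \<psi>'k: "\<psi>' y k \<bullet> k \<ge> (k \<bullet> k) / (w y * sqrt (w y))" for y k
  proof -
    have "((y - y0) \<bullet> k)\<^sup>2 \<le> ((y - y0) \<bullet> (y - y0)) * (k \<bullet> k)" by (rule Cauchy_Schwarz_ineq)
    then have "a * ((y - y0) \<bullet> k)\<^sup>2 \<le> a * (((y - y0) \<bullet> (y - y0)) * (k \<bullet> k))" using a(1) by simp
    then have "k \<bullet> k \<le> w y * (k \<bullet> k) - a * ((y - y0) \<bullet> k)\<^sup>2" by (simp add: w_def algebra_simps)
    then have "(k \<bullet> k) / (w y * sqrt (w y)) \<le> (w y * (k \<bullet> k) - a * ((y - y0) \<bullet> k)\<^sup>2) / (w y * sqrt (w y))"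
      using w0[of y] sw[of y] by (intro divide_right_mono) auto
    also have "\<dots> = \<psi>' y k \<bullet> k"
      using w0[of y] by (simp add: \<psi>'_def inner_diff_left diff_divide_distrib power2_eq_square)
    finally show ?thesis .
  qed
  have P0: "0 \<le> tdiv P' x" for x
  proof (cases "x \<in> \<D>")
    case True
    obtain e :: "'n \<Rightarrow> (real ^ 'n) \<times> fin_seq" where e: "tdiv P' x = (\<Sum>i\<in>UNIV. P' (gr x) (e i) \<bullet> e i)"
      using tdiv_family[OF True] linP by blast
    show ?thesis unfolding e
    proof (rule sum_nonneg)
      fix i
      have "0 \<le> (snd (e i) \<bullet> snd (e i)) / (w (u x) * sqrt (w (u x)))" using w0 by (simp add: less_imp_le)
      then have "0 \<le> \<psi>' (u x) (snd (e i)) \<bullet> snd (e i)" using \<psi>'k order_trans by blast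
      then show "0 \<le> P' (gr x) (e i) \<bullet> e i" by (simp add: P'_def inner_prod_def \<eta>_def)
    qed
  qed (simp add: tdiv_def)
  have n\<psi>: "norm (\<psi> y) \<le> r" for y
  proof -
    have "(norm (y - y0))\<^sup>2 = r\<^sup>2 * (a * (norm (y - y0))\<^sup>2)" using a(2) by (simp add: mult.assoc[symmetric] mult.commute)
    also have "\<dots> \<le> r\<^sup>2 * w y" by (intro mult_left_mono) (auto simp: w_def power2_norm_eq_inner)
    finally have "(norm (y - y0))\<^sup>2 \<le> (r * sqrt (w y))\<^sup>2" using w0[of y] by (simp add: power_mult_distrib)
    then have "norm (y - y0) \<le> r * sqrt (w y)"
      by (rule power2_le_imp_le) (use r w0[of y] in simp)
    then show ?thesis using sw[of y] by (simp add: \<psi>_def divide_le_eq)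
  qed
  have n\<eta>': "\<bar>\<eta>' x v\<bar> \<le> 32 / r * norm v" for x v
  proof (cases "2 * r \<le> norm (x - x0)")
    case True
    then show ?thesis using supp r by simp
  next
    case False
    have 1: "0 \<le> a * ((x - x0) \<bullet> (x - x0))" using a by simp
    have "\<bar>(x - x0) \<bullet> v\<bar> \<le> norm (x - x0) * norm v" by (rule Cauchy_Schwarz_ineq2)
    also have "\<dots> \<le> 2 * r * norm v" using False by (intro mult_right_mono) auto
    finally have 2: "\<bar>(x - x0) \<bullet> v\<bar> \<le> 2 * r * norm v" .
    have "\<bar>\<eta>' x v\<bar> = (a * (2 * \<bar>(x - x0) \<bullet> v\<bar>)) * (2 * max 0 (4 - a * ((x - x0) \<bullet> (x - x0))))"
      using a(1) by (simp add: \<eta>'_def abs_mult)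
    also have "\<dots> \<le> (a * (2 * (2 * r * norm v))) * (2 * 4)"
      using a(1) 1 2 r by (intro mult_mono mult_left_mono) auto
    also have "\<dots> = 32 / r * norm v" using r by (simp add: a_def power2_eq_square)
    finally show ?thesis .
  qed
  define B where "B = ball x0 (2 * r)"
  define W where "W = {x. norm (x - x0) < r \<and> norm (u x - y0) < r}"
  have Wb [measurable]: "W \<in> sets borel"
    unfolding W_def by (intro borel_open open_Collect_conj open_Collect_less continuous_intros continuous_u)
  have Bb [measurable]: "B \<in> sets borel" by (simp add: B_def)
  have WB: "W \<subseteq> B" using r by (auto simp: W_def B_def dist_norm norm_minus_commute)
  have Qle: "\<bar>tdiv Q' x\<bar> \<le> 32 * first_variation_const CARD('n) \<Lambda> * (1 / (1 + q x)) * indicator B x" if x: "good x" for x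
  proof (cases "x \<in> B")
    case False
    then have "2 * r \<le> norm (x - x0)" by (simp add: B_def dist_norm norm_minus_commute)
    then have z: "Q' (gr x) v = 0" for v by (simp add: Q'_def supp zero_prod_def)
    have D: "x \<in> \<D>" using x by (simp add: good_def)
    obtain e :: "'n \<Rightarrow> (real ^ 'n) \<times> fin_seq" where e: "tdiv Q' x = (\<Sum>i\<in>UNIV. Q' (gr x) (e i) \<bullet> e i)"
      using tdiv_family[OF D] linQ by blast
    show ?thesis unfolding e z using False by simp
  next
    case True
    have D: "x \<in> \<D>" using x by (simp add: good_def)
    obtain f l k where sf: "singular_frame x f l k" using good_singular[OF x] by blast
    note f = singular_frameD(1)[OF sf] and Lf = singular_frameD(2)[OF sf] and l0 = singular_frameD(3)[OF sf]
      and ql = singular_frameD(8)[OF sf]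
    have nf: "norm (f i) = 1" for i using f[of i i] by (simp add: norm_eq_1)
    have nL: "norm (Du x (f i)) = l i" for i using Lf[of i i] l0[of i] by (simp add: norm_eq_sqrt_inner)
    have "tdiv Q' x = (\<Sum>i\<in>UNIV. (Q' (gr x) (f i, Du x (f i)) \<bullet> (f i, Du x (f i))) / (1 + (l i)\<^sup>2))"
      using D tangential_div_singular[OF linear_Du[OF D] linQ f Lf] by (simp add: tdiv_def)
    also have "\<bar>\<dots>\<bar> \<le> (\<Sum>i\<in>UNIV. 32 * (l i / (1 + (l i)\<^sup>2)))"
    proof (rule order_trans[OF sum_abs], rule sum_mono)
      fix i
      have "\<bar>Q' (gr x) (f i, Du x (f i)) \<bullet> (f i, Du x (f i))\<bar> = \<bar>\<eta>' x (f i)\<bar> * \<bar>\<psi> (u x) \<bullet> Du x (f i)\<bar>"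
        by (simp add: Q'_def inner_prod_def abs_mult)
      also have "\<dots> \<le> (32 / r * norm (f i)) * (r * l i)"
      proof (intro mult_mono n\<eta>')
        have "\<bar>\<psi> (u x) \<bullet> Du x (f i)\<bar> \<le> norm (\<psi> (u x)) * norm (Du x (f i))" by (rule Cauchy_Schwarz_ineq2)
        also have "\<dots> \<le> r * l i" unfolding nL using n\<psi> l0[of i] by (intro mult_right_mono)
        finally show "\<bar>\<psi> (u x) \<bullet> Du x (f i)\<bar> \<le> r * l i" .
      qed (use r in auto)
      also have "\<dots> = 32 * l i" using r nf by simp
      finally have "\<bar>Q' (gr x) (f i, Du x (f i)) \<bullet> (f i, Du x (f i))\<bar> \<le> 32 * l i" .
      moreover have "0 < 1 + (l i)\<^sup>2" by (simp add: add_pos_nonneg)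
      ultimately show "\<bar>Q' (gr x) (f i, Du x (f i)) \<bullet> (f i, Du x (f i)) / (1 + (l i)\<^sup>2)\<bar> \<le> 32 * (l i / (1 + (l i)\<^sup>2))"
        by (simp add: abs_divide divide_right_mono)
    qed
    also have "\<dots> = 32 * (\<Sum>i\<in>UNIV. l i / (1 + (l i)\<^sup>2))" by (simp add: sum_distrib_left)
    also have "\<dots> \<le> 32 * (first_variation_const CARD('n) \<Lambda> / (1 + q x))" using frame_sum_bound[OF sf] by simp
    finally show ?thesis using True by simp
  qed
  have Ple: "1 \<le> tdiv P' x + 2 * ?n * (1 / (1 + q x))" if x: "good x" and W: "x \<in> W" for x
  proof -
    have D: "x \<in> \<D>" using x by (simp add: good_def)
    obtain f l k where sf: "singular_frame x f l k" using good_singular[OF x] by blast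
    note f = singular_frameD(1)[OF sf] and Lf = singular_frameD(2)[OF sf] and l0 = singular_frameD(3)[OF sf]
      and ql = singular_frameD(8)[OF sf]
    have p: "0 < 1 + (l i)\<^sup>2" for i by (simp add: add_pos_nonneg)
    have "(norm (x - x0))\<^sup>2 \<le> r\<^sup>2" "(norm (u x - y0))\<^sup>2 \<le> r\<^sup>2" using W by (auto simp: W_def intro!: power_mono)
    then have "a * (norm (x - x0))\<^sup>2 \<le> a * r\<^sup>2" "a * (norm (u x - y0))\<^sup>2 \<le> a * r\<^sup>2" using a(1) by simp_all
    then have s: "a * ((x - x0) \<bullet> (x - x0)) \<le> 1" "w (u x) \<le> 2" using a(2) by (simp_all add: power2_norm_eq_inner w_def)
    have "3\<^sup>2 \<le> (max 0 (4 - a * ((x - x0) \<bullet> (x - x0))))\<^sup>2" using s(1) by (intro power_mono) auto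
    then have \<eta>9: "8 \<le> \<eta> x" by (simp add: \<eta>_def pos_sq_def)
    have ww: "w (u x) * sqrt (w (u x)) \<le> 4"
    proof -
      have "sqrt (w (u x)) \<le> w (u x)" using w1[of "u x"] by (intro real_le_lsqrt) (auto simp: power2_eq_square)
      then have "w (u x) * sqrt (w (u x)) \<le> 2 * 2" using s(2) w0[of "u x"] by (intro mult_mono) auto
      then show ?thesis by simp
    qed
    have ge: "2 * (l i)\<^sup>2 \<le> P' (gr x) (f i, Du x (f i)) \<bullet> (f i, Du x (f i))" for i
    proof -
      have "(l i)\<^sup>2 / 4 \<le> (l i)\<^sup>2 / (w (u x) * sqrt (w (u x)))"
        using ww w0[of "u x"] by (intro divide_left_mono) auto
      also have "\<dots> \<le> \<psi>' (u x) (Du x (f i)) \<bullet> Du x (f i)" using \<psi>'k[of "Du x (f i)" "u x"] by (simp add: Lf)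
      finally have "8 * ((l i)\<^sup>2 / 4) \<le> \<eta> x * (\<psi>' (u x) (Du x (f i)) \<bullet> Du x (f i))"
        using \<eta>9 by (intro mult_mono) auto
      then show ?thesis by (simp add: P'_def inner_prod_def)
    qed
    have "2 * (l k)\<^sup>2 / (1 + (l k)\<^sup>2) \<le> (P' (gr x) (f k, Du x (f k)) \<bullet> (f k, Du x (f k))) / (1 + (l k)\<^sup>2)"
      using ge[of k] p[of k] by (intro divide_right_mono) auto
    also have "\<dots> \<le> (\<Sum>i\<in>UNIV. (P' (gr x) (f i, Du x (f i)) \<bullet> (f i, Du x (f i))) / (1 + (l i)\<^sup>2))"
      using order_trans[OF _ ge] p by (intro member_le_sum) (auto simp: less_imp_le intro!: divide_nonneg_nonneg)
    also have "\<dots> = tdiv P' x" using D tangential_div_singular[OF linear_Du[OF D] linP f Lf] by (simp add: tdiv_def)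
    finally have PP: "2 * (l k)\<^sup>2 / (1 + (l k)\<^sup>2) \<le> tdiv P' x" .
    show ?thesis
    proof (cases "1 \<le> l k")
      case True
      then have "1 \<le> (l k)\<^sup>2" by simp
      then have "1 \<le> 2 * (l k)\<^sup>2 / (1 + (l k)\<^sup>2)" by simp
      moreover have "0 \<le> 2 * ?n * (1 / (1 + q x))" using q_nonneg[of x] by simp
      ultimately show ?thesis using PP by linarith
    next
      case False
      have n1: "1 \<le> ?n" using zero_less_card_finite[where 'a='n] by simp
      have "?n * l k \<le> ?n * 1" using False by (intro mult_left_mono) auto
      then have "1 + q x \<le> 2 * ?n" using ql n1 by linarith
      then have "1 \<le> 2 * ?n * (1 / (1 + q x))" using q_nonneg[of x] by simp
      then show ?thesis using P0[of x] by linarith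
    qed
  qed
  have mP: "tdiv P' \<in> borel_measurable borel" by (rule measurable_tdiv[OF linP cP])
  have wq: "(\<integral>\<^sup>+x. ennreal (1 / (1 + q x)) * indicator B x \<partial>\<mu>) \<le> ennreal (3 * area_const CARD('n) \<Lambda>) * emeasure lborel B"
    by (rule area_weighted[OF Bb])
  have "(\<integral>\<^sup>+x. ennreal (tdiv P' x) \<partial>\<mu>) = ennreal (\<integral>x. tdiv P' x \<partial>\<mu>)"
    using iP P0 by (intro nn_integral_eq_integral) auto
  also have "\<dots> \<le> ennreal (\<integral>x. \<bar>tdiv Q' x\<bar> \<partial>\<mu>)"
    unfolding PQ using integral_abs_bound[of \<mu> "tdiv Q'"] by (intro ennreal_leI) linarith
  also have "\<dots> = (\<integral>\<^sup>+x. ennreal \<bar>tdiv Q' x\<bar> \<partial>\<mu>)"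
    using iQ by (intro nn_integral_eq_integral[symmetric]) auto
  also have "\<dots> \<le> (\<integral>\<^sup>+x. ennreal (32 * first_variation_const CARD('n) \<Lambda>) * (ennreal (1 / (1 + q x)) * indicator B x) \<partial>\<mu>)"
  proof (rule nn_integral_mono_AE)
    show "AE x in \<mu>. ennreal \<bar>tdiv Q' x\<bar> \<le> ennreal (32 * first_variation_const CARD('n) \<Lambda>) * (ennreal (1 / (1 + q x)) * indicator B x)"
      using AE_good
    proof eventually_elim
      case (elim x)
      have "ennreal \<bar>tdiv Q' x\<bar> \<le> ennreal (32 * first_variation_const CARD('n) \<Lambda> * (1 / (1 + q x)) * indicator B x)"
        using Qle[OF elim] by (rule ennreal_leI)
      also have "\<dots> = ennreal (32 * first_variation_const CARD('n) \<Lambda>) * (ennreal (1 / (1 + q x)) * indicator B x)"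
        using fvc_nonneg q_nonneg[of x] by (auto simp: indicator_def ennreal_mult'[symmetric])
      finally show ?case .
    qed
  qed
  also have "\<dots> = ennreal (32 * first_variation_const CARD('n) \<Lambda>) * (\<integral>\<^sup>+x. ennreal (1 / (1 + q x)) * indicator B x \<partial>\<mu>)"
    by (rule nn_integral_cmult) (simp cong: measurable_cong_sets)
  finally have PI: "(\<integral>\<^sup>+x. ennreal (tdiv P' x) \<partial>\<mu>) \<le>
      ennreal (32 * first_variation_const CARD('n) \<Lambda>) * (\<integral>\<^sup>+x. ennreal (1 / (1 + q x)) * indicator B x \<partial>\<mu>)" .
  have "emeasure \<mu> W = (\<integral>\<^sup>+x. indicator W x \<partial>\<mu>)" by simp
  also have "\<dots> \<le> (\<integral>\<^sup>+x. ennreal (tdiv P' x) + ennreal (2 * ?n) * (ennreal (1 / (1 + q x)) * indicator B x) \<partial>\<mu>)"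
  proof (rule nn_integral_mono_AE)
    show "AE x in \<mu>. indicator W x \<le> ennreal (tdiv P' x) + ennreal (2 * ?n) * (ennreal (1 / (1 + q x)) * indicator B x)"
      using AE_good
    proof eventually_elim
      case (elim x)
      show ?case
      proof (cases "x \<in> W")
        case True
        have "ennreal 1 \<le> ennreal (tdiv P' x + 2 * ?n * (1 / (1 + q x)))" using Ple[OF elim True] by (rule ennreal_leI)
        also have "\<dots> = ennreal (tdiv P' x) + ennreal (2 * ?n) * ennreal (1 / (1 + q x))"
          using P0[of x] q_nonneg[of x] by (subst ennreal_plus) (auto simp: ennreal_mult'[symmetric])
        finally show ?thesis using True WB by (auto simp: indicator_def)
      qed simp
    qed
  qed
  also have "\<dots> = (\<integral>\<^sup>+x. ennreal (tdiv P' x) \<partial>\<mu>) + ennreal (2 * ?n) * (\<integral>\<^sup>+x. ennreal (1 / (1 + q x)) * indicator B x \<partial>\<mu>)"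
    using mP by (subst nn_integral_add) (auto simp: nn_integral_cmult cong: measurable_cong_sets)
  also have "\<dots> \<le> ennreal (32 * first_variation_const CARD('n) \<Lambda>) * (\<integral>\<^sup>+x. ennreal (1 / (1 + q x)) * indicator B x \<partial>\<mu>) +
      ennreal (2 * ?n) * (\<integral>\<^sup>+x. ennreal (1 / (1 + q x)) * indicator B x \<partial>\<mu>)"
    by (rule add_right_mono[OF PI])
  also have "ennreal (32 * first_variation_const CARD('n) \<Lambda>) * (\<integral>\<^sup>+x. ennreal (1 / (1 + q x)) * indicator B x \<partial>\<mu>) +
      ennreal (2 * ?n) * (\<integral>\<^sup>+x. ennreal (1 / (1 + q x)) * indicator B x \<partial>\<mu>)
      = ennreal (32 * first_variation_const CARD('n) \<Lambda> + 2 * ?n) * (\<integral>\<^sup>+x. ennreal (1 / (1 + q x)) * indicator B x \<partial>\<mu>)"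
    using fvc_nonneg by (subst ennreal_plus) (auto simp: distrib_right)
  also have "\<dots> \<le> ennreal (32 * first_variation_const CARD('n) \<Lambda> + 2 * ?n) * (ennreal (3 * area_const CARD('n) \<Lambda>) * emeasure lborel B)"
    by (intro mult_left_mono wq) simp
  also have "emeasure lborel B = ennreal (unit_ball_vol CARD('n) * (2 * r) ^ CARD('n))"
    using r by (simp add: B_def emeasure_ball)
  also have "ennreal (32 * first_variation_const CARD('n) \<Lambda> + 2 * ?n) * (ennreal (3 * area_const CARD('n) \<Lambda>) * ennreal (unit_ball_vol CARD('n) * (2 * r) ^ CARD('n)))
      = ennreal ((32 * first_variation_const CARD('n) \<Lambda> + 2 * ?n) * (3 * area_const CARD('n) \<Lambda> * (unit_ball_vol CARD('n) * (2 * r) ^ CARD('n))))"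
  proof -
    have "0 \<le> 32 * first_variation_const CARD('n) \<Lambda> + 2 * ?n" "0 \<le> 3 * area_const CARD('n) \<Lambda>" "0 \<le> unit_ball_vol CARD('n) * (2 * r) ^ CARD('n)"
      using fvc_nonneg area_const_pos r by simp_all
    then show ?thesis by (simp only: ennreal_mult mult_nonneg_nonneg)
  qed
  also have "(32 * first_variation_const CARD('n) \<Lambda> + 2 * ?n) * (3 * area_const CARD('n) \<Lambda> * (unit_ball_vol CARD('n) * (2 * r) ^ CARD('n)))
      = volume_const CARD('n) \<Lambda> * unit_ball_vol CARD('n) * r ^ CARD('n)"
    by (simp add: volume_const_def algebra_simps power_mult_distrib)
  finally show ?thesis unfolding W_def .
qed

end

section \<open>The mean value inequality\<close>

definition density_const :: "nat \<Rightarrow> real" where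
  "density_const n = unit_ball_vol n / (2 * 2 ^ n)"

definition mean_value_const :: "nat \<Rightarrow> real" where
  "mean_value_const n = 8 * (2 * sqrt 2) ^ n / density_const n"

context stationary_graph
begin

lemma integrable_continuous_bounded:
  fixes \<phi> :: "real ^ 'n \<Rightarrow> real"
  assumes \<phi>: "continuous_on UNIV \<phi>" and S: "bounded S" "S \<in> sets borel"
  shows "integrable \<mu> (\<lambda>x. indicator S x * \<phi> x)"
proof -
  obtain R where R: "S \<subseteq> cball 0 R" using S(1) by (auto simp: bounded_iff subset_eq)
  have "bounded (\<phi> ` cball 0 R)"
    using compact_continuous_image[OF continuous_on_subset[OF \<phi>] compact_cball] compact_imp_bounded by blast
  then obtain K where K: "\<And>x. x \<in> cball 0 R \<Longrightarrow> norm (\<phi> x) \<le> K" unfolding bounded_iff by blast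
  show ?thesis
  proof (rule integrableI_bounded_set[where A=S and B=K])
    show "S \<in> sets \<mu>" using S by simp
    have "(\<lambda>x. indicator S x * \<phi> x) \<in> borel_measurable borel"
      using S borel_measurable_continuous_onI[OF \<phi>] by measurable
    then show "(\<lambda>x. indicator S x * \<phi> x) \<in> borel_measurable \<mu>" by (simp cong: measurable_cong_sets)
    show "emeasure \<mu> S < \<infinity>" using \<mu>_bounded_finite[OF S] by simp
    have "norm (indicator S x * \<phi> x) \<le> K" if "x \<in> S" for x using K[of x] R that by auto
    then show "AE x in \<mu>. x \<in> S \<longrightarrow> norm (indicator S x * \<phi> x) \<le> K" by (intro AE_I2 impI)
  qed auto
qed

definition near :: "(real ^ 'n) \<times> fin_seq \<Rightarrow> real \<Rightarrow> (real ^ 'n) set" where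
  "near z \<rho> = {x. dist (gr x) z < \<rho>}"

lemma open_near: "open (near z \<rho>)"
  unfolding near_def by (intro open_Collect_less continuous_intros continuous_gr)

lemma bounded_near: "bounded (near z \<rho>)"
proof (rule bounded_subset[OF bounded_ball[of "fst z" \<rho>]])
  show "near z \<rho> \<subseteq> ball (fst z) \<rho>"
  proof
    fix x assume "x \<in> near z \<rho>"
    then show "x \<in> ball (fst z) \<rho>" using dist_fst_le[of "gr x" z] by (simp add: near_def dist_commute)
  qed
qed

lemma near_borel [measurable]: "near z \<rho> \<in> sets borel" by (rule borel_open[OF open_near])

text \<open>
  The square of an affine function \<open>f\<close> is subharmonic on the graph. The test field is
  \<open>G(s) f\<^sup>2 (z - z0) + 2 H(s) f v\<close> with \<open>s = |z - z0|\<^sup>2\<close> and \<open>v\<close> the gradient of \<open>f\<close>. The choice \<open>H' = - G / 2\<close> makes the mixed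
  terms cancel in its divergence. What remains, besides the positive term \<open>2 H |v\<^sup>T|\<^sup>2\<close>, is
  \<open>(n G + 2 G' |(z - z0)\<^sup>T|\<^sup>2) f\<^sup>2\<close>, where \<open>\<^sup>T\<close> is the tangential part, and \<open>|(z - z0)\<^sup>T|\<^sup>2 \<le> s\<close> while \<open>G' \<le> 0\<close>.
\<close>

lemma stationary_weighted:
  fixes v z0 :: "(real ^ 'n) \<times> fin_seq" and G G' :: "real \<Rightarrow> real" and c0 \<delta> \<rho> :: real
  assumes v: "v \<in> ambient m" and z0: "z0 \<in> ambient m" and \<delta>: "0 < \<delta>" and \<rho>: "0 < \<rho>"
    and G: "\<And>s. - \<delta> < s \<Longrightarrow> (G has_real_derivative G' s) (at s)"
    and cG': "continuous_on {- \<delta><..} G'"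
    and G0: "\<And>s. 0 \<le> G s" and G'0: "\<And>s. 0 \<le> s \<Longrightarrow> G' s \<le> 0"
    and supp: "\<And>s. \<rho>\<^sup>2 \<le> s \<Longrightarrow> G s = 0" "\<And>s. \<rho>\<^sup>2 \<le> s \<Longrightarrow> G' s = 0"
  defines "f \<equiv> \<lambda>z. v \<bullet> z + c0" and "s \<equiv> \<lambda>z. (z - z0) \<bullet> (z - z0)"
  shows "(\<integral>x. indicator (near z0 \<rho>) x *
    ((real CARD('n) * G (s (gr x)) + 2 * s (gr x) * G' (s (gr x))) * (f (gr x))\<^sup>2) \<partial>\<mu>) \<le> 0"
proof -
  have cG: "continuous_on {- \<delta><..} G"
    using G by (intro continuous_at_imp_continuous_on ballI DERIV_isCont) auto
  \<comment> \<open>an antiderivative of \<open>G\<close> that starts left of \<open>0\<close>, to be differentiable from both sides at \<open>0\<close>\<close>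
  define a where "a = - \<delta> / 2"
  define I where "I s = integral {a..s} G" for s
  have cGi: "continuous_on {a..t} G" for t by (rule continuous_on_subset[OF cG]) (use \<delta> in \<open>auto simp: a_def\<close>)
  have dI: "(I has_real_derivative G t) (at t)" if "0 \<le> t" for t
  proof -
    have "((\<lambda>x. integral {a..x} G) has_real_derivative G t) (at t within {a..t + 1})"
      using that \<delta> by (intro integral_has_real_derivative cGi) (auto simp: a_def)
    moreover have "at t within {a..t + 1} = at t" using that \<delta> by (intro at_within_interior) (auto simp: a_def)
    ultimately show ?thesis unfolding I_def by simp
  qed
  define Hs where "Hs t = (I (\<rho>\<^sup>2) - I t) / 2" for t
  have dH: "(Hs has_real_derivative - G t / 2) (at t)" if "0 \<le> t" for t
    unfolding Hs_def using dI[OF that] by (auto intro!: derivative_eq_intros)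
  have intG: "G integrable_on {a..t}" for t by (rule integrable_continuous_real[OF cGi])
  have H0: "0 \<le> Hs t" if t: "0 \<le> t" "t \<le> \<rho>\<^sup>2" for t
  proof -
    have "integral {a..t} G + integral {t..\<rho>\<^sup>2} G = integral {a..\<rho>\<^sup>2} G"
      using t \<delta> by (intro Henstock_Kurzweil_Integration.integral_combine intG) (auto simp: a_def)
    moreover have "0 \<le> integral {t..\<rho>\<^sup>2} G"
    proof (rule integral_nonneg)
      show "G integrable_on {t..\<rho>\<^sup>2}"
        using t \<delta> by (intro integrable_continuous_real continuous_on_subset[OF cG]) auto
    qed (use G0 in auto)
    ultimately show ?thesis by (simp add: Hs_def I_def)
  qed
  have Hsupp: "Hs t = 0" if t: "\<rho>\<^sup>2 \<le> t" for t
  proof -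
    have r0: "0 \<le> \<rho>\<^sup>2" by simp
    have "integral {a..\<rho>\<^sup>2} G + integral {\<rho>\<^sup>2..t} G = integral {a..t} G"
      using t \<delta> r0 by (intro Henstock_Kurzweil_Integration.integral_combine intG) (auto simp: a_def intro: order_trans[OF _ r0])
    moreover have "integral {\<rho>\<^sup>2..t} G = integral {\<rho>\<^sup>2..t} (\<lambda>_. 0)" by (rule integral_cong) (use supp in auto)
    ultimately show ?thesis by (simp add: Hs_def I_def)
  qed
  have H00: "0 \<le> Hs t" if "0 \<le> t" for t using H0[OF that] Hsupp[of t] by (cases "t \<le> \<rho>\<^sup>2") auto
  have s0: "0 \<le> s z" for z by (simp add: s_def)
  define X where "X z = (G (s z) * (f z)\<^sup>2) *\<^sub>R (z - z0) + (2 * Hs (s z) * f z) *\<^sub>R v" for z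
  define X' where "X' z b = (G (s z) * (f z)\<^sup>2) *\<^sub>R b
      + (2 * ((z - z0) \<bullet> b) * G' (s z) * (f z)\<^sup>2 + G (s z) * (2 * f z * (v \<bullet> b))) *\<^sub>R (z - z0)
      + (- (2 * ((z - z0) \<bullet> b) * G (s z) * f z) + 2 * Hs (s z) * (v \<bullet> b)) *\<^sub>R v" for z b
  have ds: "(s has_derivative (\<lambda>b. 2 * ((z - z0) \<bullet> b))) (at z)" for z
    unfolding s_def by (auto intro!: derivative_eq_intros simp: inner_commute)
  have df: "(f has_derivative (\<lambda>b. v \<bullet> b)) (at z)" for z
    unfolding f_def by (auto intro!: derivative_eq_intros)
  have dGs: "((\<lambda>z. G (s z)) has_derivative (\<lambda>b. 2 * ((z - z0) \<bullet> b) * G' (s z))) (at z)" for z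
    using DERIV_compose_FDERIV[OF G ds] s0[of z] \<delta> by simp
  have dHs: "((\<lambda>z. Hs (s z)) has_derivative (\<lambda>b. 2 * ((z - z0) \<bullet> b) * (- G (s z) / 2))) (at z)" for z
    by (rule DERIV_compose_FDERIV[OF dH[OF s0] ds])
  have dX: "(X has_derivative X' z) (at z)" for z
    unfolding X_def
    by (rule has_derivative_eq_rhs, (rule derivative_intros dGs dHs df)+)
      (simp add: X'_def fun_eq_iff algebra_simps power2_eq_square)
  have csz: "continuous_on UNIV s" unfolding s_def by (intro continuous_intros)
  have cfz: "continuous_on UNIV f" unfolding f_def by (intro continuous_intros)
  have cGs: "continuous_on UNIV (\<lambda>z. G (s z))"
    using s0 \<delta> by (intro continuous_on_compose2[OF cG csz]) (auto intro: less_le_trans[of _ 0])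
  have cG's: "continuous_on UNIV (\<lambda>z. G' (s z))"
    using s0 \<delta> by (intro continuous_on_compose2[OF cG' csz]) (auto intro: less_le_trans[of _ 0])
  have cHs: "continuous_on UNIV (\<lambda>z. Hs (s z))"
    using dHs by (intro continuous_at_imp_continuous_on ballI) (metis has_derivative_continuous)
  have cX': "continuous_on UNIV (\<lambda>z. X' z b)" for b
    unfolding X'_def by (intro continuous_intros cGs cG's cHs cfz)
  have linX: "linear (X' z)" for z using dX has_derivative_linear by blast
  have far: "\<rho>\<^sup>2 \<le> s z" if "\<rho> \<le> norm (fst z - fst z0)" for z
  proof -
    have "\<rho> \<le> norm (z - z0)" using that dist_fst_le[of z z0] by (simp add: dist_norm)
    then have "\<rho>\<^sup>2 \<le> (norm (z - z0))\<^sup>2" using \<rho> by (intro power_mono) auto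
    then show ?thesis by (simp add: s_def power2_norm_eq_inner)
  qed
  have X0: "X z = 0" if "\<rho>\<^sup>2 \<le> s z" for z using supp(1)[OF that] Hsupp[OF that] by (simp add: X_def)
  have X'0: "X' z b = 0" if "\<rho>\<^sup>2 \<le> s z" for z b
    using supp[OF that] Hsupp[OF that] by (simp add: X'_def)
  have XA: "X z \<in> ambient m" if "z \<in> ambient m" for z
    unfolding X_def by (intro subspace_add[OF subspace_ambient] subspace_scale[OF subspace_ambient] subspace_diff[OF subspace_ambient] v z0 that)
  have int0: "(\<integral>x. tdiv X' x \<partial>\<mu>) = 0"
    by (rule stationary_cutoff[OF XA dX cX', of \<rho> "fst z0"]) (use far X0 X'0 in blast)+
  have iX: "integrable \<mu> (tdiv X')"
  proof (rule integrable_tdiv[OF linX cX', of \<rho> "fst z0"])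
    show "X' (gr x) b = 0" if "\<rho> \<le> norm (x - fst z0)" for x b
      using that by (intro X'0 far) simp
  qed
  let ?n = "real CARD('n)"
  define K where "K x = (?n * G (s (gr x)) + 2 * s (gr x) * G' (s (gr x))) * (f (gr x))\<^sup>2" for x
  have cK: "continuous_on UNIV K"
    unfolding K_def
    by (intro continuous_intros continuous_on_compose2[OF cGs continuous_gr] continuous_on_compose2[OF cG's continuous_gr]
      continuous_on_compose2[OF csz continuous_gr] continuous_on_compose2[OF cfz continuous_gr]) auto
  have iK: "integrable \<mu> (\<lambda>x. indicator (near z0 \<rho>) x * K x)"
    by (rule integrable_continuous_bounded[OF cK bounded_near near_borel])
  have K0: "K x = 0" if "x \<notin> near z0 \<rho>" for x
  proof -
    have "\<rho> \<le> norm (gr x - z0)" using that by (simp add: near_def dist_norm)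
    then have "\<rho>\<^sup>2 \<le> (norm (gr x - z0))\<^sup>2" using \<rho> by (intro power_mono) auto
    then have "\<rho>\<^sup>2 \<le> s (gr x)" by (simp add: s_def power2_norm_eq_inner)
    then show ?thesis using supp by (simp add: K_def)
  qed
  have le: "indicator (near z0 \<rho>) x * K x \<le> tdiv X' x" if D: "x \<in> \<D>" for x
  proof -
    obtain e :: "'n \<Rightarrow> (real ^ 'n) \<times> fin_seq" where on: "\<And>i j. e i \<bullet> e j = (if i = j then 1 else 0)"
      and e: "tdiv X' x = (\<Sum>i\<in>UNIV. X' (gr x) (e i) \<bullet> e i)"
      using tdiv_family[OF D] linX by blast
    let ?z = "gr x"
    have "X' ?z b \<bullet> b = G (s ?z) * (f ?z)\<^sup>2 * (b \<bullet> b) + 2 * G' (s ?z) * (f ?z)\<^sup>2 * ((?z - z0) \<bullet> b)\<^sup>2 + 2 * Hs (s ?z) * (v \<bullet> b)\<^sup>2" for b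
      by (simp only: X'_def inner_add_left inner_scaleR_left) (simp add: algebra_simps power2_eq_square)
    then have "tdiv X' x = (\<Sum>i\<in>UNIV. G (s ?z) * (f ?z)\<^sup>2 * (e i \<bullet> e i) + 2 * G' (s ?z) * (f ?z)\<^sup>2 * ((?z - z0) \<bullet> e i)\<^sup>2
        + 2 * Hs (s ?z) * (v \<bullet> e i)\<^sup>2)" unfolding e by (intro sum.cong refl)
    also have "\<dots> = ?n * (G (s ?z) * (f ?z)\<^sup>2) + 2 * G' (s ?z) * (f ?z)\<^sup>2 * (\<Sum>i\<in>UNIV. ((?z - z0) \<bullet> e i)\<^sup>2)
        + 2 * Hs (s ?z) * (\<Sum>i\<in>UNIV. (v \<bullet> e i)\<^sup>2)"
      by (simp add: sum.distrib sum_distrib_left on)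
    finally have eq: "tdiv X' x = ?n * (G (s ?z) * (f ?z)\<^sup>2) + 2 * G' (s ?z) * (f ?z)\<^sup>2 * (\<Sum>i\<in>UNIV. ((?z - z0) \<bullet> e i)\<^sup>2)
        + 2 * Hs (s ?z) * (\<Sum>i\<in>UNIV. (v \<bullet> e i)\<^sup>2)" .
    have "(\<Sum>i\<in>UNIV. ((?z - z0) \<bullet> e i)\<^sup>2) \<le> s ?z" unfolding s_def by (rule bessel[OF on])
    moreover have "2 * G' (s ?z) * (f ?z)\<^sup>2 \<le> 0" using G'0[OF s0, of ?z] by (simp add: mult_nonpos_nonneg)
    ultimately have "2 * G' (s ?z) * (f ?z)\<^sup>2 * s ?z \<le> 2 * G' (s ?z) * (f ?z)\<^sup>2 * (\<Sum>i\<in>UNIV. ((?z - z0) \<bullet> e i)\<^sup>2)"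
      by (rule mult_left_mono_neg)
    moreover have "0 \<le> 2 * Hs (s ?z) * (\<Sum>i\<in>UNIV. (v \<bullet> e i)\<^sup>2)"
      using H00[OF s0, of ?z] by (intro mult_nonneg_nonneg sum_nonneg) auto
    moreover have "K x = ?n * (G (s ?z) * (f ?z)\<^sup>2) + 2 * G' (s ?z) * (f ?z)\<^sup>2 * s ?z"
      by (simp add: K_def algebra_simps)
    ultimately have "K x \<le> tdiv X' x" unfolding eq by linarith
    moreover have "indicator (near z0 \<rho>) x * K x = K x" using K0[of x] by (cases "x \<in> near z0 \<rho>") auto
    ultimately show ?thesis by (simp only:)
  qed
  have "(\<integral>x. indicator (near z0 \<rho>) x * K x \<partial>\<mu>) \<le> (\<integral>x. tdiv X' x \<partial>\<mu>)"
    using AE_\<mu>_\<D> by (intro integral_mono_AE iK iX) (auto elim!: eventually_mono intro: le)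
  then show ?thesis unfolding int0 K_def .
qed

end

lemma square_powr:
  assumes "0 < t"
  shows "(t\<^sup>2) powr (- (real n / 2)) = 1 / t ^ n"
proof -
  have "t\<^sup>2 = t powr 2" using assms by (simp add: powr_realpow)
  then have "(t\<^sup>2) powr (- (real n / 2)) = t powr (- real n)" by (simp add: powr_powr)
  also have "\<dots> = 1 / t ^ n" using assms by (simp add: powr_minus_divide powr_realpow)
  finally show ?thesis .
qed

context stationary_graph
begin

definition energy :: "(real ^ 'n) \<times> fin_seq \<Rightarrow> real \<Rightarrow> (real ^ 'n \<Rightarrow> real) \<Rightarrow> real" where
  "energy z \<rho> \<phi> = (\<integral>x. indicator (near z \<rho>) x * \<phi> x \<partial>\<mu>)"

text \<open>
  The weight \<open>G\<close> is a \<open>C\<^sup>1\<close> truncation at level \<open>t0\<close> of \<open>g(s) = (s + \<sigma>\<^sup>2)\<^sup>-\<^sup>n\<^sup>/\<^sup>2\<close>, a regularised \<open>|z - z0|\<^sup>-\<^sup>n\<close>: with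
  \<open>\<theta>(t) = (t - t0)\<^sup>2 / t\<close> for \<open>t > t0\<close> it is \<open>\<theta>(g)\<close>. Then \<open>n G + 2 s G'\<close> is at least \<open>- 2 n t0\<close>, of order \<open>- \<rho>\<^sup>-\<^sup>n\<close>,
  everywhere, and of order \<open>\<sigma>\<^sup>-\<^sup>n\<close> where \<open>s < \<sigma>\<^sup>2\<close>.
\<close>

lemma energy_decay:
  fixes v z0 :: "(real ^ 'n) \<times> fin_seq" and c0 \<sigma> \<rho> :: real
  assumes v: "v \<in> ambient m" and z0: "z0 \<in> ambient m" and \<sigma>: "0 < \<sigma>" "3 * \<sigma> \<le> \<rho>"
  defines "\<phi> \<equiv> \<lambda>x. (v \<bullet> gr x + c0)\<^sup>2"
  shows "energy z0 \<sigma> \<phi> \<le> 8 * (sqrt 2 * \<sigma>) ^ CARD('n) / \<rho> ^ CARD('n) * energy z0 \<rho> \<phi>"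
proof -
  let ?n = "real CARD('n)"
  have n1: "1 \<le> ?n" using zero_less_card_finite[where 'a='n] by simp
  have \<rho>: "0 < \<rho>" using \<sigma> by simp
  define g where "g s = (s + \<sigma>\<^sup>2) powr (- (?n / 2))" for s
  define t0 where "t0 = g (\<rho>\<^sup>2)"
  define g' where "g' s = - (?n / 2) * (g s / (s + \<sigma>\<^sup>2))" for s
  define G where "G s = pos_sq (g s - t0) / g s" for s
  define G' where "G' s = (2 * max 0 (g s - t0) * g s - pos_sq (g s - t0)) / (g s)\<^sup>2 * g' s" for s
  have \<sigma>2: "0 < \<sigma>\<^sup>2" using \<sigma> by simp
  have gpos: "0 < g s" if "- \<sigma>\<^sup>2 < s" for s using that by (simp add: g_def)
  have t0: "0 < t0" unfolding t0_def using \<sigma>2 by (intro gpos) (simp add: less_le_trans[of _ 0])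
  have dg: "(g has_real_derivative g' s) (at s)" if "- \<sigma>\<^sup>2 < s" for s
  proof -
    have p: "0 < s + \<sigma>\<^sup>2" using that by simp
    have "(g has_real_derivative (- (?n / 2)) * (s + \<sigma>\<^sup>2) powr (- (?n / 2) - 1) * 1) (at s)"
      unfolding g_def
      by (rule DERIV_chain2[where f="\<lambda>z. z powr (- (?n / 2))" and g="\<lambda>s. s + \<sigma>\<^sup>2", OF has_real_derivative_powr[OF p]])
        (auto intro!: derivative_eq_intros)
    moreover have "(s + \<sigma>\<^sup>2) powr (- (?n / 2) - 1) = g s / (s + \<sigma>\<^sup>2)"
      using p unfolding g_def powr_diff by simp
    ultimately show ?thesis by (simp add: g'_def)
  qed
  have dG: "(G has_real_derivative G' s) (at s)" if s: "- \<sigma>\<^sup>2 < s" for s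
  proof -
    have 1: "((\<lambda>s. pos_sq (g s - t0)) has_real_derivative 2 * max 0 (g s - t0) * g' s) (at s)"
      by (rule DERIV_chain2[OF pos_sq_deriv]) (use dg[OF s] in \<open>auto intro!: derivative_eq_intros\<close>)
    have "(G has_real_derivative ((2 * max 0 (g s - t0) * g' s) * g s - pos_sq (g s - t0) * g' s) / (g s * g s)) (at s)"
      unfolding G_def by (rule DERIV_divide[OF 1 dg[OF s]]) (use gpos[OF s] in simp)
    moreover have "((2 * max 0 (g s - t0) * g' s) * g s - pos_sq (g s - t0) * g' s) / (g s * g s) = G' s"
      by (simp add: G'_def power2_eq_square algebra_simps diff_divide_distrib)
    ultimately show ?thesis by simp
  qed
  have cg: "continuous_on {- \<sigma>\<^sup>2<..} g"
    using dg by (intro continuous_at_imp_continuous_on ballI DERIV_isCont) auto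
  have cg': "continuous_on {- \<sigma>\<^sup>2<..} g'"
    unfolding g'_def by (intro continuous_intros cg) auto
  have cG': "continuous_on {- \<sigma>\<^sup>2<..} G'"
    unfolding G'_def using gpos by (intro continuous_intros cg cg') (auto simp: less_imp_neq[THEN not_sym])
  have antimono: "g t \<le> g s" if "- \<sigma>\<^sup>2 < s" "s \<le> t" for s t
    unfolding g_def using that n1 by (intro powr_mono2') auto
  have le_t0: "g s \<le> t0" if "\<rho>\<^sup>2 \<le> s" for s
    unfolding t0_def using that \<sigma>2 by (intro antimono) (auto intro: less_le_trans[of _ 0])
  have slope: "2 * max 0 (g s - t0) * g s - pos_sq (g s - t0) = (max t0 (g s))\<^sup>2 - t0\<^sup>2" for s
    by (simp add: pos_sq_def max_def power2_eq_square algebra_simps)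
  have slope0: "0 \<le> (max t0 (g s))\<^sup>2 - t0\<^sup>2" for s
    using t0 by (simp add: power_mono)
  define K where "K s = ?n * G s + 2 * s * G' s" for s
  have Kge: "?n * ((if s < \<sigma>\<^sup>2 then 1 / (4 * (sqrt 2 * \<sigma>) ^ CARD('n)) else 0) - 2 / \<rho> ^ CARD('n)) \<le> K s" if s: "0 \<le> s" for s
  proof -
    have s': "- \<sigma>\<^sup>2 < s" using s \<sigma>2 by linarith
    have gs: "0 < g s" by (rule gpos[OF s'])
    have p: "0 < s + \<sigma>\<^sup>2" using s \<sigma>2 by linarith
    have t0le: "t0 \<le> 1 / \<rho> ^ CARD('n)"
    proof -
      have "t0 \<le> (\<rho>\<^sup>2) powr (- (?n / 2))"
        unfolding t0_def g_def using \<rho> \<sigma>2 n1 by (intro powr_mono2') auto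
      then show ?thesis using square_powr[OF \<rho>] by simp
    qed
    define M where "M = (max t0 (g s))\<^sup>2 - t0\<^sup>2"
    have M0: "0 \<le> M" unfolding M_def by (rule slope0)
    have G's: "G' s = - (?n / 2) * (M / (g s * (s + \<sigma>\<^sup>2)))"
      unfolding G'_def slope g'_def M_def[symmetric] using gs p by (simp add: power2_eq_square field_simps)
    have "K s = ?n * (G s - M / g s * (s / (s + \<sigma>\<^sup>2)))"
    proof -
      define Y where "Y = M / (g s * (s + \<sigma>\<^sup>2))"
      have "K s = ?n * (G s - s * Y)"
        unfolding K_def G's Y_def[symmetric] by (simp add: algebra_simps)
      also have "s * Y = M / g s * (s / (s + \<sigma>\<^sup>2))"
        unfolding Y_def by simp
      finally show ?thesis .
    qed
    also have "s / (s + \<sigma>\<^sup>2) = 1 - \<sigma>\<^sup>2 / (s + \<sigma>\<^sup>2)" using p by (simp add: field_simps)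
    finally have K: "K s = ?n * ((G s - M / g s) + M / g s * (\<sigma>\<^sup>2 / (s + \<sigma>\<^sup>2)))" by (simp add: algebra_simps)
    have GM: "- (2 * t0) \<le> G s - M / g s"
    proof (cases "g s \<le> t0")
      case True
      then show ?thesis using t0 by (simp add: G_def M_def pos_sq_zero max_def)
    next
      case False
      then have "G s - M / g s = ((g s - t0)\<^sup>2 - ((g s)\<^sup>2 - t0\<^sup>2)) / g s"
        by (simp add: G_def M_def pos_sq_def max_def diff_divide_distrib)
      also have "(g s - t0)\<^sup>2 - ((g s)\<^sup>2 - t0\<^sup>2) = - (2 * t0) * g s + 2 * t0\<^sup>2"
        by (simp add: power2_eq_square algebra_simps)
      also have "(- (2 * t0) * g s + 2 * t0\<^sup>2) / g s = - (2 * t0) + 2 * t0\<^sup>2 / g s"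
        using less_imp_neq[OF gs, THEN not_sym] by (simp add: diff_divide_distrib)
      finally show ?thesis using gs by simp
    qed
    have Mpos: "0 \<le> M / g s * (\<sigma>\<^sup>2 / (s + \<sigma>\<^sup>2))" using M0 gs p \<sigma>2 by (simp add: less_imp_le)
    have ge: "(if s < \<sigma>\<^sup>2 then 1 / (4 * (sqrt 2 * \<sigma>) ^ CARD('n)) else 0) \<le> M / g s * (\<sigma>\<^sup>2 / (s + \<sigma>\<^sup>2))"
    proof (cases "s < \<sigma>\<^sup>2")
      case True
      have half: "1 / 2 \<le> \<sigma>\<^sup>2 / (s + \<sigma>\<^sup>2)" using True p by (simp add: le_divide_eq)
      define g1 where "g1 = 1 / (sqrt 2 * \<sigma>) ^ CARD('n)"
      have "(sqrt 2 * \<sigma>)\<^sup>2 = 2 * \<sigma>\<^sup>2" by (simp add: power_mult_distrib)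
      then have "g1 = (2 * \<sigma>\<^sup>2) powr (- (?n / 2))"
        unfolding g1_def using square_powr[of "sqrt 2 * \<sigma>" "CARD('n)"] \<sigma> by simp
      also have "\<dots> \<le> g s" unfolding g_def using True p n1 by (intro powr_mono2') auto
      finally have g1: "g1 \<le> g s" .
      have "2 * t0 \<le> g1"
      proof -
        have "2 * (sqrt 2 * \<sigma>) ^ CARD('n) \<le> 2 ^ CARD('n) * (sqrt 2 * \<sigma>) ^ CARD('n)"
          using \<sigma> n1 self_le_power[of "2::real" "CARD('n)"] by (intro mult_right_mono) auto
        also have "\<dots> = (2 * (sqrt 2 * \<sigma>)) ^ CARD('n)" by (simp add: power_mult_distrib)
        also have "\<dots> \<le> \<rho> ^ CARD('n)"
        proof (rule power_mono)
          have "sqrt 2 \<le> 3 / 2" by (rule real_le_lsqrt) (auto simp: power2_eq_square)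
          then have "sqrt 2 * \<sigma> \<le> 3 / 2 * \<sigma>" using \<sigma>(1) by (intro mult_right_mono) auto
          then show "2 * (sqrt 2 * \<sigma>) \<le> \<rho>" using \<sigma>(2) by linarith
        qed (use \<sigma> in auto)
        finally have le: "2 * (sqrt 2 * \<sigma>) ^ CARD('n) \<le> \<rho> ^ CARD('n)" .
        have "0 < (sqrt 2 * \<sigma>) ^ CARD('n)" "0 < \<rho> ^ CARD('n)" using \<sigma>(1) \<rho> by simp_all
        then have "2 / \<rho> ^ CARD('n) \<le> g1" unfolding g1_def using le by (simp add: divide_le_eq le_divide_eq mult.commute)
        moreover have "2 * t0 \<le> 2 / \<rho> ^ CARD('n)" using t0le by simp
        ultimately show ?thesis by linarith
      qed
      then have tg: "2 * t0 \<le> g s" using g1 by linarith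
      have "g s / 2 \<le> M / g s"
      proof -
        have "t0\<^sup>2 \<le> (g s / 2)\<^sup>2" using tg t0 by (intro power_mono) auto
        then have "t0\<^sup>2 \<le> (g s)\<^sup>2 / 4" by (simp add: power_divide)
        moreover have "M = (g s)\<^sup>2 - t0\<^sup>2" using tg t0 by (simp add: M_def max_def)
        moreover have "0 \<le> (g s)\<^sup>2" by simp
        ultimately have "(g s)\<^sup>2 / 2 \<le> M" by linarith
        then show ?thesis using gs by (simp add: le_divide_eq power2_eq_square)
      qed
      then have "g1 / 2 \<le> M / g s" using g1 by linarith
      moreover have "0 \<le> M / g s" using M0 gs by simp
      ultimately have "g1 / 2 * (1 / 2) \<le> M / g s * (\<sigma>\<^sup>2 / (s + \<sigma>\<^sup>2))"
        using half by (intro mult_mono) simp_all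
      then show ?thesis using True by (simp add: g1_def)
    qed (use Mpos in simp)
    have "(if s < \<sigma>\<^sup>2 then 1 / (4 * (sqrt 2 * \<sigma>) ^ CARD('n)) else 0) - 2 / \<rho> ^ CARD('n)
        \<le> (G s - M / g s) + M / g s * (\<sigma>\<^sup>2 / (s + \<sigma>\<^sup>2))"
      using GM ge t0le by simp
    then show ?thesis unfolding K by (rule mult_left_mono) simp
  qed
  let ?s = "\<lambda>x. (gr x - z0) \<bullet> (gr x - z0)"
  have main: "(\<integral>x. indicator (near z0 \<rho>) x * (K (?s x) * \<phi> x) \<partial>\<mu>) \<le> 0"
    unfolding K_def \<phi>_def
  proof (rule stationary_weighted[OF v z0 \<sigma>2 \<rho> dG cG'])
    show "0 \<le> G s" for s using powr_ge_zero[of "s + \<sigma>\<^sup>2"] by (simp add: G_def g_def)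
    show "G' s \<le> 0" if "0 \<le> s" for s
    proof -
      have "- \<sigma>\<^sup>2 < s" using that \<sigma>2 by linarith
      then have "0 < s + \<sigma>\<^sup>2" "0 < g s" by (simp, rule gpos)
      then have "g' s \<le> 0" by (simp add: g'_def)
      then show ?thesis unfolding G'_def slope using slope0 by (intro mult_nonneg_nonpos divide_nonneg_nonneg) auto
    qed
    show "G s = 0" if "\<rho>\<^sup>2 \<le> s" for s using le_t0[OF that] by (simp add: G_def pos_sq_zero)
    show "G' s = 0" if "\<rho>\<^sup>2 \<le> s" for s using le_t0[OF that] by (simp add: G'_def pos_sq_zero)
  qed
  have c\<phi>: "continuous_on UNIV \<phi>" unfolding \<phi>_def by (intro continuous_intros continuous_gr)
  have i1: "integrable \<mu> (\<lambda>x. indicator (near z0 r) x * \<phi> x)" for r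
    by (rule integrable_continuous_bounded[OF c\<phi> bounded_near near_borel])
  have cs: "continuous_on UNIV ?s" by (intro continuous_intros continuous_gr)
  have "continuous_on UNIV (\<lambda>x. K (?s x))"
  proof -
    have "continuous_on {- \<sigma>\<^sup>2<..} K"
      unfolding K_def using dG by (intro continuous_intros cG' continuous_at_imp_continuous_on ballI DERIV_isCont) auto
    then show ?thesis using \<sigma>2 by (intro continuous_on_compose2[OF _ cs]) (auto intro: less_le_trans[of _ 0])
  qed
  then have iK: "integrable \<mu> (\<lambda>x. indicator (near z0 \<rho>) x * (K (?s x) * \<phi> x))"
    by (intro integrable_continuous_bounded bounded_near near_borel continuous_intros c\<phi>)
  define A where "A = 1 / (4 * (sqrt 2 * \<sigma>) ^ CARD('n))"
  define B where "B = 2 / \<rho> ^ CARD('n)"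
  have "?n * (A * energy z0 \<sigma> \<phi> - B * energy z0 \<rho> \<phi>) =
      (\<integral>x. ?n * (A * (indicator (near z0 \<sigma>) x * \<phi> x) - B * (indicator (near z0 \<rho>) x * \<phi> x)) \<partial>\<mu>)"
    unfolding energy_def using i1 by simp
  also have "\<dots> \<le> (\<integral>x. indicator (near z0 \<rho>) x * (K (?s x) * \<phi> x) \<partial>\<mu>)"
  proof (rule integral_mono)
    show "integrable \<mu> (\<lambda>x. ?n * (A * (indicator (near z0 \<sigma>) x * \<phi> x) - B * (indicator (near z0 \<rho>) x * \<phi> x)))"
      using i1 by simp
    fix x
    have sx: "?s x = (dist (gr x) z0)\<^sup>2" by (simp add: dist_norm power2_norm_eq_inner)
    show "?n * (A * (indicator (near z0 \<sigma>) x * \<phi> x) - B * (indicator (near z0 \<rho>) x * \<phi> x)) \<le> indicator (near z0 \<rho>) x * (K (?s x) * \<phi> x)"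
    proof (cases "x \<in> near z0 \<rho>")
      case True
      have "dist (gr x) z0 < \<sigma> \<longleftrightarrow> (dist (gr x) z0)\<^sup>2 < \<sigma>\<^sup>2"
      proof
        show "dist (gr x) z0 < \<sigma> \<Longrightarrow> (dist (gr x) z0)\<^sup>2 < \<sigma>\<^sup>2" by (rule power_strict_mono) simp_all
        show "(dist (gr x) z0)\<^sup>2 < \<sigma>\<^sup>2 \<Longrightarrow> dist (gr x) z0 < \<sigma>" by (rule power2_less_imp_less, assumption) (use \<sigma>(1) in simp)
      qed
      then have "x \<in> near z0 \<sigma> \<longleftrightarrow> ?s x < \<sigma>\<^sup>2" unfolding sx near_def by simp
      then have i\<sigma>: "A * indicator (near z0 \<sigma>) x = (if ?s x < \<sigma>\<^sup>2 then A else 0)" by (simp add: indicator_def)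
      have "?n * ((if ?s x < \<sigma>\<^sup>2 then A else 0) - B) * \<phi> x \<le> K (?s x) * \<phi> x"
        unfolding A_def B_def using Kge[of "?s x"] by (intro mult_right_mono) (auto simp: \<phi>_def)
      moreover have "?n * (A * (indicator (near z0 \<sigma>) x * \<phi> x) - B * (indicator (near z0 \<rho>) x * \<phi> x))
          = ?n * (A * indicator (near z0 \<sigma>) x - B) * \<phi> x"
        using True by (simp add: algebra_simps)
      ultimately show ?thesis using True i\<sigma> by simp
    next
      case False
      then have "x \<notin> near z0 \<sigma>" using \<sigma> by (auto simp: near_def)
      then show ?thesis using False by simp
    qed
  qed (rule iK)
  also have "\<dots> \<le> 0" by (rule main)
  finally have "A * energy z0 \<sigma> \<phi> \<le> B * energy z0 \<rho> \<phi>" using n1 by (simp add: mult_le_0_iff)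
  then have "4 * (sqrt 2 * \<sigma>) ^ CARD('n) * (A * energy z0 \<sigma> \<phi>) \<le> 4 * (sqrt 2 * \<sigma>) ^ CARD('n) * (B * energy z0 \<rho> \<phi>)"
    using \<sigma> by (intro mult_left_mono) auto
  then show ?thesis using \<sigma> by (simp add: A_def B_def)
qed

lemma outer_gr_positive:
  assumes "open U" "U \<noteq> {}"
  shows "0 < hausdorff_outer CARD('n) (gr ` U)"
proof -
  have im: "fst ` gr ` U = U" by (simp add: image_image)
  have "emeasure lebesgue U \<le> 2 ^ DIM(real^'n) * hausdorff_outer DIM(real^'n) (gr ` U)"
    using emeasure_image_le_hausdorff[of fst "gr ` U"] assms(1) dist_fst_le unfolding im by auto
  moreover have "0 < emeasure lebesgue U"
  proof (rule ccontr)
    assume "\<not> 0 < emeasure lebesgue U"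
    then have "emeasure lebesgue U = 0" by simp
    then have "negligible U" unfolding negligible_iff_null_sets using assms(1) by (intro null_setsI) auto
    then show False using open_not_negligible[OF assms] by simp
  qed
  ultimately show ?thesis by (cases "hausdorff_outer CARD('n) (gr ` U) = 0") (auto simp: zero_less_iff_neq_zero)
qed

lemma density_const_pos: "0 < density_const CARD('n)" by (simp add: density_const_def)

text \<open>
  Otherwise the graph over a small open set would consist of points of low density, hence have measure zero,
  but its projection to the base is open.
\<close>

lemma dense_thick_points:
  assumes U: "open U" "U \<noteq> {}"
  shows "\<exists>x\<in>U. \<forall>\<delta>>0. \<exists>\<sigma>. 0 < \<sigma> \<and> \<sigma> < \<delta> \<and>
    ennreal (density_const CARD('n) * \<sigma> ^ CARD('n)) < emeasure \<mu> {y. dist (gr y) (gr x) \<le> \<sigma>}"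
proof (rule ccontr)
  assume neg: "\<not> ?thesis"
  obtain x1 where x1: "x1 \<in> U" using U by blast
  define V where "V = U \<inter> ball x1 1"
  have V: "open V" "V \<noteq> {}" "bounded V" "V \<in> sets borel"
    using U x1 by (auto simp: V_def)
  define A where "A = gr ` V"
  have fin: "hausdorff_outer CARD('n) A < top"
    using \<mu>_bounded_finite[OF V(3,4)] V(4) by (simp add: A_def emeasure_\<mu>)
  have cl: "{y. dist (gr y) z \<le> \<sigma>} \<in> sets borel" for z \<sigma>
    by (intro borel_closed closed_Collect_le continuous_intros continuous_gr)
  have "A \<subseteq> {z\<in>A. \<exists>\<delta>>0. \<forall>\<rho>. 0 < \<rho> \<longrightarrow> \<rho> < \<delta> \<longrightarrow>
      hausdorff_outer CARD('n) (A \<inter> cball z \<rho>) \<le> ennreal (density_const CARD('n) * \<rho> ^ CARD('n))}"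
  proof
    fix z assume z: "z \<in> A"
    then obtain x where x: "x \<in> V" "z = gr x" by (auto simp: A_def)
    then have "x \<in> U" by (simp add: V_def)
    then have "\<not> (\<forall>\<delta>>0. \<exists>\<sigma>. 0 < \<sigma> \<and> \<sigma> < \<delta> \<and>
        ennreal (density_const CARD('n) * \<sigma> ^ CARD('n)) < emeasure \<mu> {y. dist (gr y) (gr x) \<le> \<sigma>})"
      using neg by (meson bexI)
    then obtain \<delta> where "0 < \<delta>" and n\<delta>: "\<not> (\<exists>\<sigma>. 0 < \<sigma> \<and> \<sigma> < \<delta> \<and>
        ennreal (density_const CARD('n) * \<sigma> ^ CARD('n)) < emeasure \<mu> {y. dist (gr y) (gr x) \<le> \<sigma>})" by blast
    then have \<delta>: "0 < \<delta>" "\<And>\<sigma>. 0 < \<sigma> \<Longrightarrow> \<sigma> < \<delta> \<Longrightarrow>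
        emeasure \<mu> {y. dist (gr y) (gr x) \<le> \<sigma>} \<le> ennreal (density_const CARD('n) * \<sigma> ^ CARD('n))"
      unfolding not_less[symmetric] by blast+
    have "hausdorff_outer CARD('n) (A \<inter> cball z \<rho>) \<le> ennreal (density_const CARD('n) * \<rho> ^ CARD('n))"
      if "0 < \<rho>" "\<rho> < \<delta>" for \<rho>
    proof -
      have "A \<inter> cball z \<rho> \<subseteq> gr ` {y. dist (gr y) (gr x) \<le> \<rho>}"
        by (auto simp: A_def x(2) dist_commute)
      then have "hausdorff_outer CARD('n) (A \<inter> cball z \<rho>) \<le> emeasure \<mu> {y. dist (gr y) (gr x) \<le> \<rho>}"
        unfolding emeasure_\<mu>[OF cl] by (rule hausdorff_outer_mono)
      also have "\<dots> \<le> ennreal (density_const CARD('n) * \<rho> ^ CARD('n))" by (rule \<delta>(2)[OF that])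
      finally show ?thesis .
    qed
    then show "z \<in> {z\<in>A. \<exists>\<delta>>0. \<forall>\<rho>. 0 < \<rho> \<longrightarrow> \<rho> < \<delta> \<longrightarrow>
      hausdorff_outer CARD('n) (A \<inter> cball z \<rho>) \<le> ennreal (density_const CARD('n) * \<rho> ^ CARD('n))}"
      using z \<delta>(1) by blast
  qed
  then have "hausdorff_outer CARD('n) A \<le> hausdorff_outer CARD('n) {z\<in>A. \<exists>\<delta>>0. \<forall>\<rho>. 0 < \<rho> \<longrightarrow> \<rho> < \<delta> \<longrightarrow>
      hausdorff_outer CARD('n) (A \<inter> cball z \<rho>) \<le> ennreal (density_const CARD('n) * \<rho> ^ CARD('n))}"
    by (rule hausdorff_outer_mono)
  also have "\<dots> = 0"
    using fin density_const_pos by (intro hausdorff_density) (auto simp: density_const_def)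
  finally show False using outer_gr_positive[OF V(1,2)] by (simp add: A_def)
qed

lemma mean_value_const_pos: "0 < mean_value_const CARD('n)"
  using density_const_pos by (simp add: mean_value_const_def)

lemma energy_integrable:
  fixes \<phi> :: "real ^ 'n \<Rightarrow> real"
  shows "continuous_on UNIV \<phi> \<Longrightarrow> integrable \<mu> (\<lambda>x. indicator (near z r) x * \<phi> x)"
  by (intro integrable_continuous_bounded bounded_near near_borel)

lemma energy_mono:
  assumes "continuous_on UNIV \<phi>" "\<And>x. 0 \<le> \<phi> x" "near z r \<subseteq> near z' r'"
  shows "energy z r \<phi> \<le> energy z' r' \<phi>"
  unfolding energy_def using assms
  by (intro integral_mono energy_integrable mult_right_mono) (auto simp: indicator_def)

text \<open>
  At a thick point \<open>x\<close> let \<open>\<sigma>\<close> tend to \<open>0\<close> in the decay estimate: the energy at scale \<open>\<sigma>\<close> is at least about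
  \<open>\<phi> x\<close> times \<open>density_const * \<sigma>\<^sup>n\<close>. Thick points are dense, so the inequality extends to all points by
  continuity, at the cost of doubling the radius.
\<close>

theorem mean_value_inequality:
  fixes v :: "(real ^ 'n) \<times> fin_seq" and c0 \<rho> :: real
  assumes v: "v \<in> ambient m" and \<rho>: "0 < \<rho>"
  defines "\<phi> \<equiv> \<lambda>x. (v \<bullet> gr x + c0)\<^sup>2"
  shows "\<phi> x \<le> mean_value_const CARD('n) / \<rho> ^ CARD('n) * energy (gr x) (2 * \<rho>) \<phi>"
proof -
  have c\<phi>: "continuous_on UNIV \<phi>" unfolding \<phi>_def by (intro continuous_intros continuous_gr)
  have \<phi>0: "0 \<le> \<phi> x" for x by (simp add: \<phi>_def)
  have thick: "\<phi> x \<le> mean_value_const CARD('n) / \<rho> ^ CARD('n) * energy (gr x) \<rho> \<phi>"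
    if th: "\<And>\<delta>. 0 < \<delta> \<Longrightarrow> \<exists>\<sigma>. 0 < \<sigma> \<and> \<sigma> < \<delta> \<and>
      ennreal (density_const CARD('n) * \<sigma> ^ CARD('n)) < emeasure \<mu> {y. dist (gr y) (gr x) \<le> \<sigma>}" for x
  proof (rule field_le_epsilon)
    fix \<epsilon> :: real assume \<epsilon>: "0 < \<epsilon>"
    define f where "f z = (v \<bullet> z + c0)\<^sup>2" for z
    have "continuous_on UNIV f" unfolding f_def by (intro continuous_intros)
    then have "isCont f (gr x)" using continuous_on_eq_continuous_at[OF open_UNIV] by blast
    then obtain d where d: "0 < d" "\<And>z. dist z (gr x) < d \<Longrightarrow> dist (f z) (f (gr x)) < \<epsilon>"
      using \<epsilon> unfolding continuous_at_eps_delta by blast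
    obtain \<sigma> where \<sigma>: "0 < \<sigma>" "\<sigma> < min (d / 2) (\<rho> / 6)"
      and big: "ennreal (density_const CARD('n) * \<sigma> ^ CARD('n)) < emeasure \<mu> {y. dist (gr y) (gr x) \<le> \<sigma>}"
      using th[of "min (d / 2) (\<rho> / 6)"] d(1) \<rho> by auto
    let ?N = "near (gr x) (2 * \<sigma>)"
    have finN: "emeasure \<mu> ?N < top" by (rule \<mu>_bounded_finite[OF bounded_near near_borel])
    have sub: "{y. dist (gr y) (gr x) \<le> \<sigma>} \<subseteq> ?N" using \<sigma>(1) by (auto simp: near_def)
    have "emeasure \<mu> {y. dist (gr y) (gr x) \<le> \<sigma>} \<le> emeasure \<mu> ?N"
      by (rule emeasure_mono[OF sub]) (simp add: near_borel)
    also have "\<dots> = ennreal (measure \<mu> ?N)"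
      using finN by (intro emeasure_eq_ennreal_measure) auto
    finally have "ennreal (density_const CARD('n) * \<sigma> ^ CARD('n)) \<le> ennreal (measure \<mu> ?N)"
      using big by (meson less_imp_le order_trans)
    then have meas: "density_const CARD('n) * \<sigma> ^ CARD('n) \<le> measure \<mu> ?N" by simp
    have low: "(\<phi> x - \<epsilon>) * measure \<mu> ?N \<le> energy (gr x) (2 * \<sigma>) \<phi>"
    proof -
      have "(\<phi> x - \<epsilon>) * measure \<mu> ?N = (\<integral>y. indicator ?N y * (\<phi> x - \<epsilon>) \<partial>\<mu>)"
        using finN by (simp add: mult.commute)
      also have "\<dots> \<le> energy (gr x) (2 * \<sigma>) \<phi>"
        unfolding energy_def
      proof (intro integral_mono energy_integrable c\<phi> continuous_on_const)
        fix y
        show "indicator ?N y * (\<phi> x - \<epsilon>) \<le> indicator ?N y * \<phi> y"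
        proof (cases "y \<in> ?N")
          case True
          then have "dist (gr y) (gr x) < d" using \<sigma>(2) by (auto simp: near_def)
          from d(2)[OF this] show ?thesis using True by (simp add: f_def \<phi>_def dist_real_def)
        qed simp
      qed
      finally show ?thesis .
    qed
    have decay: "energy (gr x) (2 * \<sigma>) \<phi> \<le> 8 * (sqrt 2 * (2 * \<sigma>)) ^ CARD('n) / \<rho> ^ CARD('n) * energy (gr x) \<rho> \<phi>"
      unfolding \<phi>_def using \<sigma> by (intro energy_decay v gr_ambient) auto
    have E0: "0 \<le> energy (gr x) \<rho> \<phi>" unfolding energy_def using \<phi>0 by (intro integral_nonneg_AE) auto
    show "\<phi> x \<le> mean_value_const CARD('n) / \<rho> ^ CARD('n) * energy (gr x) \<rho> \<phi> + \<epsilon>"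
    proof (cases "\<phi> x \<le> \<epsilon>")
      case True
      have "0 \<le> mean_value_const CARD('n) / \<rho> ^ CARD('n) * energy (gr x) \<rho> \<phi>"
        using mean_value_const_pos \<rho> E0 by (intro mult_nonneg_nonneg divide_nonneg_nonneg) auto
      then show ?thesis using True by linarith
    next
      case False
      have "(\<phi> x - \<epsilon>) * (density_const CARD('n) * \<sigma> ^ CARD('n)) \<le> (\<phi> x - \<epsilon>) * measure \<mu> ?N"
        using False meas by (intro mult_left_mono) auto
      also have "\<dots> \<le> 8 * (sqrt 2 * (2 * \<sigma>)) ^ CARD('n) / \<rho> ^ CARD('n) * energy (gr x) \<rho> \<phi>"
        using low decay by linarith
      also have "\<dots> = (mean_value_const CARD('n) / \<rho> ^ CARD('n) * energy (gr x) \<rho> \<phi>) * (density_const CARD('n) * \<sigma> ^ CARD('n))"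
        using density_const_pos by (simp add: mean_value_const_def power_mult_distrib)
      finally have "\<phi> x - \<epsilon> \<le> mean_value_const CARD('n) / \<rho> ^ CARD('n) * energy (gr x) \<rho> \<phi>"
        by (rule mult_right_le_imp_le) (use density_const_pos \<sigma>(1) in simp)
      then show ?thesis by linarith
    qed
  qed
  show ?thesis
  proof (rule field_le_epsilon)
    fix \<epsilon> :: real assume \<epsilon>: "0 < \<epsilon>"
    define U where "U = {y. dist (gr y) (gr x) < \<rho> \<and> \<phi> x - \<epsilon> < \<phi> y}"
    have "open U" unfolding U_def
      by (intro open_Collect_conj open_Collect_less continuous_intros continuous_gr c\<phi>)
    moreover have "x \<in> U" using \<rho> \<epsilon> by (simp add: U_def)
    ultimately obtain y where y: "y \<in> U" and th: "\<And>\<delta>. 0 < \<delta> \<Longrightarrow> \<exists>\<sigma>. 0 < \<sigma> \<and> \<sigma> < \<delta> \<and>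
      ennreal (density_const CARD('n) * \<sigma> ^ CARD('n)) < emeasure \<mu> {z. dist (gr z) (gr y) \<le> \<sigma>}"
      using dense_thick_points[of U] by blast
    have sub: "near (gr y) \<rho> \<subseteq> near (gr x) (2 * \<rho>)"
    proof
      fix z assume "z \<in> near (gr y) \<rho>"
      then show "z \<in> near (gr x) (2 * \<rho>)"
        using y dist_triangle[of "gr z" "gr x" "gr y"] by (simp add: near_def U_def)
    qed
    have "\<phi> x - \<epsilon> \<le> \<phi> y" using y by (simp add: U_def)
    also have "\<dots> \<le> mean_value_const CARD('n) / \<rho> ^ CARD('n) * energy (gr y) \<rho> \<phi>" by (rule thick[OF th])
    also have "\<dots> \<le> mean_value_const CARD('n) / \<rho> ^ CARD('n) * energy (gr x) (2 * \<rho>) \<phi>"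
      using mean_value_const_pos \<rho> by (intro mult_left_mono energy_mono c\<phi> \<phi>0 sub) auto
    finally show "\<phi> x \<le> mean_value_const CARD('n) / \<rho> ^ CARD('n) * energy (gr x) (2 * \<rho>) \<phi> + \<epsilon>" by linarith
  qed
qed

end

section \<open>Bounding the dimension\<close>

definition dim_const :: "nat \<Rightarrow> real \<Rightarrow> real" where
  "dim_const n \<Lambda> = 2 * 2 ^ (n + 2) * (mean_value_const n * 2 ^ n * (volume_const n \<Lambda> * unit_ball_vol n))"

text \<open>
  Orthogonalisation with respect to \<open>B\<close> along the flag of the spans of \<open>v ` {..<i}\<close>.
\<close>

lemma gram_schmidt_flag:
  fixes B :: "'v::real_vector \<Rightarrow> 'v \<Rightarrow> real" and v :: "nat \<Rightarrow> 'v"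
  assumes bil: "bilinear B" and sym: "\<And>x y. B x y = B y x"
    and pos: "\<And>w. w \<in> span (v ` {..<k}) \<Longrightarrow> w \<noteq> 0 \<Longrightarrow> 0 < B w w"
    and ind: "\<And>i. i < k \<Longrightarrow> v i \<notin> span (v ` {..<i})"
  shows "\<exists>e. (\<forall>i<k. e i - v i \<in> span (v ` {..<i})) \<and> (\<forall>i<k. \<forall>y\<in>span (v ` {..<i}). B (e i) y = 0) \<and> (\<forall>i<k. 0 < B (e i) (e i))"
proof -
  have proj: "\<exists>x. x - v i \<in> span (v ` {..<i}) \<and> (\<forall>y\<in>span (v ` {..<i}). B x y = 0)" if i: "i < k" for i
  proof -
    have "\<exists>x. x - w \<in> span (v ` {..<j}) \<and> (\<forall>y\<in>span (v ` {..<j}). B x y = 0)" if "j \<le> k" for j w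
      using that
    proof (induction j arbitrary: w)
      case 0
      then show ?case by (intro exI[of _ w]) (auto simp: bilinear_rzero[OF bil])
    next
      case (Suc j)
      obtain e where e: "e - v j \<in> span (v ` {..<j})" "\<forall>y\<in>span (v ` {..<j}). B e y = 0"
        using Suc.IH[of "v j"] Suc.prems by auto
      obtain x where x: "x - w \<in> span (v ` {..<j})" "\<forall>y\<in>span (v ` {..<j}). B x y = 0"
        using Suc.IH[of w] Suc.prems by auto
      have sub: "span (v ` {..<j}) \<subseteq> span (v ` {..<Suc j})" by (intro span_mono) auto
      have vj: "v j \<in> span (v ` {..<Suc j})" by (intro span_base) auto
      have eS: "e \<in> span (v ` {..<Suc j})" using span_add[OF subsetD[OF sub e(1)] vj] by simp
      have "span (v ` {..<Suc j}) \<subseteq> span (v ` {..<k})" using Suc.prems by (intro span_mono) auto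
      moreover have "e \<noteq> 0"
      proof
        assume "e = 0"
        then have "v j \<in> span (v ` {..<j})" using span_neg[OF e(1)] by simp
        then show False using ind[of j] Suc.prems by simp
      qed
      ultimately have Bee: "0 < B e e" using pos eS by blast
      define c where "c = B x e / B e e"
      have ce: "B x e = c * B e e" using Bee by (simp add: c_def)
      let ?x = "x - c *\<^sub>R e"
      have "?x - w = (x - w) - c *\<^sub>R e" by simp
      also have "\<dots> \<in> span (v ` {..<Suc j})" by (rule span_diff[OF subsetD[OF sub x(1)] span_scale[OF eS]])
      finally have 1: "?x - w \<in> span (v ` {..<Suc j})" .
      have 2: "B ?x y = 0" if y: "y \<in> span (v ` {..<Suc j})" for y
      proof -
        have "v ` {..<Suc j} = insert (v j) (v ` {..<j})" by (auto simp: lessThan_Suc)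
        then obtain t where t: "y - t *\<^sub>R v j \<in> span (v ` {..<j})" using y by (auto simp: span_breakdown_eq)
        have "y - t *\<^sub>R e = (y - t *\<^sub>R v j) - t *\<^sub>R (e - v j)" by (simp add: scaleR_diff_right)
        also have "\<dots> \<in> span (v ` {..<j})" by (rule span_diff[OF t span_scale[OF e(1)]])
        finally have y': "y - t *\<^sub>R e \<in> span (v ` {..<j})" .
        have "B ?x y = B ?x ((y - t *\<^sub>R e) + t *\<^sub>R e)" by simp
        also have "\<dots> = B x (y - t *\<^sub>R e) - c * B e (y - t *\<^sub>R e) + t * (B x e - c * B e e)"
          by (simp only: bilinear_radd[OF bil] bilinear_rmul[OF bil] bilinear_lsub[OF bil] bilinear_lmul[OF bil] real_scaleR_def)
        also have "\<dots> = 0" using x(2) e(2) y' ce by simp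
        finally show ?thesis .
      qed
      show ?case using 1 2 by blast
    qed
    from this[of i "v i"] i show ?thesis by simp
  qed
  then have "\<forall>i\<in>{..<k}. \<exists>x. x - v i \<in> span (v ` {..<i}) \<and> (\<forall>y\<in>span (v ` {..<i}). B x y = 0)" by blast
  then obtain e where e: "\<And>i. i < k \<Longrightarrow> e i - v i \<in> span (v ` {..<i})"
    "\<And>i y. i < k \<Longrightarrow> y \<in> span (v ` {..<i}) \<Longrightarrow> B (e i) y = 0"
    unfolding bchoice_iff by blast
  have "0 < B (e i) (e i)" if i: "i < k" for i
  proof (rule pos)
    have "v ` {..<i} \<subseteq> v ` {..<k}" "v i \<in> v ` {..<k}" using i by auto
    then have "e i - v i \<in> span (v ` {..<k})" "v i \<in> span (v ` {..<k})"
      using e(1)[OF i] span_mono by (blast, blast intro: span_base)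
    from span_add[OF this] show "e i \<in> span (v ` {..<k})" by simp
    show "e i \<noteq> 0"
    proof
      assume "e i = 0"
      then have "v i \<in> span (v ` {..<i})" using span_neg[OF e(1)[OF i]] by simp
      then show False using ind[OF i] by simp
    qed
  qed
  then show ?thesis using e by blast
qed

lemma sum_ge_of_prod_ge_1:
  fixes x :: "nat \<Rightarrow> real"
  assumes pos: "\<And>i. i < k \<Longrightarrow> 0 < x i" and prod: "1 \<le> (\<Prod>i<k. x i)"
  shows "real k \<le> (\<Sum>i<k. x i)"
proof -
  have ne: "x i \<noteq> 0" if "i < k" for i using pos[OF that] by simp
  have "0 \<le> ln (\<Prod>i<k. x i)" using prod by simp
  also have "\<dots> = (\<Sum>i<k. ln (x i))" by (intro ln_prod) (auto simp: ne pos)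
  also have "\<dots> \<le> (\<Sum>i<k. x i - 1)" using pos by (intro sum_mono ln_le_minus_one) auto
  finally show ?thesis by (simp add: sum_subtractf)
qed

text \<open>
  Let \<open>a j i\<close> be the squared \<open>B j\<close>-distance of \<open>v i\<close> from the span of the earlier vectors; it is attained at the
  Gram-Schmidt vector \<open>e j i\<close>. Their product over \<open>i\<close> grows at most like \<open>Q\<^sup>k\<^sup>j\<close>, so at some \<open>j\<close> it grows by a factor of at most
  \<open>(2 Q)\<^sup>k\<close> from \<open>j\<close> to \<open>j + 1\<close>. The normalised vectors \<open>f i\<close> of scale \<open>j + 1\<close> differ from multiples of \<open>v i\<close> by earlier
  vectors, so their \<open>B j\<close>-size is at least \<open>a j i / a (j + 1) i\<close>, and the arithmetic mean of these
  quotients is at least their geometric mean \<open>1 / (2 Q)\<close>.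
\<close>

lemma slow_scale_orthonormal_family:
  fixes B :: "nat \<Rightarrow> 'v::real_vector \<Rightarrow> 'v \<Rightarrow> real" and v :: "nat \<Rightarrow> 'v" and Q :: real
  assumes bil: "\<And>j. bilinear (B j)" and sym: "\<And>j x y. B j x y = B j y x"
    and mono: "\<And>j x. B j x x \<le> B (Suc j) x x" and psd: "\<And>j x. 0 \<le> B j x x"
    and pos: "\<And>w. w \<in> span (v ` {..<k}) \<Longrightarrow> w \<noteq> 0 \<Longrightarrow> 0 < B 0 w w"
    and ind: "\<And>i. i < k \<Longrightarrow> v i \<notin> span (v ` {..<i})"
    and Q: "0 < Q" and growth: "\<And>i j. i < k \<Longrightarrow> B j (v i) (v i) \<le> c i * Q ^ j"
  shows "\<exists>j f. (\<forall>i<k. f i \<in> span (v ` {..<k})) \<and>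
    (\<forall>i<k. \<forall>l<k. B (Suc j) (f i) (f l) = (if i = l then 1 else 0)) \<and>
    real k \<le> 2 * Q * (\<Sum>i<k. B j (f i) (f i))"
proof (cases "k = 0")
  case True
  then show ?thesis by simp
next
  case False
  have posj: "0 < B j w w" if "w \<in> span (v ` {..<k})" "w \<noteq> 0" for j w
    using pos[OF that] by (induction j) (auto intro: less_le_trans[OF _ mono])
  have "\<forall>j. \<exists>e. (\<forall>i<k. e i - v i \<in> span (v ` {..<i})) \<and> (\<forall>i<k. \<forall>y\<in>span (v ` {..<i}). B j (e i) y = 0) \<and> (\<forall>i<k. 0 < B j (e i) (e i))"
    using gram_schmidt_flag[OF bil sym posj ind] by blast
  then obtain e where e: "\<And>j i. i < k \<Longrightarrow> e j i - v i \<in> span (v ` {..<i})"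
    "\<And>j i y. i < k \<Longrightarrow> y \<in> span (v ` {..<i}) \<Longrightarrow> B j (e j i) y = 0"
    "\<And>j i. i < k \<Longrightarrow> 0 < B j (e j i) (e j i)" unfolding choice_iff by blast
  define a where "a j i = B j (e j i) (e j i)" for j i
  have apos: "0 < a j i" if "i < k" for i j using e(3)[OF that] by (simp add: a_def)
  have min: "a j i \<le> B j x x" if i: "i < k" and x: "x - v i \<in> span (v ` {..<i})" for i j x
  proof -
    define y where "y = x - e j i"
    have "y = (x - v i) - (e j i - v i)" by (simp add: y_def)
    then have y: "y \<in> span (v ` {..<i})" using x e(1)[OF i, of j] by (metis span_diff)
    have xe: "x = e j i + y" by (simp add: y_def)
    have "B j x x = a j i + 2 * B j (e j i) y + B j y y"
      unfolding xe a_def by (simp add: bilinear_ladd[OF bil] bilinear_radd[OF bil] sym[of j y "e j i"])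
    then show ?thesis using e(2)[OF i y, of j] psd[of j y] by simp
  qed
  define P where "P j = (\<Prod>i<k. a j i)" for j
  have Ppos: "0 < P j" for j unfolding P_def using apos by (intro prod_pos) auto
  have a_le: "a j i \<le> c i * Q ^ j" if "i < k" for i j
    using min[OF that, of "v i" j] growth[OF that, of j] by (simp add: span_zero)
  define M where "M = (\<Prod>i<k. c i)"
  have PQ: "P j \<le> M * (Q ^ k) ^ j" for j
  proof -
    have "P j \<le> (\<Prod>i<k. c i * Q ^ j)" unfolding P_def using apos a_le by (intro prod_mono) (auto intro: less_imp_le)
    also have "\<dots> = M * (Q ^ j) ^ k" by (simp add: prod.distrib M_def)
    finally show ?thesis by (simp add: power_mult[symmetric] mult.commute)
  qed
  have "\<exists>j. P (Suc j) \<le> (2 * Q) ^ k * P j"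
  proof (rule ccontr)
    assume "\<not> ?thesis"
    then have grow: "(2 * Q) ^ k * P j \<le> P (Suc j)" for j by (auto simp: not_le less_imp_le)
    have low: "((2 * Q) ^ k) ^ j * P 0 \<le> P j" for j
    proof (induction j)
      case (Suc j)
      have "((2 * Q) ^ k) ^ Suc j * P 0 = (2 * Q) ^ k * (((2 * Q) ^ k) ^ j * P 0)" by simp
      also have "\<dots> \<le> (2 * Q) ^ k * P j" using Suc.IH Q by (intro mult_left_mono) auto
      also have "\<dots> \<le> P (Suc j)" by (rule grow)
      finally show ?case .
    qed simp
    have bd: "(2 ^ k) ^ j \<le> M / P 0" for j
    proof -
      have "(2 ^ k) ^ j * (Q ^ k) ^ j * P 0 \<le> M * (Q ^ k) ^ j"
        using order_trans[OF low PQ, of j] by (simp add: power_mult_distrib)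
      then have "((2 ^ k) ^ j * P 0) * (Q ^ k) ^ j \<le> M * (Q ^ k) ^ j" by (simp add: mult_ac)
      then have "(2 ^ k) ^ j * P 0 \<le> M" by (rule mult_right_le_imp_le) (use Q in simp)
      then show ?thesis using Ppos[of 0] by (simp add: le_divide_eq)
    qed
    obtain j where j: "M / P 0 < 2 ^ j" using real_arch_pow[of 2 "M / P 0"] by auto
    have "(2::real) ^ j \<le> (2 ^ k) ^ j" using False by (intro power_mono) (auto simp: self_le_power)
    then show False using j bd[of j] by linarith
  qed
  then obtain j where j: "P (Suc j) \<le> (2 * Q) ^ k * P j" by blast
  define f where "f i = (1 / sqrt (a (Suc j) i)) *\<^sub>R e (Suc j) i" for i
  have f_form: "B h (f i) (f l) = B h (e (Suc j) i) (e (Suc j) l) / (sqrt (a (Suc j) i) * sqrt (a (Suc j) l))" for h i l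
    by (simp add: f_def bilinear_lmul[OF bil] bilinear_rmul[OF bil])
  have espan: "e (Suc j) i \<in> span (v ` {..<l})" if "i < l" "i < k" for i l
  proof -
    have "v ` {..<i} \<subseteq> v ` {..<l}" "v i \<in> v ` {..<l}" using that by auto
    then have "e (Suc j) i - v i \<in> span (v ` {..<l})" "v i \<in> span (v ` {..<l})"
      using e(1)[OF that(2), of "Suc j"] span_mono by (blast, blast intro: span_base)
    from span_add[OF this] show ?thesis by simp
  qed
  have orth: "B (Suc j) (e (Suc j) i) (e (Suc j) l) = 0" if "i < k" "l < k" "i \<noteq> l" for i l
  proof (cases "i < l")
    case True
    then show ?thesis using e(2)[OF that(2) espan[OF True that(1)], of "Suc j"] by (simp add: sym)
  next
    case False
    then have "l < i" using that by simp
    then show ?thesis using e(2)[OF that(1) espan[OF _ that(2)], of "Suc j"] by simp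
  qed
  have on: "B (Suc j) (f i) (f l) = (if i = l then 1 else 0)" if "i < k" "l < k" for i l
    using orth[OF that] apos[OF that(1), of "Suc j"] unfolding f_form by (auto simp: a_def)
  have fj: "a j i / a (Suc j) i \<le> B j (f i) (f i)" if "i < k" for i
    unfolding f_form using min[OF that e(1)[OF that, of "Suc j"], of j] apos[OF that, of "Suc j"]
    by (simp add: divide_right_mono)
  have "real k \<le> (\<Sum>i<k. 2 * Q * (a j i / a (Suc j) i))"
  proof (rule sum_ge_of_prod_ge_1)
    show "0 < 2 * Q * (a j i / a (Suc j) i)" if "i < k" for i using apos[OF that] Q by simp
    have "(\<Prod>i<k. 2 * Q * (a j i / a (Suc j) i)) = (2 * Q) ^ k * (P j / P (Suc j))"
      by (simp only: prod.distrib prod_dividef P_def) simp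
    also have "1 \<le> \<dots>" using j Ppos[of "Suc j"] by (simp add: le_divide_eq)
    finally show "1 \<le> (\<Prod>i<k. 2 * Q * (a j i / a (Suc j) i))" .
  qed
  also have "\<dots> \<le> (\<Sum>i<k. 2 * Q * B j (f i) (f i))" using fj Q by (intro sum_mono mult_left_mono) auto
  also have "\<dots> = 2 * Q * (\<Sum>i<k. B j (f i) (f i))" by (simp add: sum_distrib_left)
  finally have "real k \<le> 2 * Q * (\<Sum>i<k. B j (f i) (f i))" .
  moreover have "f i \<in> span (v ` {..<k})" if "i < k" for i unfolding f_def using espan[OF that that] by (rule span_scale)
  ultimately show ?thesis using on by blast
qed

context minimal_dilation_graph
begin

definition height :: "(real ^ 'n) \<times> fin_seq \<Rightarrow> real ^ 'n \<Rightarrow> real" where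
  "height w x = w \<bullet> (gr x - gr 0)"

text \<open>
  The \<open>L\<^sup>2\<close> inner product of linear functions on the part of the graph in the ball of radius \<open>R\<close>.
\<close>

definition form :: "real \<Rightarrow> (real ^ 'n) \<times> fin_seq \<Rightarrow> (real ^ 'n) \<times> fin_seq \<Rightarrow> real" where
  "form R w w' = energy (gr 0) R (\<lambda>x. height w x * height w' x)"

lemma continuous_lin: "continuous_on UNIV (height w)"
  unfolding height_def by (intro continuous_intros continuous_gr)

lemma form_bilinear: "bilinear (form R)"
proof -
  have i: "integrable \<mu> (\<lambda>x. indicator (near (gr 0) R) x * (height a x * height b x))" for a b
    by (intro energy_integrable continuous_intros continuous_lin)
  have add: "form R (a + b) c = form R a c + form R b c" for a b c
    unfolding form_def energy_def using i[of a c] i[of b c]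
    by (subst Bochner_Integration.integral_add[symmetric]) (simp_all add: height_def inner_add_left algebra_simps)
  have scale: "form R (r *\<^sub>R a) c = r * form R a c" for r a c
    unfolding form_def energy_def
    by (subst integral_mult_right_zero[symmetric]) (simp add: height_def algebra_simps)
  have sym: "form R a c = form R c a" for a c by (simp add: form_def mult.commute)
  show ?thesis unfolding bilinear_def
    by (intro conjI allI linearI) (simp_all add: add scale sym[of _ "_ + _"] sym[of _ "_ *\<^sub>R _"], simp_all add: sym)
qed

lemma form_sym: "form R a c = form R c a" by (simp add: form_def mult.commute)

lemma form_mono: "R \<le> R' \<Longrightarrow> form R w w \<le> form R' w w"
  unfolding form_def
  by (intro energy_mono continuous_intros continuous_lin) (auto simp: near_def)

lemma form_nonneg: "0 \<le> form R w w"
  unfolding form_def energy_def by (intro integral_nonneg_AE) auto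

lemma measure_near_le:
  assumes R: "0 < R"
  shows "measure \<mu> (near (gr 0) R) \<le> volume_const CARD('n) \<Lambda> * unit_ball_vol CARD('n) * R ^ CARD('n)"
    and "emeasure \<mu> (near (gr 0) R) < top"
proof -
  show fin: "emeasure \<mu> (near (gr 0) R) < top" by (rule \<mu>_bounded_finite[OF bounded_near near_borel])
  have sub: "near (gr 0) R \<subseteq> {x. norm (x - 0) < R \<and> norm (u x - u 0) < R}"
  proof
    fix x assume "x \<in> near (gr 0) R"
    then have "dist (gr x) (gr 0) < R" by (simp add: near_def)
    then show "x \<in> {x. norm (x - 0) < R \<and> norm (u x - u 0) < R}"
      using dist_fst_le[of "gr x" "gr 0"] dist_snd_le[of "gr x" "gr 0"] by (simp add: dist_norm)
  qed
  have "{x. norm (x - 0) < R \<and> norm (u x - u 0) < R} \<in> sets \<mu>"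
    by (simp, intro borel_open open_Collect_conj open_Collect_less continuous_intros continuous_u)
  from emeasure_mono[OF sub this] volume_bound[OF u_in R, of 0 0]
  have "emeasure \<mu> (near (gr 0) R) \<le> ennreal (volume_const CARD('n) \<Lambda> * unit_ball_vol CARD('n) * R ^ CARD('n))"
    by (meson order_trans)
  moreover have "0 \<le> volume_const CARD('n) \<Lambda> * unit_ball_vol CARD('n) * R ^ CARD('n)"
    using fvc_nonneg area_const_pos R by (simp add: volume_const_def)
  ultimately show "measure \<mu> (near (gr 0) R) \<le> volume_const CARD('n) \<Lambda> * unit_ball_vol CARD('n) * R ^ CARD('n)"
    using fin by (simp add: emeasure_eq_ennreal_measure)
qed

lemma form_growth:
  assumes R: "0 < R"
  shows "form R w w \<le> (norm w)\<^sup>2 * R\<^sup>2 * (volume_const CARD('n) \<Lambda> * unit_ball_vol CARD('n) * R ^ CARD('n))"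
proof -
  have "form R w w \<le> (\<integral>x. indicator (near (gr 0) R) x * ((norm w)\<^sup>2 * R\<^sup>2) \<partial>\<mu>)"
    unfolding form_def energy_def
  proof (intro integral_mono energy_integrable continuous_intros continuous_lin)
    fix x
    show "indicator (near (gr 0) R) x * (height w x * height w x) \<le> indicator (near (gr 0) R) x * ((norm w)\<^sup>2 * R\<^sup>2)"
    proof (cases "x \<in> near (gr 0) R")
      case True
      have "\<bar>height w x\<bar> \<le> norm w * norm (gr x - gr 0)" unfolding height_def by (rule Cauchy_Schwarz_ineq2)
      also have "\<dots> \<le> norm w * R" using True by (intro mult_left_mono) (auto simp: near_def dist_norm)
      finally have "\<bar>height w x\<bar>\<^sup>2 \<le> (norm w * R)\<^sup>2" by (intro power_mono) auto
      then show ?thesis using True by (simp add: power_mult_distrib power2_eq_square mult_ac)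
    qed simp
  qed
  also have "\<dots> = (norm w)\<^sup>2 * R\<^sup>2 * measure \<mu> (near (gr 0) R)" using measure_near_le(2)[OF R] by simp
  also have "\<dots> \<le> (norm w)\<^sup>2 * R\<^sup>2 * (volume_const CARD('n) \<Lambda> * unit_ball_vol CARD('n) * R ^ CARD('n))"
    by (intro mult_left_mono measure_near_le R) auto
  finally show ?thesis .
qed

lemma lin_square_le:
  assumes w: "w \<in> ambient m" and R: "0 < R" and x: "near (gr x) R \<subseteq> near (gr 0) R'"
  shows "(height w x)\<^sup>2 \<le> mean_value_const CARD('n) * 2 ^ CARD('n) / R ^ CARD('n) * form R' w w"
proof -
  have eq: "(w \<bullet> gr y + - (w \<bullet> gr 0))\<^sup>2 = height w y * height w y" for y
    by (simp add: height_def inner_diff_right power2_eq_square)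
  have "(height w x)\<^sup>2 \<le> mean_value_const CARD('n) / (R / 2) ^ CARD('n) * energy (gr x) (2 * (R / 2)) (\<lambda>y. height w y * height w y)"
    using mean_value_inequality[OF w, of "R / 2" x "- (w \<bullet> gr 0)"] R unfolding eq by (simp add: power2_eq_square)
  also have "\<dots> \<le> mean_value_const CARD('n) / (R / 2) ^ CARD('n) * form R' w w"
    unfolding form_def using mean_value_const_pos R x
    by (intro mult_left_mono energy_mono continuous_intros continuous_lin) auto
  also have "mean_value_const CARD('n) / (R / 2) ^ CARD('n) = mean_value_const CARD('n) * 2 ^ CARD('n) / R ^ CARD('n)"
    by (simp add: power_divide)
  finally show ?thesis .
qed

text \<open>
  The energy of a linear function on the ball of radius \<open>R\<close> grows at most like \<open>R\<^sup>n\<^sup>+\<^sup>2\<close>. Hence there is a scale \<open>R\<close> with functions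
  \<open>f i\<close> that are orthonormal on the ball of radius \<open>2 R\<close> and still have total energy at least \<open>k\<close> times a constant on the
  ball of radius \<open>R\<close>. At a point of the smaller ball the combination of the \<open>f i\<close> whose coefficients are their values
  there is a single function to which the mean value inequality applies; it bounds \<open>\<Sum> f i\<^sup>2\<close> by a constant times
  \<open>R\<^sup>-\<^sup>n\<close> for every \<open>k\<close>. Integrating and using the volume bound gives a bound on \<open>k\<close>.
\<close>

lemma flag_dimension_bound:
  assumes vg: "\<And>i. i < k \<Longrightarrow> v i \<in> range (\<lambda>x. gr x - gr 0)"
    and ind: "\<And>i. i < k \<Longrightarrow> v i \<notin> span (v ` {..<i})"
  shows "real k \<le> dim_const CARD('n) \<Lambda>"
proof -
  have vA: "v i \<in> ambient m" if "i < k" for i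
    using vg[OF that] by (auto simp: subspace_diff[OF subspace_ambient gr_ambient gr_ambient])
  have spA: "span (v ` {..<k}) \<subseteq> ambient m" using vA by (intro span_minimal subspace_ambient) auto
  \<comment> \<open>large enough that the unit balls about all the points that define the \<open>v i\<close> are inside, so the form is definite\<close>
  define R0 where "R0 = 1 + (\<Sum>i<k. norm (v i))"
  have vR: "norm (v i) + 1 \<le> R0" if "i < k" for i
    unfolding R0_def using member_le_sum[of i "{..<k}" "\<lambda>i. norm (v i)"] that by simp
  have R0: "0 < R0" by (simp add: R0_def add_pos_nonneg sum_nonneg)
  define B where "B j = form (2 ^ j * R0)" for j :: nat
  let ?V = "volume_const CARD('n) \<Lambda> * unit_ball_vol CARD('n)"
  have pos: "0 < B 0 w w" if w: "w \<in> span (v ` {..<k})" "w \<noteq> 0" for w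
  proof (rule ccontr)
    assume "\<not> 0 < B 0 w w"
    then have z: "form R0 w w = 0" using form_nonneg[of R0 w] by (simp add: B_def)
    have "orthogonal w y" if "y \<in> v ` {..<k}" for y
    proof -
      obtain i where i: "i < k" "y = v i" using \<open>y \<in> v ` {..<k}\<close> by auto
      obtain x where x: "v i = gr x - gr 0" using vg[OF i(1)] by auto
      have "near (gr x) 1 \<subseteq> near (gr 0) R0"
      proof
        fix y assume "y \<in> near (gr x) 1"
        then show "y \<in> near (gr 0) R0"
          using dist_triangle[of "gr y" "gr 0" "gr x"] vR[OF i(1)] by (simp add: near_def x dist_norm)
      qed
      from lin_square_le[OF _ _ this, of w] have "(height w x)\<^sup>2 \<le> 0" using w(1) spA z by auto
      then have "w \<bullet> v i = 0" by (simp add: height_def x)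
      then show ?thesis by (simp add: orthogonal_def i(2))
    qed
    then have "orthogonal w w" by (intro orthogonal_to_span[OF w(1)])
    then show False using w(2) by (simp add: orthogonal_def)
  qed
  define c where "c i = (norm (v i))\<^sup>2 * R0\<^sup>2 * (?V * R0 ^ CARD('n))" for i
  have growth: "B j (v i) (v i) \<le> c i * (2 ^ (CARD('n) + 2)) ^ j" for i j
  proof -
    have "B j (v i) (v i) \<le> (norm (v i))\<^sup>2 * (2 ^ j * R0)\<^sup>2 * (?V * (2 ^ j * R0) ^ CARD('n))"
      unfolding B_def using R0 by (intro form_growth) simp
    also have "\<dots> = c i * (2 ^ (CARD('n) + 2)) ^ j"
    proof -
      have "((2::real) ^ (CARD('n) + 2)) ^ j = (2 ^ j)\<^sup>2 * (2 ^ j) ^ CARD('n)"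
      proof -
        have "(CARD('n) + 2) * j = j * 2 + j * CARD('n)" by (simp add: algebra_simps)
        then show ?thesis by (simp only: power_mult[symmetric] power_add[symmetric])
      qed
      then show ?thesis by (simp add: c_def power_mult_distrib)
    qed
    finally show ?thesis .
  qed
  have "\<exists>j f. (\<forall>i<k. f i \<in> span (v ` {..<k})) \<and>
    (\<forall>i<k. \<forall>l<k. B (Suc j) (f i) (f l) = (if i = l then 1 else 0)) \<and>
    real k \<le> 2 * 2 ^ (CARD('n) + 2) * (\<Sum>i<k. B j (f i) (f i))"
  proof (rule slow_scale_orthonormal_family)
    show "bilinear (B j)" for j unfolding B_def by (rule form_bilinear)
    show "B j x y = B j y x" for j x y unfolding B_def by (rule form_sym)
    show "B j x x \<le> B (Suc j) x x" for j x unfolding B_def using R0 by (intro form_mono) simp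
    show "0 \<le> B j x x" for j x unfolding B_def by (rule form_nonneg)
    show "(0::real) < 2 ^ (CARD('n) + 2)" by simp
  qed (use pos ind growth in auto)
  then obtain j f where fs: "\<And>i. i < k \<Longrightarrow> f i \<in> span (v ` {..<k})"
    and on: "\<And>i l. i < k \<Longrightarrow> l < k \<Longrightarrow> B (Suc j) (f i) (f l) = (if i = l then 1 else 0)"
    and kle: "real k \<le> 2 * 2 ^ (CARD('n) + 2) * (\<Sum>i<k. B j (f i) (f i))" by blast
  define R where "R = 2 ^ j * R0"
  have R: "0 < R" using R0 by (simp add: R_def)
  define T where "T x = (\<Sum>i<k. height (f i) x * height (f i) x)" for x
  define D where "D = mean_value_const CARD('n) * 2 ^ CARD('n) / R ^ CARD('n)"
  have D0: "0 \<le> D" using mean_value_const_pos R by (simp add: D_def)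
  have TD: "T x \<le> D" if x: "x \<in> near (gr 0) R" for x
  proof (cases "T x = 0")
    case True
    then show ?thesis using D0 by simp
  next
    case False
    have T0: "0 \<le> T x" unfolding T_def by (intro sum_nonneg) auto
    \<comment> \<open>the function with value \<open>T x\<close> at \<open>x\<close> and energy \<open>T x\<close>, so that \<open>(T x)\<^sup>2 \<le> D T x\<close>\<close>
    define w where "w = (\<Sum>i<k. height (f i) x *\<^sub>R f i)"
    have wA: "w \<in> ambient m" using fs spA unfolding w_def
      by (intro subspace_sum[OF subspace_ambient] subspace_scale[OF subspace_ambient]) auto
    have wx: "height w x = T x" by (simp add: w_def T_def height_def inner_sum_left)
    have bil: "bilinear (B (Suc j))" unfolding B_def by (rule form_bilinear)
    have "B (Suc j) w w = (\<Sum>i<k. \<Sum>l<k. height (f i) x * (height (f l) x * B (Suc j) (f i) (f l)))"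
    proof -
      have "\<forall>b. linear (B (Suc j) b)" "\<forall>b. linear (\<lambda>a. B (Suc j) a b)"
        using bil unfolding bilinear_def by blast+
      note lin2 = this(1)[rule_format] and lin1 = this(2)[rule_format]
      have inner: "B (Suc j) (f i) w = (\<Sum>l<k. height (f l) x * B (Suc j) (f i) (f l))" for i
        by (simp add: w_def linear_sum[OF lin2] linear_scale[OF lin2])
      have "B (Suc j) w w = (\<Sum>i<k. height (f i) x * B (Suc j) (f i) w)"
        by (subst (1) w_def) (simp add: linear_sum[OF lin1] linear_scale[OF lin1])
      then show ?thesis unfolding inner by (simp add: sum_distrib_left)
    qed
    also have "\<dots> = (\<Sum>i<k. \<Sum>l<k. if i = l then height (f i) x * height (f i) x else 0)"
      by (intro sum.cong refl) (auto simp: on)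
    also have "\<dots> = T x" by (simp add: T_def)
    finally have Bw: "form (2 * R) w w = T x" by (simp add: B_def R_def mult.assoc)
    have "near (gr x) R \<subseteq> near (gr 0) (2 * R)"
    proof
      fix y assume "y \<in> near (gr x) R"
      then show "y \<in> near (gr 0) (2 * R)"
        using x dist_triangle[of "gr y" "gr 0" "gr x"] by (simp add: near_def)
    qed
    from lin_square_le[OF wA R this] have "T x * T x \<le> D * T x"
      by (simp add: Bw wx D_def power2_eq_square)
    then show ?thesis by (rule mult_right_le_imp_le) (use False T0 in simp)
  qed
  have "(\<Sum>i<k. B j (f i) (f i)) = (\<integral>x. indicator (near (gr 0) R) x * T x \<partial>\<mu>)"
  proof -
    have i: "integrable \<mu> (\<lambda>x. indicator (near (gr 0) R) x * (height a x * height a x))" for a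
      by (intro energy_integrable continuous_intros continuous_lin)
    show ?thesis unfolding T_def B_def R_def[symmetric] form_def energy_def sum_distrib_left
      by (subst Bochner_Integration.integral_sum) (rule i, rule refl)
  qed
  also have "\<dots> \<le> (\<integral>x. indicator (near (gr 0) R) x * D \<partial>\<mu>)"
    unfolding T_def[abs_def]
  proof (intro integral_mono energy_integrable continuous_intros continuous_lin)
    fix x show "indicator (near (gr 0) R) x * (\<Sum>i<k. height (f i) x * height (f i) x) \<le> indicator (near (gr 0) R) x * D"
      using TD[of x] by (auto simp: indicator_def T_def)
  qed
  also have "\<dots> = D * measure \<mu> (near (gr 0) R)" using measure_near_le(2)[OF R] by simp
  also have "\<dots> \<le> D * (?V * R ^ CARD('n))" using D0 by (intro mult_left_mono measure_near_le R)
  also have "\<dots> = mean_value_const CARD('n) * 2 ^ CARD('n) * ?V" using R by (simp add: D_def)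
  finally have "2 * 2 ^ (CARD('n) + 2) * (\<Sum>i<k. B j (f i) (f i)) \<le> dim_const CARD('n) \<Lambda>"
    unfolding dim_const_def by (intro mult_left_mono) auto
  then show ?thesis using kle by linarith
qed

end

section \<open>The theorem\<close>

context minimal_dilation_graph
begin

text \<open>
  A maximal independent set of differences of graph points spans the direction space, and enumerating it gives a
  flag.
\<close>

lemma graph_in_small_subspace:
  "\<exists>p S. p \<in> ambient m \<and> subspace S \<and> S \<subseteq> ambient m \<and> real (dim S) \<le> dim_const CARD('n) \<Lambda> \<and> graph_of u \<subseteq> (+) p ` S"
proof -
  let ?A = "range (\<lambda>x. gr x - gr 0)"
  obtain B where B: "B \<subseteq> ?A" "independent B" "?A \<subseteq> span B"
    using maximal_independent_subset[of ?A] by blast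
  define S where "S = span B"
  have BA: "B \<subseteq> ambient m" using B(1) by (auto simp: subspace_diff[OF subspace_ambient gr_ambient gr_ambient])
  have SA: "S \<subseteq> ambient m" unfolding S_def using BA by (intro span_minimal subspace_ambient)
  let ?T = "range (\<lambda>i. (axis i 1, 0) :: (real^'n) \<times> fin_seq) \<union> (\<lambda>a. (0, unit_seq a)) ` {..<m}"
  have "ambient m \<subseteq> span ?T"
  proof
    fix z :: "(real^'n) \<times> fin_seq" assume "z \<in> ambient m"
    then have s: "snd z \<in> coord_space m" by (auto simp: ambient_def)
    have "z = (\<Sum>i\<in>UNIV. (fst z $ i) *\<^sub>R (axis i 1, 0)) + (\<Sum>a<m. coord (snd z) a *\<^sub>R (0, unit_seq a))"
      using coord_space_expansion[OF s] basis_expansion[of "fst z", unfolded scalar_mult_eq_scaleR]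
      by (simp add: prod_eq_iff fst_sum snd_sum)
    also have "\<dots> \<in> span ?T" by (intro span_add span_sum span_scale span_base) auto
    finally show "z \<in> span ?T" .
  qed
  then have "finite B" using independent_span_bound[of ?T B] B(2) BA by auto
  then obtain v where v: "bij_betw v {..<card B} B" using ex_bij_betw_nat_finite[of B] by (auto simp: atLeast0LessThan)
  have vi: "v i \<in> B" if "i < card B" for i using v that by (auto simp: bij_betw_def)
  have "real (card B) \<le> dim_const CARD('n) \<Lambda>"
  proof (rule flag_dimension_bound)
    show "v i \<in> ?A" if "i < card B" for i using vi[OF that] B(1) by blast
    show "v i \<notin> span (v ` {..<i})" if i: "i < card B" for i
    proof
      assume a: "v i \<in> span (v ` {..<i})"
      have "v ` {..<i} \<subseteq> B - {v i}"
      proof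
        fix y assume "y \<in> v ` {..<i}"
        then obtain l where l: "l < i" "y = v l" by auto
        then have "v l \<noteq> v i" using v i by (auto simp: bij_betw_def inj_on_def)
        then show "y \<in> B - {v i}" using l i vi[of l] by simp
      qed
      then have "v i \<in> span (B - {v i})" using a span_mono by blast
      then show False using B(2) vi[OF i] unfolding dependent_def by blast
    qed
  qed
  moreover have "dim S = card B" unfolding S_def dim_span by (rule dim_eq_card_independent[OF B(2)])
  moreover have "graph_of u \<subseteq> (+) (gr 0) ` S"
    unfolding graph_eq
  proof (rule image_subsetI)
    fix x
    have "gr x - gr 0 \<in> S" using B(3) by (auto simp: S_def)
    then show "gr x \<in> (+) (gr 0) ` S" by (intro image_eqI[of _ _ "gr x - gr 0"]) auto
  qed
  ultimately show ?thesis using SA gr_ambient[of 0] by (intro exI[of _ "gr 0"] exI[of _ S]) (auto simp: S_def)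
qed

lemma hausdorff_ball_bound:
  assumes z: "z \<in> ambient m" and r: "0 < r"
  shows "emeasure H (graph_of u \<inter> ball z r) \<le> ennreal (volume_const CARD('n) \<Lambda> * unit_ball_vol CARD('n) * r ^ CARD('n))"
proof -
  let ?W = "{x. norm (x - fst z) < r \<and> norm (u x - snd z) < r}"
  have Wb: "?W \<in> sets borel"
    by (intro borel_open open_Collect_conj open_Collect_less continuous_intros continuous_u)
  have "graph_of u \<inter> ball z r \<subseteq> gr ` ?W"
  proof
    fix y assume y: "y \<in> graph_of u \<inter> ball z r"
    then obtain x where x: "y = gr x" by (auto simp: graph_eq)
    have "x \<in> ?W" using y dist_fst_le[of "gr x" z] dist_snd_le[of "gr x" z] by (simp add: x dist_norm norm_minus_commute)
    then show "y \<in> gr ` ?W" using x by blast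
  qed
  then have "emeasure H (graph_of u \<inter> ball z r) \<le> hausdorff_outer CARD('n) (gr ` ?W)"
    using graph_borel by (subst emeasure_hausdorff_measure) (auto intro: hausdorff_outer_mono)
  also have "\<dots> = emeasure \<mu> ?W" by (rule emeasure_\<mu>[OF Wb, symmetric])
  also have "\<dots> \<le> ennreal (volume_const CARD('n) \<Lambda> * unit_ball_vol CARD('n) * r ^ CARD('n))"
    using z by (intro volume_bound r) (auto simp: ambient_def)
  finally show ?thesis .
qed

end

theorem lemma3p2:
  fixes \<Lambda> :: real
  shows "\<exists>C::real. C \<ge> 1 \<and>
    (\<forall>m \<ge> (2::nat). \<forall>u :: real ^ 'n \<Rightarrow> fin_seq.
       minimal_graph m u \<longrightarrow>
       (AE x in lebesgue. u differentiable at x \<longrightarrow>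
          two_dilation (frechet_derivative u (at x)) \<le> \<Lambda>) \<longrightarrow>
       (\<exists>p S. p \<in> ambient m \<and> subspace S \<and> S \<subseteq> ambient m \<and> real (dim S) \<le> C \<and>
          graph_of u \<subseteq> (+) p ` S) \<and>
       (\<forall>z \<in> ambient m. \<forall>r > 0.
          emeasure (hausdorff_measure CARD('n)) (graph_of u \<inter> ball z r)
            \<le> ennreal (C * unit_ball_vol (real CARD('n)) * r ^ CARD('n))))"
proof -
  \<comment> \<open>a negative \<open>\<Lambda>\<close> is replaced by \<open>0\<close> so that \<open>sqrt \<Lambda>\<close> and the constants are nonnegative\<close>
  define C where "C = Max {1, dim_const CARD('n) (max \<Lambda> 0), volume_const CARD('n) (max \<Lambda> 0)}"
  have C: "1 \<le> C" "dim_const CARD('n) (max \<Lambda> 0) \<le> C" "volume_const CARD('n) (max \<Lambda> 0) \<le> C"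
    by (auto simp: C_def)
  show ?thesis
  proof (intro exI[of _ C] conjI[OF C(1)] allI impI)
    fix m :: nat and u :: "real ^ 'n \<Rightarrow> fin_seq"
    assume min: "minimal_graph m u"
      and dil: "AE x in lebesgue. u differentiable at x \<longrightarrow> two_dilation (frechet_derivative u (at x)) \<le> \<Lambda>"
    interpret minimal_dilation_graph m u "max \<Lambda> 0"
    proof
      show "AE x in lebesgue. u differentiable at x \<longrightarrow> two_dilation (frechet_derivative u (at x)) \<le> max \<Lambda> 0"
        using dil by eventually_elim auto
    qed (use min in \<open>auto simp: minimal_graph_def\<close>)
    show "(\<exists>p S. p \<in> ambient m \<and> subspace S \<and> S \<subseteq> ambient m \<and> real (dim S) \<le> C \<and>
          graph_of u \<subseteq> (+) p ` S) \<and>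
       (\<forall>z \<in> ambient m. \<forall>r > 0.
          emeasure (hausdorff_measure CARD('n)) (graph_of u \<inter> ball z r)
            \<le> ennreal (C * unit_ball_vol (real CARD('n)) * r ^ CARD('n)))"
    proof (intro conjI ballI allI impI)
      show "\<exists>p S. p \<in> ambient m \<and> subspace S \<and> S \<subseteq> ambient m \<and> real (dim S) \<le> C \<and> graph_of u \<subseteq> (+) p ` S"
        using graph_in_small_subspace C(2) by (meson order_trans)
      fix z :: "(real ^ 'n) \<times> fin_seq" and r :: real assume z: "z \<in> ambient m" and r: "0 < r"
      have "emeasure H (graph_of u \<inter> ball z r) \<le> ennreal (volume_const CARD('n) (max \<Lambda> 0) * unit_ball_vol CARD('n) * r ^ CARD('n))"
        by (rule hausdorff_ball_bound[OF z r])
      also have "\<dots> \<le> ennreal (C * unit_ball_vol CARD('n) * r ^ CARD('n))"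
        using C(3) r by (intro ennreal_leI mult_right_mono) auto
      finally show "emeasure H (graph_of u \<inter> ball z r) \<le> ennreal (C * unit_ball_vol CARD('n) * r ^ CARD('n))" .
    qed
  qed
qed

end
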